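(* Let $\mathcal{H}$ be a complex separable Hilbert space and $X\subset\mathbb{R}^d$ a relatively separated set. Let $\nu$ be an admissible weight on $\mathbb{R}^d$ which satisfies the weak growth condition $$\nu(x)\ge C(1+|x|)^\delta\qquad(x\in\mathbb{R}^d)\quad\text{for some }\delta\in(0,1],\ C>0.$$ Then for every $\alpha=(\alpha_j)_{j=1}^d\in\mathbb{N}_0^d$, the class of $\mathcal{B}(\mathcal{H})$-valued matrices $[A_{k,l}]_{k,l\in X}$ satisfying $$\sup_{k\in X}\sum_{l\in X}\prod_{j=1}^d(1+|k_j-l_j|)^{\alpha_j}\|A_{k,l}\|\nu(k-l)<\infty\quad\text{and}\quad \sup_{l\in X}\sum_{k\in X}\prod_{j=1}^d(1+|k_j-l_j|)^{\alpha_j}\|A_{k,l}\|\nu(k-l)<\infty$$ is (with respect to a suitable norm) a solid unital Banach *-algebra which is inverse-closed in $\mathcal{B}(\ell^2(X;\mathcal{H}))$ and thus symmetric.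
   Context: $|\cdot|$ is the Euclidean norm on $\mathbb{R}^d$ (absolute value on coordinates), $k_j$ the $j$-th coordinate of $k\in X\subset\mathbb{R}^d$. A countable set $X\subset\mathbb{R}^d$ is relatively separated if $\sup_{x\in\mathbb{R}^d}|X\cap(x+[0,1]^d)|<\infty$ (cardinality). $\ell^2(X;\mathcal{H})$ is the Hilbert space of families $(f_k)_{k\in X}$ in $\mathcal{H}$ with $\sum_k\|f_k\|^2<\infty$. Matrices act by $A(f_l)_l=(\sum_lA_{k,l}f_l)_k$, which identifies the class with a subalgebra of $\mathcal{B}(\ell^2(X;\mathcal{H}))$; multiplication is $[AB]_{k,l}=\sum_nA_{k,n}B_{n,l}$ and involution is $[A^*]_{k,l}=(A_{l,k})^*$. A weight is a continuous function $\nu:\mathbb{R}^d\to(0,\infty)$. It is admissible if (a) $\nu(x)=e^{\rho(\|x\|)}$ for some norm $\|\cdot\|$ on $\mathbb{R}^d$ and some continuous concave $\rho:[0,\infty)\to[0,\infty)$ with $\rho(0)=0$, and (b) $\lim_{n\to\infty}\nu(nz)^{1/n}=1$ for all $z\in\mathbb{R}^d$. A Banach *-algebra is a complex Banach algebra with isometric involution. A normed space $\mathcal{A}$ of $\mathcal{B}(\mathcal{H})$-valued matrices is solid if, whenever $A\in\mathcal{A}$ and $\|B_{k,l}\|\le\|A_{k,l}\|$ for all $k,l$, then $B\in\mathcal{A}$ and $\|B\|_{\mathcal{A}}\le\|A\|_{\mathcal{A}}$. $\mathcal{A}\subseteq\mathcal{B}$ (common identity) is inverse-closed in $\mathcal{B}$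 if $A\in\mathcal{A}$ invertible in $\mathcal{B}$ implies $A^{-1}\in\mathcal{A}$. $\mathcal{A}$ is symmetric if the spectrum $\sigma_{\mathcal{A}}(A^*A)\subseteq[0,\infty)$ for all $A\in\mathcal{A}$. *)

theory Defs
  imports "HOL-Analysis.Analysis" "HOL-Algebra.Module"
begin

section \<open>Complex Hilbert spaces and their bounded operators\<close>

text \<open>
  The real inner product of the superclass is the real part of the complex one, so the norm,
  the metric and the topology are those of the complex Hilbert space.
  The complex inner product is linear in its first argument.
\<close>

class chilbert_space = real_inner + banach +
  fixes scaleC :: "complex \<Rightarrow> 'a \<Rightarrow> 'a" (infixr "*\<^sub>C" 75)
    and cinner :: "'a \<Rightarrow> 'a \<Rightarrow> complex"
  assumes scaleC_add_right: "c *\<^sub>C (x + y) = c *\<^sub>C x + c *\<^sub>C y"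
    and scaleC_add_left: "(c + d) *\<^sub>C x = c *\<^sub>C x + d *\<^sub>C x"
    and scaleC_scaleC: "c *\<^sub>C d *\<^sub>C x = (c * d) *\<^sub>C x"
    and scaleC_of_real: "complex_of_real r *\<^sub>C x = r *\<^sub>R x"
    and cinner_add_left: "cinner (x + y) z = cinner x z + cinner y z"
    and cinner_scaleC_left: "cinner (c *\<^sub>C x) y = c * cinner x y"
    and cinner_commute: "cinner x y = cnj (cinner y x)"
    and Re_cinner: "Re (cinner x y) = inner x y"
begin

lemma cinner_self: "cinner x x = complex_of_real ((norm x)\<^sup>2)"
proof (rule complex_eqI)
  show "Re (cinner x x) = Re (complex_of_real ((norm x)\<^sup>2))"
    by (simp add: Re_cinner power2_norm_eq_inner)
  have "Im (cinner x x) = - Im (cinner x x)"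
    by (subst cinner_commute) simp
  then show "Im (cinner x x) = Im (complex_of_real ((norm x)\<^sup>2))"
    by simp
qed

lemma norm_scaleC: "norm (c *\<^sub>C x) = cmod c * norm x"
proof -
  have "cinner (c *\<^sub>C x) (c *\<^sub>C x) = c * cnj (cinner (c *\<^sub>C x) x)"
    by (subst cinner_scaleC_left, subst cinner_commute) simp
  also have "\<dots> = (c * cnj c) * cnj (cinner x x)"
    by (simp add: cinner_scaleC_left)
  also have "\<dots> = complex_of_real ((cmod c * norm x)\<^sup>2)"
    by (simp only: cinner_self complex_norm_square[symmetric] complex_cnj_complex_of_real
        of_real_mult[symmetric] power_mult_distrib)
  finally have "(norm (c *\<^sub>C x))\<^sup>2 = (cmod c * norm x)\<^sup>2"
    by (simp only: cinner_self of_real_eq_iff)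
  then show ?thesis
    by (simp add: power2_eq_iff_nonneg)
qed

end

lemma bounded_linear_scaleC: "bounded_linear (\<lambda>x::'h::chilbert_space. c *\<^sub>C x)"
proof (rule bounded_linear_intro[where K = "cmod c"])
  fix r :: real and x :: 'h
  show "c *\<^sub>C (r *\<^sub>R x) = r *\<^sub>R (c *\<^sub>C x)"
    by (simp add: scaleC_of_real[symmetric] scaleC_scaleC mult.commute)
qed (simp_all add: scaleC_add_right norm_scaleC)

lift_definition scaleC_blinfun ::
  "complex \<Rightarrow> ('h::chilbert_space \<Rightarrow>\<^sub>L 'h) \<Rightarrow> ('h \<Rightarrow>\<^sub>L 'h)" is "\<lambda>c T x. c *\<^sub>C T x"
  by (rule bounded_linear_compose[OF bounded_linear_scaleC])

text \<open>
  The type \<open>'h \<Rightarrow>\<^sub>L 'h\<close> contains all bounded \<^emph>\<open>real\<close>-linear operators; the following set is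
  \<open>B(H)\<close>. The norm of \<open>'h \<Rightarrow>\<^sub>L 'h\<close> restricts to the usual operator norm.
\<close>

definition bounded_ops :: "('h::chilbert_space \<Rightarrow>\<^sub>L 'h) set" where
  "bounded_ops = {T. \<forall>c x. blinfun_apply T (c *\<^sub>C x) = c *\<^sub>C blinfun_apply T x}"

definition adjoint_op :: "('h::chilbert_space \<Rightarrow>\<^sub>L 'h) \<Rightarrow> ('h \<Rightarrow>\<^sub>L 'h)" where
  "adjoint_op T = (THE S. \<forall>x y. cinner (blinfun_apply T x) y = cinner x (blinfun_apply S y))"


section \<open>Banach star-algebras, symmetry and inverse-closedness\<close>

definition complex_field :: "complex ring" where
  "complex_field = \<lparr>carrier = UNIV, mult = (*), one = 1, zero = 0, add = (+)\<rparr>"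

record 'a star_algebra = "(complex, 'a) module" +
  star :: "'a \<Rightarrow> 'a"
  anorm :: "'a \<Rightarrow> real"

text \<open>
  A unital Banach algebra is normalised by \<open>\<parallel>1\<parallel> = 1\<close>, except that the zero algebra
  (which occurs if \<open>X\<close> is empty or \<open>H\<close> is zero) is admitted.
\<close>

locale unital_banach_star_algebra =
  ring A + Module.module complex_field A for A :: "'a star_algebra" (structure) +
  assumes smult_mult_left: "\<lbrakk>a \<in> carrier A; b \<in> carrier A\<rbrakk> \<Longrightarrow>
      (c \<odot>\<^bsub>A\<^esub> a) \<otimes>\<^bsub>A\<^esub> b = c \<odot>\<^bsub>A\<^esub> (a \<otimes>\<^bsub>A\<^esub> b)"
    and smult_mult_right: "\<lbrakk>a \<in> carrier A; b \<in> carrier A\<rbrakk> \<Longrightarrow>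
      a \<otimes>\<^bsub>A\<^esub> (c \<odot>\<^bsub>A\<^esub> b) = c \<odot>\<^bsub>A\<^esub> (a \<otimes>\<^bsub>A\<^esub> b)"
    and anorm_nonneg: "a \<in> carrier A \<Longrightarrow> 0 \<le> anorm A a"
    and anorm_eq_zero: "a \<in> carrier A \<Longrightarrow> anorm A a = 0 \<longleftrightarrow> a = \<zero>\<^bsub>A\<^esub>"
    and anorm_add: "\<lbrakk>a \<in> carrier A; b \<in> carrier A\<rbrakk> \<Longrightarrow>
      anorm A (a \<oplus>\<^bsub>A\<^esub> b) \<le> anorm A a + anorm A b"
    and anorm_smult: "a \<in> carrier A \<Longrightarrow> anorm A (c \<odot>\<^bsub>A\<^esub> a) = cmod c * anorm A a"
    and anorm_mult: "\<lbrakk>a \<in> carrier A; b \<in> carrier A\<rbrakk> \<Longrightarrow>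
      anorm A (a \<otimes>\<^bsub>A\<^esub> b) \<le> anorm A a * anorm A b"
    and anorm_one: "\<one>\<^bsub>A\<^esub> \<noteq> \<zero>\<^bsub>A\<^esub> \<Longrightarrow> anorm A \<one>\<^bsub>A\<^esub> = 1"
    and complete: "\<lbrakk>\<And>n::nat. s n \<in> carrier A;
        \<And>e. 0 < e \<Longrightarrow> \<exists>M. \<forall>m\<ge>M. \<forall>n\<ge>M. anorm A (s m \<ominus>\<^bsub>A\<^esub> s n) < e\<rbrakk> \<Longrightarrow>
      \<exists>a\<in>carrier A. (\<lambda>n. anorm A (s n \<ominus>\<^bsub>A\<^esub> a)) \<longlonglongrightarrow> 0"
    and star_closed: "a \<in> carrier A \<Longrightarrow> star A a \<in> carrier A"
    and star_star: "a \<in> carrier A \<Longrightarrow> star A (star A a) = a"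
    and star_add: "\<lbrakk>a \<in> carrier A; b \<in> carrier A\<rbrakk> \<Longrightarrow>
      star A (a \<oplus>\<^bsub>A\<^esub> b) = star A a \<oplus>\<^bsub>A\<^esub> star A b"
    and star_smult: "a \<in> carrier A \<Longrightarrow> star A (c \<odot>\<^bsub>A\<^esub> a) = cnj c \<odot>\<^bsub>A\<^esub> star A a"
    and star_mult: "\<lbrakk>a \<in> carrier A; b \<in> carrier A\<rbrakk> \<Longrightarrow>
      star A (a \<otimes>\<^bsub>A\<^esub> b) = star A b \<otimes>\<^bsub>A\<^esub> star A a"
    and anorm_star: "a \<in> carrier A \<Longrightarrow> anorm A (star A a) = anorm A a"

definition algebra_spectrum :: "(complex, 'a, 'm) module_scheme \<Rightarrow> 'a \<Rightarrow> complex set" where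
  "algebra_spectrum A a = {c. (c \<odot>\<^bsub>A\<^esub> \<one>\<^bsub>A\<^esub>) \<ominus>\<^bsub>A\<^esub> a \<notin> Units A}"

definition symmetric_algebra :: "'a star_algebra \<Rightarrow> bool" where
  "symmetric_algebra A \<longleftrightarrow>
     (\<forall>a\<in>carrier A. algebra_spectrum A (star A a \<otimes>\<^bsub>A\<^esub> a) \<subseteq> \<real>\<^sub>\<ge>\<^sub>0)"

text \<open>
  The map \<open>\<phi>\<close> identifies \<open>A\<close> with a subalgebra of \<open>B\<close> that has the same identity
  (\<^const>\<open>ring_hom\<close> includes preservation of the identity).
\<close>

definition subalgebra_via ::
  "('a \<Rightarrow> 'b) \<Rightarrow> (complex, 'a, 'm) module_scheme \<Rightarrow> (complex, 'b, 'n) module_scheme \<Rightarrow> bool" where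
  "subalgebra_via \<phi> A B \<longleftrightarrow> \<phi> \<in> ring_hom A B \<and> inj_on \<phi> (carrier A) \<and>
     (\<forall>c. \<forall>a\<in>carrier A. \<phi> (c \<odot>\<^bsub>A\<^esub> a) = c \<odot>\<^bsub>B\<^esub> \<phi> a)"

definition inverse_closed_via ::
  "('a \<Rightarrow> 'b) \<Rightarrow> (complex, 'a, 'm) module_scheme \<Rightarrow> (complex, 'b, 'n) module_scheme \<Rightarrow> bool" where
  "inverse_closed_via \<phi> A B \<longleftrightarrow> subalgebra_via \<phi> A B \<and>
     (\<forall>a\<in>carrier A. \<phi> a \<in> Units B \<longrightarrow> inv\<^bsub>B\<^esub> (\<phi> a) \<in> \<phi> ` carrier A)"


section \<open>The algebra of bounded operators on \<open>\<ell>\<^sup>2(X; H)\<close>\<close>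

text \<open>Families indexed by \<open>X\<close> are functions that vanish outside \<open>X\<close>.\<close>

definition ell2 :: "'i set \<Rightarrow> ('i \<Rightarrow> 'h::chilbert_space) set" where
  "ell2 X = {f. (\<forall>k. k \<notin> X \<longrightarrow> f k = 0) \<and> (\<lambda>k. (norm (f k))\<^sup>2) summable_on X}"

definition ell2_norm :: "'i set \<Rightarrow> ('i \<Rightarrow> 'h::chilbert_space) \<Rightarrow> real" where
  "ell2_norm X f = sqrt (\<Sum>\<^sub>\<infinity>k\<in>X. (norm (f k))\<^sup>2)"

definition ell2_operators ::
  "'i set \<Rightarrow> (complex, ('i \<Rightarrow> 'h::chilbert_space) \<Rightarrow> ('i \<Rightarrow> 'h)) module" where
  "ell2_operators X = \<lparr>
     carrier = {T \<in> ell2 X \<rightarrow>\<^sub>E ell2 X.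
       (\<forall>f\<in>ell2 X. \<forall>g\<in>ell2 X. T (\<lambda>k. f k + g k) = (\<lambda>k. T f k + T g k)) \<and>
       (\<forall>c. \<forall>f\<in>ell2 X. T (\<lambda>k. c *\<^sub>C f k) = (\<lambda>k. c *\<^sub>C T f k)) \<and>
       (\<exists>K. \<forall>f\<in>ell2 X. ell2_norm X (T f) \<le> K * ell2_norm X f)},
     mult = compose (ell2 X),
     one = (\<lambda>f\<in>ell2 X. f),
     zero = (\<lambda>f\<in>ell2 X. \<lambda>k. 0),
     add = (\<lambda>S T. \<lambda>f\<in>ell2 X. \<lambda>k. S f k + T f k),
     smult = (\<lambda>c T. \<lambda>f\<in>ell2 X. \<lambda>k. c *\<^sub>C T f k)\<rparr>"


section \<open>Operator-valued matrices\<close>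

type_synonym ('i, 'h) op_matrix = "'i \<Rightarrow> 'i \<Rightarrow> ('h \<Rightarrow>\<^sub>L 'h)"

definition op_matrices :: "'i set \<Rightarrow> ('i, 'h::chilbert_space) op_matrix set" where
  "op_matrices X =
     {A. (\<forall>k l. A k l \<in> bounded_ops) \<and> (\<forall>k l. k \<notin> X \<or> l \<notin> X \<longrightarrow> A k l = 0)}"

definition matrix_algebra ::
  "'i set \<Rightarrow> ('i, 'h::chilbert_space) op_matrix set \<Rightarrow> (('i, 'h) op_matrix \<Rightarrow> real) \<Rightarrow>
     ('i, 'h) op_matrix star_algebra" where
  "matrix_algebra X \<A> N = \<lparr>
     carrier = \<A>,
     mult = (\<lambda>A B k l. \<Sum>\<^sub>\<infinity>n\<in>X. A k n o\<^sub>L B n l),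
     one = (\<lambda>k l. if k = l \<and> k \<in> X then id_blinfun else 0),
     zero = (\<lambda>k l. 0),
     add = (\<lambda>A B k l. A k l + B k l),
     smult = (\<lambda>c A k l. scaleC_blinfun c (A k l)),
     star = (\<lambda>A k l. adjoint_op (A l k)),
     anorm = N\<rparr>"

definition matrix_operator ::
  "'i set \<Rightarrow> ('i, 'h::chilbert_space) op_matrix \<Rightarrow> ('i \<Rightarrow> 'h) \<Rightarrow> ('i \<Rightarrow> 'h)" where
  "matrix_operator X A = (\<lambda>f\<in>ell2 X. \<lambda>k. \<Sum>\<^sub>\<infinity>l\<in>X. blinfun_apply (A k l) (f l))"

definition solid :: "'i set \<Rightarrow> ('i, 'h::chilbert_space) op_matrix star_algebra \<Rightarrow> bool" where
  "solid X \<A> \<longleftrightarrow> (\<forall>A\<in>carrier \<A>. \<forall>B\<in>op_matrices X.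
     (\<forall>k\<in>X. \<forall>l\<in>X. norm (B k l) \<le> norm (A k l)) \<longrightarrow>
       B \<in> carrier \<A> \<and> anorm \<A> B \<le> anorm \<A> A)"


section \<open>Relatively separated sets, weights and the weighted Schur class\<close>

definition relatively_separated :: "(real^'d) set \<Rightarrow> bool" where
  "relatively_separated X \<longleftrightarrow> countable X \<and>
     (\<exists>n. \<forall>x. finite (X \<inter> (+) x ` cbox 0 1) \<and> card (X \<inter> (+) x ` cbox 0 1) \<le> n)"

definition is_norm :: "('a::real_vector \<Rightarrow> real) \<Rightarrow> bool" where
  "is_norm p \<longleftrightarrow> (\<forall>x. 0 \<le> p x) \<and> (\<forall>x. p x = 0 \<longleftrightarrow> x = 0) \<and>
     (\<forall>r x. p (r *\<^sub>R x) = \<bar>r\<bar> * p x) \<and> (\<forall>x y. p (x + y) \<le> p x + p y)"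

definition weight :: "(real^'d \<Rightarrow> real) \<Rightarrow> bool" where
  "weight \<nu> \<longleftrightarrow> continuous_on UNIV \<nu> \<and> (\<forall>x. 0 < \<nu> x)"

definition admissible_weight :: "(real^'d \<Rightarrow> real) \<Rightarrow> bool" where
  "admissible_weight \<nu> \<longleftrightarrow> weight \<nu> \<and>
     (\<exists>p \<rho>. is_norm p \<and> continuous_on {0..} \<rho> \<and> concave_on {0..} \<rho> \<and>
        (\<forall>t\<ge>0. 0 \<le> \<rho> t) \<and> \<rho> 0 = 0 \<and> (\<forall>x. \<nu> x = exp (\<rho> (p x)))) \<and>
     (\<forall>z. (\<lambda>n. root n (\<nu> (real n *\<^sub>R z))) \<longlonglongrightarrow> 1)"

text \<open>The suprema and sums are formed in \<open>[0, \<infinity>]\<close>.\<close>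

definition schur_class ::
  "(real^'d) set \<Rightarrow> (real^'d \<Rightarrow> real) \<Rightarrow> ('d \<Rightarrow> nat) \<Rightarrow> (real^'d, 'h::chilbert_space) op_matrix set"
where
  "schur_class X \<nu> \<alpha> = {A \<in> op_matrices X.
     (SUP k\<in>X. \<Sum>\<^sub>\<infinity>l\<in>X. ennreal ((\<Prod>j\<in>UNIV. (1 + \<bar>k $ j - l $ j\<bar>) ^ \<alpha> j) * norm (A k l) * \<nu> (k - l))) < \<infinity> \<and>
     (SUP l\<in>X. \<Sum>\<^sub>\<infinity>k\<in>X. ennreal ((\<Prod>j\<in>UNIV. (1 + \<bar>k $ j - l $ j\<bar>) ^ \<alpha> j) * norm (A k l) * \<nu> (k - l))) < \<infinity>}"

end

theory Submission
  imports Defs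
begin

text \<open>
  Write \<open>W k l = \<omega> (k - l)\<close> with \<open>\<omega> x = \<nu> x * (\<Prod>j. (1 + \<bar>x $ j\<bar>) ^ \<alpha> j)\<close>. Since \<open>\<omega>\<close> is submultiplicative,
  the larger of the two suprema is an algebra norm, and Schur's test bounds the operator norm by it.

  For inverse-closedness let \<open>T\<close> in the algebra be bounded below on \<open>\<ell>\<^sup>2(X; H)\<close>. For large \<open>K\<close> the
  matrix \<open>R = 1 - T\<^sup>*T / K\<^sup>2\<close> is a strict contraction, \<open>\<parallel>R\<parallel> \<le> q < 1\<close>, and it is enough to show that
  some power of \<open>R\<close> has norm less than 1 in the algebra: then the Neumann series inverts \<open>T\<^sup>*T\<close>
  and \<open>T\<close> has a left inverse in the algebra. For each \<open>S\<close> there is an equivalent submultiplicative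
  weight that is bounded by 4 on the cube of size \<open>S\<close> and by \<open>c S\<^sup>-\<^sup>\<delta> \<omega>\<close> outside of it. As a cube
  contains \<open>O(S\<^sup>d)\<close> points of \<open>X\<close> and matrix entries are bounded by the operator norm, \<open>R\<^sup>n\<close> has norm
  \<open>O(S\<^sup>d q\<^sup>n + S\<^sup>-\<^sup>\<delta> \<parallel>R\<^sup>n\<parallel>)\<close> with respect to that weight. This norm dominates the \<open>n\<close>-th power of the
  spectral radius \<open>r\<close>, and letting \<open>S\<close> grow exponentially in \<open>n\<close> at a small rate gives \<open>r < 1\<close>.

  Symmetry follows in the same way, because \<open>\<lambda> - A\<^sup>*A\<close> and its adjoint are bounded below unless
  \<open>\<lambda> \<ge> 0\<close>.
\<close>

section \<open>Adjoint operators\<close>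

text \<open>The obstacle is that \<nu> may outgrow every polynomial: cutting the norm of
  \<open>R^n\<close> at a cube would cost the maximum of \<nu> on it, which \<open>q^n\<close>
  cannot absorb when the cube grows exponentially. Hence the weight varies with \<open>S\<close>.
  Equivalent weights give the same spectral radius, and the constant of equivalence, uncontrolled in
  \<open>S\<close>, disappears when \<open>S\<close> and \<open>n\<close> are fixed and high powers
  of \<open>R^n\<close> are taken. The root condition on \<nu> makes \<rho> flat far out, and a
  shift of its argument moves this flat part to the origin; the growth condition is the source of
  the factor with exponent \<open>- \<delta>\<close>. The polynomial factor need not be a function
  of a norm and is flattened separately, by a dilation.

  Invertibility is used in the form of lower bounds: they are read off from a bounded inverse or
  from the numerical range, and norm identities turn them into contractions. Only left inverses are
  built; the other side comes from the given inverse or from the adjoint.\<close>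

lemma scaleC_zero_left [simp]: "0 *\<^sub>C (x::'h::chilbert_space) = 0"
  using scaleC_of_real[of 0 x] by simp

lemma scaleC_zero_right [simp]: "c *\<^sub>C (0::'h::chilbert_space) = 0"
  using norm_scaleC[of c "0::'h"] by simp

lemma scaleC_one [simp]: "1 *\<^sub>C (x::'h::chilbert_space) = x"
  using scaleC_of_real[of 1 x] by simp

lemma scaleC_minus1 [simp]: "(-1) *\<^sub>C (x::'h::chilbert_space) = - x"
  using scaleC_of_real[of "-1" x] by simp

lemma scaleC_minus_right: "c *\<^sub>C (- x::'h::chilbert_space) = - (c *\<^sub>C x)"
  using scaleC_add_right[of c x "-x"] by (simp add: eq_neg_iff_add_eq_0 add.commute)

lemma scaleC_diff_right: "c *\<^sub>C (x - y::'h::chilbert_space) = c *\<^sub>C x - c *\<^sub>C y"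
  using scaleC_add_right[of c x "-y"] by (simp add: scaleC_minus_right)

lemma cinner_scaleC_right: "cinner x (c *\<^sub>C y) = cnj c * cinner x (y::'h::chilbert_space)"
  by (subst (1 2) cinner_commute) (simp add: cinner_scaleC_left)

text \<open>Rotating one argument by \<open>\<i>\<close> turns imaginary parts into real inner
  products. Complex identities below are checked through real ones in this way, and Riesz
  representation is applied to real functionals.\<close>

lemma Im_cinner: "Im (cinner x y) = - inner (\<i> *\<^sub>C x) (y::'h::chilbert_space)"
  by (simp add: Re_cinner[symmetric] cinner_scaleC_left)

lemma inner_scaleC_scaleC:
  "inner (c *\<^sub>C x) y = inner x (cnj c *\<^sub>C (y::'h::chilbert_space))"
  by (simp add: Re_cinner[symmetric] cinner_scaleC_left cinner_scaleC_right)

text \<open>The representing vector minimises \<open>\<parallel>x\<parallel>\<^sup>2 - 2 f x\<close>; minimising sequences are Cauchy by the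
  parallelogram law.\<close>

lemma riesz_representation:
  fixes f :: "'h::{real_inner,banach} \<Rightarrow> real"
  assumes "bounded_linear f"
  shows "\<exists>y. \<forall>x. f x = inner x y"
proof -
  interpret f: bounded_linear f by fact
  define J where "J x = (norm x)\<^sup>2 - 2 * f x" for x
  obtain K where K: "\<And>x. norm (f x) \<le> norm x * K"
    using f.bounded by blast
  have J_lower: "- K\<^sup>2 \<le> J x" for x
  proof -
    have "f x \<le> norm x * K" using K[of x] by simp
    moreover have "0 \<le> (norm x - K)\<^sup>2" by simp
    ultimately show ?thesis by (simp add: J_def power2_diff)
  qed
  define m where "m = (INF x. J x)"
  have bdd: "bdd_below (range J)" by (rule bdd_belowI2) (rule J_lower)
  have m_le: "m \<le> J x" for x unfolding m_def by (rule cINF_lower[OF bdd]) simp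
  have "\<exists>x. J x < m + 1 / real (Suc n)" for n
  proof (rule ccontr)
    assume "\<not> ?thesis"
    then have "m + 1 / real (Suc n) \<le> m"
      unfolding m_def by (intro cINF_greatest) (auto simp: not_less)
    then show False by (simp add: field_simps)
  qed
  then obtain s where s: "\<And>n. J (s n) < m + 1 / real (Suc n)" by metis
  have close: "(norm (x - y))\<^sup>2 \<le> 2 * (J x - m) + 2 * (J y - m)" for x y
  proof -
    have *: "(norm (x - y))\<^sup>2 = 2 * (norm x)\<^sup>2 + 2 * (norm y)\<^sup>2 - 4 * (norm ((1/2) *\<^sub>R (x + y)))\<^sup>2"
      by (simp add: power2_norm_eq_inner inner_simps inner_commute algebra_simps)
    define z where "z = (1/2) *\<^sub>R (x + y)"
    have "f z = (f x + f y) / 2"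
      by (simp add: z_def f.scaleR f.add)
    then have "(norm (x - y))\<^sup>2 = 2 * J x + 2 * J y - 4 * J z"
      unfolding * J_def z_def[symmetric] by simp
    then show ?thesis using mult_left_mono[OF m_le[of z], of 4] by (simp add: right_diff_distrib)
  qed
  have "Cauchy s"
  proof (rule metric_CauchyI)
    fix e :: real assume "0 < e"
    obtain M where M: "4 / e\<^sup>2 < real M" using reals_Archimedean2 by blast
    have M0: "0 < real M" using M \<open>0 < e\<close> by (meson divide_pos_pos less_trans zero_less_numeral zero_less_power)
    have "dist (s a) (s b) < e" if "M \<le> a" "M \<le> b" for a b
    proof -
      have inv: "1 / real (Suc c) < 1 / real M" if "M \<le> c" for c
        using that M0 by (intro divide_strict_left_mono) auto
      have "(norm (s a - s b))\<^sup>2 \<le> 2 * (J (s a) - m) + 2 * (J (s b) - m)" by (rule close)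
      also have "\<dots> < 4 * (1 / real M)"
        using s[of a] s[of b] inv[OF that(1)] inv[OF that(2)] by argo
      also have "\<dots> < e\<^sup>2" using M M0 \<open>0 < e\<close> by (simp add: field_simps)
      finally show ?thesis using \<open>0 < e\<close> by (simp add: dist_norm power2_less_imp_less)
    qed
    then show "\<exists>M. \<forall>m\<ge>M. \<forall>n\<ge>M. dist (s m) (s n) < e" by blast
  qed
  then obtain y where y: "s \<longlonglongrightarrow> y" using Cauchy_convergent convergent_def by blast
  have "(\<lambda>n. J (s n)) \<longlonglongrightarrow> J y"
    unfolding J_def by (intro tendsto_intros y f.tendsto)
  moreover have "(\<lambda>n. m + 1 / real (Suc n)) \<longlonglongrightarrow> m + 0"
    by (intro tendsto_intros LIMSEQ_Suc[OF lim_1_over_n])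
  ultimately have "J y \<le> m + 0"
    by (rule LIMSEQ_le) (use s less_imp_le in blast)
  then have min: "J y \<le> J x" for x using m_le[of x] by simp
  have "f x = inner x y" for x
  proof -
    define b where "b = inner x y - f x"
    have *: "0 \<le> 2 * t * b + t\<^sup>2 * (norm x)\<^sup>2" for t
    proof -
      have "J (y + t *\<^sub>R x) = J y + 2 * t * b + t\<^sup>2 * (norm x)\<^sup>2"
        unfolding J_def b_def f.add f.scaleR
        by (simp add: power2_norm_eq_inner inner_simps inner_commute algebra_simps power2_eq_square[of t])
      then show ?thesis using min[of "y + t *\<^sub>R x"] by simp
    qed
    have "b = 0"
    proof (rule ccontr)
      assume "b \<noteq> 0"
      \<comment> \<open>The quadratic in \<open>t\<close> is minimised with
        \<open>(norm x)\<^sup>2\<close> replaced by \<open>M\<close>: the extra 1 keeps the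
        denominator positive when \<open>x = 0\<close>, and the value
        \<open>- (b\<^sup>2 / M)\<close> is still negative.\<close>
      define M where "M = 1 + (norm x)\<^sup>2"
      define t where "t = - b / M"
      have p: "0 < M" by (simp add: M_def add_pos_nonneg)
      have "2 * t * b + t\<^sup>2 * (norm x)\<^sup>2 \<le> 2 * t * b + t\<^sup>2 * M"
        by (simp add: M_def mult_left_mono)
      also have "\<dots> = - (b\<^sup>2 / M)"
        using p by (simp add: t_def power2_eq_square field_simps)
      also have "\<dots> < 0" using p \<open>b \<noteq> 0\<close> by simp
      finally show False using *[of t] by simp
    qed
    then show ?thesis by (simp add: b_def)
  qed
  then show ?thesis by blast
qed

lemma bounded_opsD: "T \<in> bounded_ops \<Longrightarrow> blinfun_apply T (c *\<^sub>C x) = c *\<^sub>C blinfun_apply T x"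
  by (simp add: bounded_ops_def)

lemma cinner_ext:
  assumes "\<And>x. cinner x y = cinner x (z::'h::chilbert_space)"
  shows "y = z"
proof -
  have "inner (y - z) y = inner (y - z) z"
    using assms[of "y - z"] by (metis Re_cinner)
  then have "inner (y - z) (y - z) = 0" by (simp add: inner_diff_right)
  then show ?thesis by simp
qed

lemma cinner_add_right: "cinner x (y + z) = cinner x y + cinner x (z::'h::chilbert_space)"
  by (subst (1 2 3) cinner_commute) (simp add: cinner_add_left)

text \<open>\<open>adjoint_op\<close> is a definite description and says nothing until an adjoint
  exists. Riesz, applied for each \<open>y\<close> in the real inner product, gives
  \<open>S\<close>; as \<open>T\<close> commutes with \<open>\<i>\<close>, testing at
  \<open>\<i> *\<^sub>C x\<close> supplies the imaginary parts. Linearity and boundedness of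
  \<open>S\<close> follow from the adjoint identity.\<close>

lemma adjoint_ex:
  assumes T: "T \<in> bounded_ops"
  shows "\<exists>S. \<forall>x y. cinner (blinfun_apply T x) y = cinner x (blinfun_apply S y)"
proof -
  have "\<exists>z. \<forall>x. inner (blinfun_apply T x) y = inner x z" for y
    by (rule riesz_representation)
      (rule bounded_linear_compose[OF bounded_linear_inner_left blinfun.bounded_linear_right])
  then obtain S where S: "\<And>x y. inner (blinfun_apply T x) y = inner x (S y)" by metis
  have SC: "cinner (blinfun_apply T x) y = cinner x (S y)" for x y
  proof (rule complex_eqI)
    show "Im (cinner (blinfun_apply T x) y) = Im (cinner x (S y))"
      using S[of "\<i> *\<^sub>C x" y] by (simp add: Im_cinner bounded_opsD[OF T])
  qed (simp add: Re_cinner S)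
  have "bounded_linear S"
  proof (rule bounded_linear_intro[where K = "norm T"])
    show "S (x + y) = S x + S y" for x y
      by (rule cinner_ext) (simp add: SC[symmetric] cinner_add_right)
    show "S (r *\<^sub>R x) = r *\<^sub>R S x" for r x
      by (rule cinner_ext) (simp add: SC[symmetric] scaleC_of_real[symmetric] cinner_scaleC_right)
    show "norm (S x) \<le> norm x * norm T" for x
    proof (cases "S x = 0")
      case False
      have "norm (S x) * norm (S x) = inner (S x) (S x)"
        by (simp add: power2_norm_eq_inner[symmetric] power2_eq_square)
      also have "\<dots> = inner (blinfun_apply T (S x)) x" by (simp add: S)
      also have "\<dots> \<le> norm (blinfun_apply T (S x)) * norm x" by (rule norm_cauchy_schwarz)
      also have "\<dots> \<le> (norm T * norm (S x)) * norm x"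
        by (intro mult_right_mono norm_blinfun) simp
      finally show ?thesis using False by (simp add: mult_ac)
    qed simp
  qed
  then show ?thesis using SC by (metis bounded_linear_Blinfun_apply)
qed

lemma adjoint_op_eqI:
  assumes "\<And>x y. cinner (blinfun_apply T x) y = cinner x (blinfun_apply S y)"
  shows "adjoint_op T = S"
  unfolding adjoint_op_def
proof (rule the_equality)
  fix S' assume "\<forall>x y. cinner (blinfun_apply T x) y = cinner x (blinfun_apply S' y)"
  then show "S' = S" using assms by (intro blinfun_eqI cinner_ext) simp
qed (use assms in blast)

lemma cinner_adjoint_op:
  assumes "T \<in> bounded_ops"
  shows "cinner (blinfun_apply T x) y = cinner x (blinfun_apply (adjoint_op T) y)"
  using adjoint_ex[OF assms] adjoint_op_eqI by metis

lemma inner_adjoint_op: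
  assumes "T \<in> bounded_ops"
  shows "inner (blinfun_apply T x) y = inner x (blinfun_apply (adjoint_op T) y)"
  using cinner_adjoint_op[OF assms] by (metis Re_cinner)

lemma adjoint_op_closed:
  assumes "T \<in> bounded_ops" shows "adjoint_op T \<in> bounded_ops"
  unfolding bounded_ops_def
proof (intro CollectI allI)
  show "blinfun_apply (adjoint_op T) (c *\<^sub>C x) = c *\<^sub>C blinfun_apply (adjoint_op T) x" for c x
    by (rule cinner_ext) (simp add: cinner_adjoint_op[OF assms, symmetric] cinner_scaleC_right)
qed

lemma adjoint_op_adjoint_op:
  assumes "T \<in> bounded_ops" shows "adjoint_op (adjoint_op T) = T"
  by (rule adjoint_op_eqI) (metis cinner_adjoint_op[OF assms] cinner_commute)

lemma norm_adjoint_op_le: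
  assumes "T \<in> bounded_ops" shows "norm (adjoint_op T) \<le> norm T"
proof (rule norm_blinfun_bound)
  fix y
  let ?S = "blinfun_apply (adjoint_op T)"
  show "norm (?S y) \<le> norm T * norm y"
  proof (cases "?S y = 0")
    case False
    have "norm (?S y) * norm (?S y) = inner (blinfun_apply T (?S y)) y"
      by (simp add: inner_adjoint_op[OF assms] power2_norm_eq_inner[symmetric] power2_eq_square)
    also have "\<dots> \<le> norm (blinfun_apply T (?S y)) * norm y" by (rule norm_cauchy_schwarz)
    also have "\<dots> \<le> (norm T * norm (?S y)) * norm y"
      by (intro mult_right_mono norm_blinfun) simp
    finally show ?thesis using False by (simp add: mult_ac)
  qed simp
qed simp

lemma norm_adjoint_op [simp]:
  assumes "T \<in> bounded_ops" shows "norm (adjoint_op T) = norm T"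
  using norm_adjoint_op_le[OF assms] norm_adjoint_op_le[OF adjoint_op_closed[OF assms]]
  by (simp add: adjoint_op_adjoint_op[OF assms])

lemma adjoint_op_add:
  assumes "S \<in> bounded_ops" "T \<in> bounded_ops"
  shows "adjoint_op (S + T) = adjoint_op S + adjoint_op T"
  by (rule adjoint_op_eqI)
    (simp add: blinfun.add_left cinner_add_left cinner_add_right cinner_adjoint_op assms)

lemma adjoint_op_scaleC:
  assumes "T \<in> bounded_ops"
  shows "adjoint_op (scaleC_blinfun c T) = scaleC_blinfun (cnj c) (adjoint_op T)"
  by (rule adjoint_op_eqI)
    (simp add: scaleC_blinfun.rep_eq cinner_scaleC_left cinner_scaleC_right cinner_adjoint_op assms)

lemma adjoint_op_0 [simp]: "adjoint_op 0 = 0"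
proof (rule adjoint_op_eqI)
  fix x y :: 'a
  show "cinner (blinfun_apply 0 x) y = cinner x (blinfun_apply 0 y)"
    using cinner_scaleC_left[of 0 x y] cinner_scaleC_right[of x 0 y] by simp
qed

lemma adjoint_op_id [simp]: "adjoint_op id_blinfun = id_blinfun"
  by (rule adjoint_op_eqI) simp

lemma bounded_ops_0 [simp]: "0 \<in> bounded_ops"
  and bounded_ops_id [simp]: "id_blinfun \<in> bounded_ops"
  and bounded_ops_add: "S \<in> bounded_ops \<Longrightarrow> T \<in> bounded_ops \<Longrightarrow> S + T \<in> bounded_ops"
  and bounded_ops_diff: "S \<in> bounded_ops \<Longrightarrow> T \<in> bounded_ops \<Longrightarrow> S - T \<in> bounded_ops"
  and bounded_ops_compose: "S \<in> bounded_ops \<Longrightarrow> T \<in> bounded_ops \<Longrightarrow> S o\<^sub>L T \<in> bounded_ops"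
  and bounded_ops_scaleC: "T \<in> bounded_ops \<Longrightarrow> scaleC_blinfun c T \<in> bounded_ops"
  by (simp_all add: bounded_ops_def blinfun.add_left blinfun.diff_left scaleC_add_right
      scaleC_diff_right scaleC_blinfun.rep_eq scaleC_scaleC mult.commute)

text \<open>The surrounding type holds all bounded real-linear operators. Products and limits of
  matrices have infinite sums and limits as entries, and closedness keeps these entries complex
  linear.\<close>

lemma closed_bounded_ops: "closed (bounded_ops :: ('h::chilbert_space \<Rightarrow>\<^sub>L 'h) set)"
proof -
  have "closed {T :: 'h \<Rightarrow>\<^sub>L 'h. blinfun_apply T (c *\<^sub>C x) = c *\<^sub>C blinfun_apply T x}" for c x
    by (intro closed_Collect_eq continuous_intros
        linear_continuous_on bounded_linear_compose[OF bounded_linear_scaleC] blinfun.bounded_linear_left)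
  then show ?thesis unfolding bounded_ops_def
    by (simp add: closed_Collect_all)
qed

lemma norm_scaleC_blinfun: "norm (scaleC_blinfun c T) = cmod c * norm T"
proof (cases "c = 0")
  case True
  then have "scaleC_blinfun c T = 0" by (intro blinfun_eqI) (simp add: scaleC_blinfun.rep_eq)
  with True show ?thesis by simp
next
  case False
  have le: "norm (scaleC_blinfun d S) \<le> cmod d * norm S" for d and S :: "'a \<Rightarrow>\<^sub>L 'a"
    by (rule norm_blinfun_bound)
      (simp_all add: scaleC_blinfun.rep_eq norm_scaleC mult.assoc mult_left_mono norm_blinfun)
  have "T = scaleC_blinfun (inverse c) (scaleC_blinfun c T)"
    using False by (intro blinfun_eqI) (simp add: scaleC_blinfun.rep_eq scaleC_scaleC)
  then have "norm T \<le> inverse (cmod c) * norm (scaleC_blinfun c T)"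
    using le[of "inverse c" "scaleC_blinfun c T"] by (simp add: norm_inverse)
  then have "cmod c * norm T \<le> norm (scaleC_blinfun c T)"
    using False by (simp add: field_simps)
  then show ?thesis using le[of c T] by simp
qed

lemma norm_id_blinfun_eq:
  assumes "(id_blinfun :: 'h::real_normed_vector \<Rightarrow>\<^sub>L 'h) \<noteq> 0"
  shows "norm (id_blinfun :: 'h \<Rightarrow>\<^sub>L 'h) = 1"
proof (rule antisym)
  obtain x :: 'h where "blinfun_apply id_blinfun x \<noteq> 0" using assms by (metis blinfun_eqI zero_blinfun.rep_eq)
  then have "norm x * 1 \<le> norm x * norm (id_blinfun :: 'h \<Rightarrow>\<^sub>L 'h)" "norm x > 0"
    using norm_blinfun[of id_blinfun x] by (simp_all add: mult.commute)
  then show "1 \<le> norm (id_blinfun :: 'h \<Rightarrow>\<^sub>L 'h)" by simp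
qed (rule norm_blinfun_bound, simp_all)

section \<open>Unordered sums and \<open>\<ell>\<^sup>2\<close>\<close>

lemma infsum_bounded_linear:
  fixes h :: "'a :: real_normed_vector \<Rightarrow> 'b :: real_normed_vector"
  assumes "bounded_linear h" "f summable_on A"
  shows "infsum (\<lambda>x. h (f x)) A = h (infsum f A)"
  using infsum_bounded_linear_strong[OF _ assms(1)] assms summable_on_bounded_linear by blast

lemma infsum_in_closed:
  fixes f :: "'a \<Rightarrow> 'b::{comm_monoid_add,t2_space}"
  assumes "closed S" "\<And>F. finite F \<Longrightarrow> F \<subseteq> A \<Longrightarrow> sum f F \<in> S"
  shows "infsum f A \<in> S"
proof (cases "f summable_on A")
  case True
  show ?thesis
    by (rule Lim_in_closed_set[OF assms(1) _ _ infsum_tendsto[OF True]])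
      (auto intro!: eventually_finite_subsets_at_top_weakI assms)
next
  case False
  \<comment> \<open>A sum that does not converge has value 0, which is the sum over the empty set
    and so lies in \<open>S\<close>.\<close>
  then show ?thesis using assms(2)[of "{}"] by (simp add: infsum_not_exists)
qed

lemma summable_on_finite_sums_le:
  fixes f :: "'a \<Rightarrow> real"
  assumes "\<And>x. x \<in> A \<Longrightarrow> 0 \<le> f x" "\<And>F. finite F \<Longrightarrow> F \<subseteq> A \<Longrightarrow> sum f F \<le> c"
  shows "f summable_on A"
  using assms by (intro nonneg_bdd_above_summable_on) (auto intro!: bdd_aboveI[where M = c])

lemma summable_on_comparison:
  fixes f :: "'a \<Rightarrow> 'b::banach"
  assumes "g summable_on A" "\<And>x. x \<in> A \<Longrightarrow> norm (f x) \<le> g x"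
  shows "f summable_on A"
  by (rule abs_summable_summable) (rule Infinite_Sum.abs_summable_on_comparison_test'[OF assms])

text \<open>A finite set of index pairs lies in the rectangle spanned by its projections, so a bound
  uniform over finite rectangles yields absolute summability over the product, and Fubini applies.
  In this form only finite double sums have to be estimated.\<close>

lemma infsum_swap_finite_sums:
  fixes f :: "'a \<Rightarrow> 'b \<Rightarrow> 'c::banach"
  assumes "\<And>F G. finite F \<Longrightarrow> F \<subseteq> A \<Longrightarrow> finite G \<Longrightarrow> G \<subseteq> B \<Longrightarrow>
    (\<Sum>x\<in>F. \<Sum>y\<in>G. norm (f x y)) \<le> c"
  shows "(\<Sum>\<^sub>\<infinity>x\<in>A. \<Sum>\<^sub>\<infinity>y\<in>B. f x y) = (\<Sum>\<^sub>\<infinity>y\<in>B. \<Sum>\<^sub>\<infinity>x\<in>A. f x y)"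
proof (rule infsum_swap_banach)
  have "(\<lambda>p. norm (case p of (x, y) \<Rightarrow> f x y)) summable_on A \<times> B"
  proof (rule summable_on_finite_sums_le[where c = c])
    fix H assume H: "finite H" "H \<subseteq> A \<times> B"
    have "(\<Sum>p\<in>H. norm (case p of (x, y) \<Rightarrow> f x y))
        \<le> (\<Sum>p\<in>fst ` H \<times> snd ` H. norm (case p of (x, y) \<Rightarrow> f x y))"
      using H by (intro sum_mono2) (auto simp: rev_image_eqI)
    also have "\<dots> = (\<Sum>x\<in>fst ` H. \<Sum>y\<in>snd ` H. norm (f x y))"
      by (simp add: sum.cartesian_product case_prod_unfold)
    also have "\<dots> \<le> c" using H by (intro assms) auto
    finally show "(\<Sum>p\<in>H. norm (case p of (x, y) \<Rightarrow> f x y)) \<le> c" .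
  qed simp
  then show "(\<lambda>(x, y). f x y) summable_on A \<times> B"
    by (rule abs_summable_summable)
qed

text \<open>The real part of the usual complex inner product of families. It determines the norm,
  and complex phases enter by multiplying one argument by a scalar.\<close>

definition ell2_inner :: "'i set \<Rightarrow> ('i \<Rightarrow> 'h::chilbert_space) \<Rightarrow> ('i \<Rightarrow> 'h) \<Rightarrow> real" where
  "ell2_inner X f g = (\<Sum>\<^sub>\<infinity>k\<in>X. inner (f k) (g k))"

section \<open>Norms and inner products of square-summable families\<close>

lemma ell2_outside: "f \<in> ell2 X \<Longrightarrow> k \<notin> X \<Longrightarrow> f k = 0"
  by (simp add: ell2_def)

lemma ell2_norm_nonneg [simp]: "0 \<le> ell2_norm X f"
  by (simp add: ell2_norm_def infsum_nonneg)

lemma ell2_norm_square: "(ell2_norm X f)\<^sup>2 = ell2_inner X f f"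
  by (simp add: ell2_norm_def ell2_inner_def infsum_nonneg power2_norm_eq_inner)

lemma ell2_finite_sum_le:
  assumes "f \<in> ell2 X" "finite F" "F \<subseteq> X"
  shows "(\<Sum>k\<in>F. (norm (f k))\<^sup>2) \<le> (ell2_norm X f)\<^sup>2"
proof -
  have "(\<Sum>k\<in>F. (norm (f k))\<^sup>2) \<le> (\<Sum>\<^sub>\<infinity>k\<in>X. (norm (f k))\<^sup>2)"
    using assms by (intro finite_sum_le_infsum) (auto simp: ell2_def)
  then show ?thesis by (simp add: ell2_norm_def infsum_nonneg)
qed

lemma norm_le_ell2_norm:
  assumes "f \<in> ell2 X" shows "norm (f k) \<le> ell2_norm X f"
proof (cases "k \<in> X")
  case True
  then have "(norm (f k))\<^sup>2 \<le> (ell2_norm X f)\<^sup>2"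
    using ell2_finite_sum_le[OF assms, of "{k}"] by simp
  then show ?thesis by (rule power2_le_imp_le) simp
qed (use assms in \<open>simp add: ell2_outside\<close>)

lemma ell2_boundI:
  assumes "\<And>k. k \<notin> X \<Longrightarrow> f k = 0" "0 \<le> c"
    "\<And>F. finite F \<Longrightarrow> F \<subseteq> X \<Longrightarrow> (\<Sum>k\<in>F. (norm (f k))\<^sup>2) \<le> c\<^sup>2"
  shows "f \<in> ell2 X" and "ell2_norm X f \<le> c"
proof -
  have s: "(\<lambda>k. (norm (f k))\<^sup>2) summable_on X"
    using assms(3) by (intro summable_on_finite_sums_le) auto
  then show "f \<in> ell2 X" using assms(1) by (simp add: ell2_def)
  have "(\<Sum>\<^sub>\<infinity>k\<in>X. (norm (f k))\<^sup>2) \<le> c\<^sup>2"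
    using assms(3) by (intro infsum_le_finite_sums[OF s])
  then show "ell2_norm X f \<le> c"
    using assms(2) by (simp add: ell2_norm_def real_le_lsqrt infsum_nonneg)
qed

lemma ell2_inner_summable:
  assumes "f \<in> ell2 X" "g \<in> ell2 X"
  shows "(\<lambda>k. inner (f k) (g k)) summable_on X"
proof (rule summable_on_comparison)
  show "(\<lambda>k. (norm (f k))\<^sup>2 + (norm (g k))\<^sup>2) summable_on X"
    using assms by (intro summable_on_add) (auto simp: ell2_def)
  fix k
  have "norm (inner (f k) (g k)) \<le> norm (f k) * norm (g k)"
    using Cauchy_Schwarz_ineq2[of "f k" "g k"] by simp
  also have "\<dots> \<le> (norm (f k))\<^sup>2 + (norm (g k))\<^sup>2"
    using sum_squares_bound[of "norm (f k)" "norm (g k)"]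
      mult_nonneg_nonneg[OF norm_ge_zero[of "f k"] norm_ge_zero[of "g k"]]
    unfolding mult.assoc by linarith
  finally show "norm (inner (f k) (g k)) \<le> (norm (f k))\<^sup>2 + (norm (g k))\<^sup>2" .
qed

lemma ell2_scaleC:
  assumes "f \<in> ell2 X"
  shows "(\<lambda>k. c *\<^sub>C f k) \<in> ell2 X"
  using assms by (auto simp: ell2_def norm_scaleC power_mult_distrib intro: summable_on_cmult_right)

lemma ell2_scaleR: "f \<in> ell2 X \<Longrightarrow> (\<lambda>k. r *\<^sub>R f k) \<in> ell2 X"
  using ell2_scaleC[of f X "of_real r"] by (simp add: scaleC_of_real)

lemma ell2_add:
  assumes "f \<in> ell2 X" "g \<in> ell2 X"
  shows "(\<lambda>k. f k + g k) \<in> ell2 X"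
proof -
  have "(\<lambda>k. inner (f k) (f k) + 2 * inner (f k) (g k) + inner (g k) (g k)) summable_on X"
    by (intro summable_on_add summable_on_cmult_right ell2_inner_summable assms)
  moreover have "(norm (f k + g k))\<^sup>2 = inner (f k) (f k) + 2 * inner (f k) (g k) + inner (g k) (g k)" for k
    by (simp add: power2_norm_eq_inner inner_simps inner_commute)
  ultimately have "(\<lambda>k. (norm (f k + g k))\<^sup>2) summable_on X"
    by simp
  then show ?thesis using assms by (auto simp: ell2_def)
qed

lemma ell2_inner_commute: "ell2_inner X f g = ell2_inner X g f"
  by (simp add: ell2_inner_def inner_commute)

lemma ell2_inner_add_left:
  assumes "f \<in> ell2 X" "g \<in> ell2 X" "h \<in> ell2 X"
  shows "ell2_inner X (\<lambda>k. f k + g k) h = ell2_inner X f h + ell2_inner X g h"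
  by (simp add: ell2_inner_def inner_add_left infsum_add ell2_inner_summable assms)

lemma ell2_inner_scaleC_left: "ell2_inner X (\<lambda>k. c *\<^sub>C f k) g = ell2_inner X f (\<lambda>k. cnj c *\<^sub>C g k)"
  by (simp add: ell2_inner_def inner_scaleC_scaleC)

lemma ell2_inner_scaleR_right: "ell2_inner X f (\<lambda>k. r *\<^sub>R g k) = r * ell2_inner X f g"
  by (simp add: ell2_inner_def infsum_cmult_right')

lemma ell2_norm_scaleC: "ell2_norm X (\<lambda>k. c *\<^sub>C f k) = cmod c * ell2_norm X f"
  by (simp add: ell2_norm_def norm_scaleC power_mult_distrib infsum_cmult_right' real_sqrt_mult)

lemma ell2_norm_diff_square:
  assumes "f \<in> ell2 X" "g \<in> ell2 X"
  shows "(ell2_norm X (\<lambda>k. f k - g k))\<^sup>2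
    = (ell2_norm X f)\<^sup>2 - 2 * ell2_inner X f g + (ell2_norm X g)\<^sup>2"
proof -
  have m: "(\<lambda>k. - g k) \<in> ell2 X" using ell2_scaleC[OF assms(2), of "-1"] by simp
  have neg: "ell2_inner X h (\<lambda>k. - g k) = - ell2_inner X h g" for h
    by (simp add: ell2_inner_def infsum_uminus)
  have add: "(\<lambda>k. f k + - g k) \<in> ell2 X" by (rule ell2_add[OF assms(1) m])
  have "(ell2_norm X (\<lambda>k. f k + - g k))\<^sup>2 =
      ell2_inner X f (\<lambda>k. f k + - g k) + ell2_inner X (\<lambda>k. - g k) (\<lambda>k. f k + - g k)"
    unfolding ell2_norm_square by (rule ell2_inner_add_left[OF assms(1) m add])
  also have "\<dots> = ell2_inner X (\<lambda>k. f k + - g k) f + ell2_inner X (\<lambda>k. f k + - g k) (\<lambda>k. - g k)"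
    by (simp only: ell2_inner_commute)
  also have "\<dots> = ell2_inner X f f + ell2_inner X (\<lambda>k. - g k) f
      + (ell2_inner X f (\<lambda>k. - g k) + ell2_inner X (\<lambda>k. - g k) (\<lambda>k. - g k))"
    by (simp only: ell2_inner_add_left[OF assms(1) m assms(1)] ell2_inner_add_left[OF assms(1) m m])
  finally show ?thesis
    by (simp add: ell2_norm_square neg ell2_inner_commute[of X "\<lambda>k. - g k" f]
        ell2_inner_commute[of X "\<lambda>k. - g k" g])
qed

lemma ell2_single:
  assumes "k \<in> X"
  shows "(\<lambda>l. if l = k then x else 0) \<in> ell2 X"
    and "ell2_norm X (\<lambda>l. if l = k then x else 0) = norm x"
proof -
  let ?f = "\<lambda>l. if l = k then x else 0"
  have *: "((\<lambda>l. (norm (?f l))\<^sup>2) has_sum (norm x)\<^sup>2) X"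
    by (rule has_sum_finite_neutralI[of "{k}"]) (use assms in auto)
  then show "?f \<in> ell2 X" using assms by (auto simp: ell2_def summable_on_def)
  show "ell2_norm X ?f = norm x" using * by (simp add: ell2_norm_def infsumI)
qed

section \<open>The Schur algebra of a submultiplicative kernel\<close>

text \<open>Finite partial sums avoid summability conditions, and each inequality then involves
  finitely many entries. One constant serves rows and columns, which makes \<open>schur_norm\<close>
  the larger of the two suprema. The conjunct \<open>0 \<le> c\<close> matters for empty
  \<open>X\<close>, where every negative number would otherwise be a bound too.\<close>

definition schur_bound ::
  "'i set \<Rightarrow> ('i \<Rightarrow> 'i \<Rightarrow> real) \<Rightarrow> ('i, 'h::chilbert_space) op_matrix \<Rightarrow> real \<Rightarrow> bool" where
  "schur_bound X W A c \<longleftrightarrow> 0 \<le> c \<and> (\<forall>i\<in>X. \<forall>F. finite F \<longrightarrow> F \<subseteq> X \<longrightarrow>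
     (\<Sum>l\<in>F. W i l * norm (A i l)) \<le> c \<and> (\<Sum>k\<in>F. W k i * norm (A k i)) \<le> c)"

definition schur_matrices ::
  "'i set \<Rightarrow> ('i \<Rightarrow> 'i \<Rightarrow> real) \<Rightarrow> ('i, 'h::chilbert_space) op_matrix set" where
  "schur_matrices X W = {A \<in> op_matrices X. \<exists>c. schur_bound X W A c}"

definition schur_norm ::
  "'i set \<Rightarrow> ('i \<Rightarrow> 'i \<Rightarrow> real) \<Rightarrow> ('i, 'h::chilbert_space) op_matrix \<Rightarrow> real" where
  "schur_norm X W A = Inf {c. schur_bound X W A c}"

lemma matrix_algebra_simps [simp]:
  "carrier (matrix_algebra X S N) = S"
  "A \<otimes>\<^bsub>matrix_algebra X S N\<^esub> B = (\<lambda>k l. \<Sum>\<^sub>\<infinity>n\<in>X. A k n o\<^sub>L B n l)"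
  "\<one>\<^bsub>matrix_algebra X S N\<^esub> = (\<lambda>k l. if k = l \<and> k \<in> X then id_blinfun else 0)"
  "\<zero>\<^bsub>matrix_algebra X S N\<^esub> = (\<lambda>k l. 0)"
  "A \<oplus>\<^bsub>matrix_algebra X S N\<^esub> B = (\<lambda>k l. A k l + B k l)"
  "c \<odot>\<^bsub>matrix_algebra X S N\<^esub> A = (\<lambda>k l. scaleC_blinfun c (A k l))"
  "star (matrix_algebra X S N) A = (\<lambda>k l. adjoint_op (A l k))"
  "anorm (matrix_algebra X S N) = N"
  by (simp_all add: matrix_algebra_def)

lemma op_matrices_bounded_ops: "A \<in> op_matrices X \<Longrightarrow> A k l \<in> bounded_ops"
  and op_matrices_outside: "A \<in> op_matrices X \<Longrightarrow> k \<notin> X \<or> l \<notin> X \<Longrightarrow> A k l = 0"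
  by (auto simp: op_matrices_def)

lemma schur_boundI:
  assumes "0 \<le> c"
    "\<And>i F. i \<in> X \<Longrightarrow> finite F \<Longrightarrow> F \<subseteq> X \<Longrightarrow> (\<Sum>l\<in>F. W i l * norm (A i l)) \<le> c"
    "\<And>i F. i \<in> X \<Longrightarrow> finite F \<Longrightarrow> F \<subseteq> X \<Longrightarrow> (\<Sum>k\<in>F. W k i * norm (A k i)) \<le> c"
  shows "schur_bound X W A c"
  using assms by (simp add: schur_bound_def)

lemma schur_boundD:
  assumes "schur_bound X W A c"
  shows "0 \<le> c"
    and "i \<in> X \<Longrightarrow> finite F \<Longrightarrow> F \<subseteq> X \<Longrightarrow> (\<Sum>l\<in>F. W i l * norm (A i l)) \<le> c"
    and "i \<in> X \<Longrightarrow> finite F \<Longrightarrow> F \<subseteq> X \<Longrightarrow> (\<Sum>k\<in>F. W k i * norm (A k i)) \<le> c"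
  using assms by (simp_all add: schur_bound_def)

text \<open>The infimum is attained, since every partial sum lies below all admissible constants and
  hence below their infimum.\<close>

lemma schur_bound_norm:
  assumes "A \<in> schur_matrices X W"
  shows "schur_bound X W A (schur_norm X W A)"
proof -
  have ne: "{c. schur_bound X W A c} \<noteq> {}" using assms by (auto simp: schur_matrices_def)
  show ?thesis unfolding schur_norm_def
    by (intro schur_boundI cInf_greatest ne) (auto dest: schur_boundD)
qed

lemma schur_norm_le: "schur_bound X W A c \<Longrightarrow> schur_norm X W A \<le> c"
  unfolding schur_norm_def by (rule cInf_lower) (auto intro!: bdd_belowI[of _ 0] dest: schur_boundD)

lemma schur_norm_nonneg: "A \<in> schur_matrices X W \<Longrightarrow> 0 \<le> schur_norm X W A"
  using schur_bound_norm schur_boundD(1) by blast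

lemma schur_matricesI: "A \<in> op_matrices X \<Longrightarrow> schur_bound X W A c \<Longrightarrow> A \<in> schur_matrices X W"
  by (auto simp: schur_matrices_def)

lemma schur_matrices_op: "A \<in> schur_matrices X W \<Longrightarrow> A \<in> op_matrices X"
  by (auto simp: schur_matrices_def)

lemma schur_bound_mono:
  assumes "schur_bound X W A c" "c \<le> d" "0 \<le> d"
    "\<And>k l. k \<in> X \<Longrightarrow> l \<in> X \<Longrightarrow> 0 \<le> W k l"
    "\<And>k l. k \<in> X \<Longrightarrow> l \<in> X \<Longrightarrow> norm (B k l) \<le> norm (A k l)"
  shows "schur_bound X W B d"
proof (rule schur_boundI)
  fix i F assume F: "i \<in> X" "finite F" "F \<subseteq> X"
  have "(\<Sum>l\<in>F. W i l * norm (B i l)) \<le> (\<Sum>l\<in>F. W i l * norm (A i l))"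
    using F by (intro sum_mono mult_left_mono assms) auto
  then show "(\<Sum>l\<in>F. W i l * norm (B i l)) \<le> d"
    using schur_boundD(2)[OF assms(1) F] assms(2) by simp
  have "(\<Sum>k\<in>F. W k i * norm (B k i)) \<le> (\<Sum>k\<in>F. W k i * norm (A k i))"
    using F by (intro sum_mono mult_left_mono assms) auto
  then show "(\<Sum>k\<in>F. W k i * norm (B k i)) \<le> d"
    using schur_boundD(3)[OF assms(1) F] assms(2) by simp
qed (rule assms)

text \<open>Entrywise convergence is enough because each inequality is a closed condition on
  finitely many entries. The filter is arbitrary since there are two uses: the net of finite sets
  for the partial sums of a product, and sequences for completeness.\<close>

lemma schur_bound_limit:
  assumes lim: "\<And>k l. k \<in> X \<Longrightarrow> l \<in> X \<Longrightarrow> ((\<lambda>x. A x k l) \<longlongrightarrow> B k l) Q"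
    and Q: "Q \<noteq> bot" and ev: "eventually (\<lambda>x. schur_bound X W (A x) c) Q"
  shows "schur_bound X W B c"
proof (rule schur_boundI)
  show "0 \<le> c" using eventually_happens[OF ev] Q schur_boundD(1) by blast
  fix i F assume F: "i \<in> X" "finite F" "F \<subseteq> X"
  have 1: "((\<lambda>x. \<Sum>l\<in>F. W i l * norm (A x i l)) \<longlongrightarrow> (\<Sum>l\<in>F. W i l * norm (B i l))) Q"
    using F by (intro tendsto_intros lim) auto
  show "(\<Sum>l\<in>F. W i l * norm (B i l)) \<le> c"
    by (rule tendsto_upperbound[OF 1 eventually_mono[OF ev] Q]) (rule schur_boundD(2)[OF _ F])
  have 2: "((\<lambda>x. \<Sum>k\<in>F. W k i * norm (A x k i)) \<longlongrightarrow> (\<Sum>k\<in>F. W k i * norm (B k i))) Q"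
    using F by (intro tendsto_intros lim) auto
  show "(\<Sum>k\<in>F. W k i * norm (B k i)) \<le> c"
    by (rule tendsto_upperbound[OF 2 eventually_mono[OF ev] Q]) (rule schur_boundD(3)[OF _ F])
qed

text \<open>Cauchy-Schwarz with each weight split into two square roots; this is the inequality
  behind Schur's test.\<close>

lemma sum_weighted_square_le:
  fixes a x :: "'i \<Rightarrow> real"
  assumes "\<And>i. 0 \<le> a i"
  shows "(\<Sum>i\<in>F. a i * x i)\<^sup>2 \<le> (\<Sum>i\<in>F. a i) * (\<Sum>i\<in>F. a i * (x i)\<^sup>2)"
proof -
  have "(\<Sum>i\<in>F. sqrt (a i) * (sqrt (a i) * x i))\<^sup>2
      \<le> (\<Sum>i\<in>F. (sqrt (a i))\<^sup>2) * (\<Sum>i\<in>F. (sqrt (a i) * x i)\<^sup>2)"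
    by (rule Cauchy_Schwarz_ineq_sum)
  moreover have "sqrt (a i) * (sqrt (a i) * x i) = a i * x i" for i
    by (simp add: mult.assoc[symmetric] assms)
  ultimately show ?thesis by (simp add: power_mult_distrib assms)
qed

text \<open>Abstract in \<open>W\<close>, as the given kernel and its flattened versions are used on
  the same \<open>X\<close>. The laws have separate duties: \<open>W_refl\<close> normalises the
  identity, \<open>W_sym\<close> makes the involution isometric, \<open>W_ge_1\<close> compares with
  unweighted sums, and \<open>W_mult\<close> makes the norm submultiplicative.\<close>

locale schur_weight =
  fixes X :: "'i set" and W :: "'i \<Rightarrow> 'i \<Rightarrow> real"
  assumes W_refl: "W k k = 1"
    and W_sym: "W k l = W l k"
    and W_ge_1: "1 \<le> W k l"
    and W_mult: "W k l \<le> W k n * W n l"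
begin

abbreviation alg :: "('i, 'h::chilbert_space) op_matrix star_algebra" where
  "alg \<equiv> matrix_algebra X (schur_matrices X W) (schur_norm X W)"

abbreviation mats :: "('i, 'h::chilbert_space) op_matrix set" where
  "mats \<equiv> schur_matrices X W"

abbreviation nrm :: "('i, 'h::chilbert_space) op_matrix \<Rightarrow> real" where
  "nrm \<equiv> schur_norm X W"

lemma W_nonneg [simp]: "0 \<le> W k l"
  using W_ge_1[of k l] by linarith

lemma schur_row_le:
  assumes "schur_bound X W A c" "k \<in> X" "finite F" "F \<subseteq> X"
  shows "(\<Sum>l\<in>F. norm (A k l)) \<le> c"
proof -
  have "(\<Sum>l\<in>F. norm (A k l)) \<le> (\<Sum>l\<in>F. W k l * norm (A k l))"
    using W_ge_1 by (intro sum_mono) (simp add: mult_le_cancel_right1)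
  then show ?thesis using schur_boundD(2)[OF assms] by simp
qed

lemma schur_col_le:
  assumes "schur_bound X W A c" "l \<in> X" "finite F" "F \<subseteq> X"
  shows "(\<Sum>k\<in>F. norm (A k l)) \<le> c"
proof -
  have "(\<Sum>k\<in>F. norm (A k l)) \<le> (\<Sum>k\<in>F. W k l * norm (A k l))"
    using W_ge_1 by (intro sum_mono) (simp add: mult_le_cancel_right1)
  then show ?thesis using schur_boundD(3)[OF assms] by simp
qed

lemma row_sum_le:
  assumes "A \<in> mats" "finite F" "F \<subseteq> X"
  shows "(\<Sum>l\<in>F. norm (A k l)) \<le> nrm A"
  using schur_row_le[OF schur_bound_norm[OF assms(1)] _ assms(2,3), of k]
    op_matrices_outside[OF schur_matrices_op[OF assms(1)], of k] schur_norm_nonneg[OF assms(1)]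
  by (cases "k \<in> X") auto

lemma col_sum_le:
  assumes "A \<in> mats" "finite F" "F \<subseteq> X"
  shows "(\<Sum>k\<in>F. norm (A k l)) \<le> nrm A"
  using schur_col_le[OF schur_bound_norm[OF assms(1)] _ assms(2,3), of l]
    op_matrices_outside[OF schur_matrices_op[OF assms(1)], of _ l] schur_norm_nonneg[OF assms(1)]
  by (cases "l \<in> X") auto

lemma entry_le:
  assumes "A \<in> mats" shows "norm (A k l) \<le> nrm A"
  using row_sum_le[OF assms, of "{l}" k] op_matrices_outside[OF schur_matrices_op[OF assms], of k l]
    schur_norm_nonneg[OF assms]
  by (cases "l \<in> X") auto

lemma row_summable: "A \<in> mats \<Longrightarrow> (\<lambda>l. norm (A k l)) summable_on X"
  by (rule summable_on_finite_sums_le[where c = "nrm A"]) (auto intro: row_sum_le)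

lemma mult_summable:
  assumes "A \<in> mats" "B \<in> mats"
  shows "(\<lambda>n. A k n o\<^sub>L B n l) summable_on X"
proof (rule summable_on_comparison)
  show "(\<lambda>n. norm (A k n) * nrm B) summable_on X"
    by (intro summable_on_cmult_left row_summable assms)
  show "norm (A k n o\<^sub>L B n l) \<le> norm (A k n) * nrm B" for n
    by (rule order_trans[OF norm_blinfun_compose]) (intro mult_left_mono entry_le assms norm_ge_zero)
qed

text \<open>The inner index runs through a finite set, so sums may be exchanged freely; the full
  product is reached afterwards as a limit over such sets. \<open>W_mult\<close> distributes the
  weight over the two factors, and then rows are bounded by rows and columns by columns.\<close>

lemma schur_bound_mult_finite:
  assumes A: "schur_bound X W A a" and B: "schur_bound X W B b" and G: "finite G" "G \<subseteq> X"
  shows "schur_bound X W (\<lambda>k l. \<Sum>n\<in>G. A k n o\<^sub>L B n l) (a * b)"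
proof (rule schur_boundI)
  show "0 \<le> a * b" using schur_boundD(1)[OF A] schur_boundD(1)[OF B] by simp
  have *: "W k l * norm (\<Sum>n\<in>G. A k n o\<^sub>L B n l)
      \<le> (\<Sum>n\<in>G. (W k n * norm (A k n)) * (W n l * norm (B n l)))" for k l
  proof -
    have "W k l * norm (\<Sum>n\<in>G. A k n o\<^sub>L B n l) \<le> W k l * (\<Sum>n\<in>G. norm (A k n) * norm (B n l))"
      by (intro mult_left_mono order_trans[OF norm_sum] sum_mono norm_blinfun_compose) simp
    also have "\<dots> \<le> (\<Sum>n\<in>G. (W k n * W n l) * (norm (A k n) * norm (B n l)))"
      unfolding sum_distrib_left by (intro sum_mono mult_right_mono W_mult) simp
    finally show ?thesis by (simp add: mult_ac)
  qed
  fix i F assume F: "i \<in> X" "finite F" "F \<subseteq> X"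
  have "(\<Sum>l\<in>F. W i l * norm (\<Sum>n\<in>G. A i n o\<^sub>L B n l))
      \<le> (\<Sum>l\<in>F. \<Sum>n\<in>G. (W i n * norm (A i n)) * (W n l * norm (B n l)))"
    by (intro sum_mono *)
  also have "\<dots> = (\<Sum>n\<in>G. (W i n * norm (A i n)) * (\<Sum>l\<in>F. W n l * norm (B n l)))"
    by (subst sum.swap) (simp add: sum_distrib_left)
  also have "\<dots> \<le> (\<Sum>n\<in>G. (W i n * norm (A i n)) * b)"
    using G by (intro sum_mono mult_left_mono schur_boundD(2)[OF B _ F(2,3)]) auto
  also have "\<dots> \<le> a * b"
    unfolding sum_distrib_right[symmetric]
    by (intro mult_right_mono schur_boundD(2)[OF A F(1) G] schur_boundD(1)[OF B])
  finally show "(\<Sum>l\<in>F. W i l * norm (\<Sum>n\<in>G. A i n o\<^sub>L B n l)) \<le> a * b" .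
  have "(\<Sum>k\<in>F. W k i * norm (\<Sum>n\<in>G. A k n o\<^sub>L B n i))
      \<le> (\<Sum>k\<in>F. \<Sum>n\<in>G. (W k n * norm (A k n)) * (W n i * norm (B n i)))"
    by (intro sum_mono *)
  also have "\<dots> = (\<Sum>n\<in>G. (\<Sum>k\<in>F. W k n * norm (A k n)) * (W n i * norm (B n i)))"
    by (subst sum.swap) (simp add: sum_distrib_right)
  also have "\<dots> \<le> (\<Sum>n\<in>G. a * (W n i * norm (B n i)))"
    using G by (intro sum_mono mult_right_mono schur_boundD(3)[OF A _ F(2,3)]) auto
  also have "\<dots> \<le> a * b"
    unfolding sum_distrib_left[symmetric]
    by (intro mult_left_mono schur_boundD(3)[OF B F(1) G] schur_boundD(1)[OF A])
  finally show "(\<Sum>k\<in>F. W k i * norm (\<Sum>n\<in>G. A k n o\<^sub>L B n i)) \<le> a * b" .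
qed

lemma schur_bound_mult:
  assumes A: "A \<in> mats" and B: "B \<in> mats"
  shows "schur_bound X W (A \<otimes>\<^bsub>alg\<^esub> B) (nrm A * nrm B)"
proof -
  have "schur_bound X W (\<lambda>k l. \<Sum>\<^sub>\<infinity>n\<in>X. A k n o\<^sub>L B n l) (nrm A * nrm B)"
  proof (rule schur_bound_limit[where Q = "finite_subsets_at_top X"])
    show "((\<lambda>G. \<Sum>n\<in>G. A k n o\<^sub>L B n l) \<longlongrightarrow> (\<Sum>\<^sub>\<infinity>n\<in>X. A k n o\<^sub>L B n l)) (finite_subsets_at_top X)" for k l
      by (rule infsum_tendsto[OF mult_summable[OF assms]])
  qed (auto intro!: eventually_finite_subsets_at_top_weakI schur_bound_mult_finite schur_bound_norm assms)
  then show ?thesis by simp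
qed

lemma mult_closed:
  assumes A: "A \<in> mats" and B: "B \<in> mats"
  shows "A \<otimes>\<^bsub>alg\<^esub> B \<in> mats"
proof (rule schur_matricesI[OF _ schur_bound_mult[OF assms]])
  have "(\<Sum>\<^sub>\<infinity>n\<in>X. A k n o\<^sub>L B n l) \<in> bounded_ops" for k l
  proof (rule infsum_in_closed[OF closed_bounded_ops])
    fix F :: "'i set"
    show "(\<Sum>n\<in>F. A k n o\<^sub>L B n l) \<in> bounded_ops"
    proof (induction F rule: infinite_finite_induct)
      case (insert n F)
      then show ?case
        using assms[THEN schur_matrices_op, THEN op_matrices_bounded_ops]
        by (simp add: bounded_ops_add bounded_ops_compose)
    qed simp_all
  qed
  moreover have "(\<Sum>\<^sub>\<infinity>n\<in>X. A k n o\<^sub>L B n l) = 0" if "k \<notin> X \<or> l \<notin> X" for k l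
    by (rule infsum_0) (use that op_matrices_outside[OF schur_matrices_op[OF A]]
        op_matrices_outside[OF schur_matrices_op[OF B]] in auto)
  ultimately show "A \<otimes>\<^bsub>alg\<^esub> B \<in> op_matrices X"
    by (simp add: op_matrices_def)
qed

lemma norm_mult_le:
  assumes "A \<in> mats" "B \<in> mats"
  shows "nrm (A \<otimes>\<^bsub>alg\<^esub> B) \<le> nrm A * nrm B"
  by (rule schur_norm_le[OF schur_bound_mult[OF assms]])

section \<open>Sums, scalar multiples, adjoints and the identity\<close>

lemma schur_bound_add:
  assumes "schur_bound X W A a" "schur_bound X W B b"
  shows "schur_bound X W (\<lambda>k l. A k l + B k l) (a + b)"
proof (rule schur_boundI)
  show "0 \<le> a + b" using schur_boundD(1)[OF assms(1)] schur_boundD(1)[OF assms(2)] by simp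
  have *: "W k l * norm (A k l + B k l) \<le> W k l * norm (A k l) + W k l * norm (B k l)" for k l
    unfolding distrib_left[symmetric] by (intro mult_left_mono norm_triangle_ineq) simp
  fix i F assume F: "i \<in> X" "finite F" "F \<subseteq> X"
  show "(\<Sum>l\<in>F. W i l * norm (A i l + B i l)) \<le> a + b"
    by (rule order_trans[OF sum_mono[OF *]])
      (simp add: sum.distrib add_mono schur_boundD(2)[OF assms(1) F] schur_boundD(2)[OF assms(2) F])
  show "(\<Sum>k\<in>F. W k i * norm (A k i + B k i)) \<le> a + b"
    by (rule order_trans[OF sum_mono[OF *]])
      (simp add: sum.distrib add_mono schur_boundD(3)[OF assms(1) F] schur_boundD(3)[OF assms(2) F])
qed

lemma schur_bound_scaleC:
  assumes "schur_bound X W A a"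
  shows "schur_bound X W (\<lambda>k l. scaleC_blinfun c (A k l)) (cmod c * a)"
proof (rule schur_boundI)
  show "0 \<le> cmod c * a" using schur_boundD(1)[OF assms] by simp
  fix i F assume F: "i \<in> X" "finite F" "F \<subseteq> X"
  show "(\<Sum>l\<in>F. W i l * norm (scaleC_blinfun c (A i l))) \<le> cmod c * a"
    using mult_left_mono[OF schur_boundD(2)[OF assms F], of "cmod c"]
    by (simp add: norm_scaleC_blinfun sum_distrib_left mult_ac)
  show "(\<Sum>k\<in>F. W k i * norm (scaleC_blinfun c (A k i))) \<le> cmod c * a"
    using mult_left_mono[OF schur_boundD(3)[OF assms F], of "cmod c"]
    by (simp add: norm_scaleC_blinfun sum_distrib_left mult_ac)
qed

lemma schur_bound_star:
  assumes "schur_bound X W A a" "A \<in> op_matrices X"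
  shows "schur_bound X W (\<lambda>k l. adjoint_op (A l k)) a"
proof (rule schur_boundI)
  have eq: "W k l * norm (adjoint_op (A l k)) = W l k * norm (A l k)" for k l
    by (simp add: W_sym[of k l] op_matrices_bounded_ops[OF assms(2)])
  fix i F assume F: "i \<in> X" "finite F" "F \<subseteq> X"
  show "(\<Sum>l\<in>F. W i l * norm (adjoint_op (A l i))) \<le> a"
    unfolding eq by (rule schur_boundD(3)[OF assms(1) F])
  show "(\<Sum>k\<in>F. W k i * norm (adjoint_op (A i k))) \<le> a"
    unfolding eq by (rule schur_boundD(2)[OF assms(1) F])
qed (rule schur_boundD(1)[OF assms(1)])

lemma schur_bound_one: "schur_bound X W (\<one>\<^bsub>alg\<^esub> :: ('i, 'h::chilbert_space) op_matrix) (norm (id_blinfun :: 'h \<Rightarrow>\<^sub>L 'h))"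
proof (rule schur_boundI)
  fix i F assume F: "i \<in> X" "finite F" "F \<subseteq> X"
  have "(\<Sum>l\<in>F. W i l * norm ((\<one>\<^bsub>alg\<^esub> :: ('i, 'h) op_matrix) i l))
      = (\<Sum>l\<in>F. if i = l then norm (id_blinfun :: 'h \<Rightarrow>\<^sub>L 'h) else 0)"
    using F by (intro sum.cong) (auto simp: W_refl)
  then show "(\<Sum>l\<in>F. W i l * norm ((\<one>\<^bsub>alg\<^esub> :: ('i, 'h) op_matrix) i l)) \<le> norm (id_blinfun :: 'h \<Rightarrow>\<^sub>L 'h)"
    using F by simp
  have "(\<Sum>k\<in>F. W k i * norm ((\<one>\<^bsub>alg\<^esub> :: ('i, 'h) op_matrix) k i))
      = (\<Sum>k\<in>F. if k = i then norm (id_blinfun :: 'h \<Rightarrow>\<^sub>L 'h) else 0)"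
    using F by (intro sum.cong) (auto simp: W_refl)
  then show "(\<Sum>k\<in>F. W k i * norm ((\<one>\<^bsub>alg\<^esub> :: ('i, 'h) op_matrix) k i)) \<le> norm (id_blinfun :: 'h \<Rightarrow>\<^sub>L 'h)"
    using F by simp
qed simp

lemma schur_bound_zero: "schur_bound X W (\<lambda>k l. 0) 0"
  by (rule schur_boundI) simp_all

lemma one_closed: "\<one>\<^bsub>alg\<^esub> \<in> mats"
  by (rule schur_matricesI[OF _ schur_bound_one]) (auto simp: op_matrices_def)

lemma zero_closed: "(\<lambda>k l. 0) \<in> mats"
  by (rule schur_matricesI[OF _ schur_bound_zero]) (auto simp: op_matrices_def)

lemma add_closed:
  assumes "A \<in> mats" "B \<in> mats" shows "(\<lambda>k l. A k l + B k l) \<in> mats"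
  by (rule schur_matricesI[OF _ schur_bound_add[OF schur_bound_norm schur_bound_norm]])
    (use assms[THEN schur_matrices_op] assms in \<open>auto simp: op_matrices_def bounded_ops_add\<close>)

lemma scaleC_closed:
  assumes "A \<in> mats" shows "(\<lambda>k l. scaleC_blinfun c (A k l)) \<in> mats"
proof (rule schur_matricesI[OF _ schur_bound_scaleC[OF schur_bound_norm[OF assms]]])
  have "scaleC_blinfun c 0 = (0 :: 'a \<Rightarrow>\<^sub>L 'a)" by (rule blinfun_eqI) (simp add: scaleC_blinfun.rep_eq)
  then show "(\<lambda>k l. scaleC_blinfun c (A k l)) \<in> op_matrices X"
    using assms[THEN schur_matrices_op] by (auto simp: op_matrices_def bounded_ops_scaleC)
qed

lemma star_closed:
  assumes "A \<in> mats" shows "(\<lambda>k l. adjoint_op (A l k)) \<in> mats"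
  by (rule schur_matricesI[OF _ schur_bound_star[OF schur_bound_norm[OF assms] schur_matrices_op[OF assms]]])
    (use assms[THEN schur_matrices_op] in \<open>auto simp: op_matrices_def adjoint_op_closed\<close>)

section \<open>Matrices acting on square-summable families\<close>

lemma operator_summable:
  assumes "A \<in> mats" "f \<in> ell2 X"
  shows "(\<lambda>l. blinfun_apply (A k l) (f l)) summable_on X"
proof (rule summable_on_comparison)
  show "(\<lambda>l. norm (A k l) * ell2_norm X f) summable_on X"
    by (intro summable_on_cmult_left row_summable assms)
  show "norm (blinfun_apply (A k l) (f l)) \<le> norm (A k l) * ell2_norm X f" for l
    by (rule order_trans[OF norm_blinfun]) (intro mult_left_mono norm_le_ell2_norm assms norm_ge_zero)
qed

lemma operator_apply:
  "f \<in> ell2 X \<Longrightarrow> matrix_operator X A f k = (\<Sum>\<^sub>\<infinity>l\<in>X. blinfun_apply (A k l) (f l))"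
  by (simp add: matrix_operator_def)

text \<open>Schur's test: Cauchy-Schwarz in each row spends one factor \<open>nrm A\<close> on the
  row sum, and after exchanging the sums the column sums provide the second one. This is done for
  finitely many rows and columns; \<open>bd\<close> then lets the columns exhaust
  \<open>X\<close>.\<close>

lemma operator_bounded:
  assumes A: "A \<in> mats" and f: "f \<in> ell2 X"
  shows "matrix_operator X A f \<in> ell2 X"
    and "ell2_norm X (matrix_operator X A f) \<le> nrm A * ell2_norm X f"
proof -
  define a where "a k l = norm (A k l)" for k l
  note N0 = schur_norm_nonneg[OF A]
  have fin: "(\<Sum>k\<in>F. (norm (\<Sum>l\<in>G. blinfun_apply (A k l) (f l)))\<^sup>2) \<le> (nrm A * ell2_norm X f)\<^sup>2"
    if F: "finite F" "F \<subseteq> X" and G: "finite G" "G \<subseteq> X" for F G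
  proof -
    have "(norm (\<Sum>l\<in>G. blinfun_apply (A k l) (f l)))\<^sup>2 \<le> nrm A * (\<Sum>l\<in>G. a k l * (norm (f l))\<^sup>2)" for k
    proof -
      have "norm (\<Sum>l\<in>G. blinfun_apply (A k l) (f l)) \<le> (\<Sum>l\<in>G. a k l * norm (f l))"
        unfolding a_def by (intro order_trans[OF norm_sum] sum_mono norm_blinfun)
      then have "(norm (\<Sum>l\<in>G. blinfun_apply (A k l) (f l)))\<^sup>2 \<le> (\<Sum>l\<in>G. a k l * norm (f l))\<^sup>2"
        by (rule power_mono) simp
      also have "\<dots> \<le> (\<Sum>l\<in>G. a k l) * (\<Sum>l\<in>G. a k l * (norm (f l))\<^sup>2)"
        by (rule sum_weighted_square_le) (simp add: a_def)
      also have "\<dots> \<le> nrm A * (\<Sum>l\<in>G. a k l * (norm (f l))\<^sup>2)"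
        unfolding a_def by (intro mult_right_mono row_sum_le A G sum_nonneg) simp
      finally show ?thesis .
    qed
    then have "(\<Sum>k\<in>F. (norm (\<Sum>l\<in>G. blinfun_apply (A k l) (f l)))\<^sup>2)
        \<le> (\<Sum>k\<in>F. nrm A * (\<Sum>l\<in>G. a k l * (norm (f l))\<^sup>2))" by (rule sum_mono)
    also have "\<dots> = nrm A * (\<Sum>l\<in>G. (\<Sum>k\<in>F. a k l) * (norm (f l))\<^sup>2)"
      unfolding sum_distrib_left[symmetric] by (subst sum.swap) (simp add: sum_distrib_right)
    also have "\<dots> \<le> nrm A * (\<Sum>l\<in>G. nrm A * (norm (f l))\<^sup>2)"
      unfolding a_def by (intro mult_left_mono N0 sum_mono mult_right_mono col_sum_le A F) simp
    also have "\<dots> \<le> nrm A * (nrm A * (ell2_norm X f)\<^sup>2)"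
      unfolding sum_distrib_left[symmetric] by (intro mult_left_mono N0 ell2_finite_sum_le f G)
    finally show ?thesis by (simp add: power2_eq_square mult_ac)
  qed
  have bd: "(\<Sum>k\<in>F. (norm (matrix_operator X A f k))\<^sup>2) \<le> (nrm A * ell2_norm X f)\<^sup>2"
    if F: "finite F" "F \<subseteq> X" for F
  proof (rule tendsto_upperbound)
    show "((\<lambda>G. \<Sum>k\<in>F. (norm (\<Sum>l\<in>G. blinfun_apply (A k l) (f l)))\<^sup>2) \<longlongrightarrow>
        (\<Sum>k\<in>F. (norm (matrix_operator X A f k))\<^sup>2)) (finite_subsets_at_top X)"
      unfolding operator_apply[OF f] by (intro tendsto_intros infsum_tendsto operator_summable A f)
  qed (auto intro!: eventually_finite_subsets_at_top_weakI fin[OF F])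
  have out: "matrix_operator X A f k = 0" if "k \<notin> X" for k
    unfolding operator_apply[OF f]
    by (rule infsum_0) (simp add: op_matrices_outside[OF schur_matrices_op[OF A]] that)
  show "matrix_operator X A f \<in> ell2 X"
    by (rule ell2_boundI(1)[where c = "nrm A * ell2_norm X f"]) (use out bd N0 in simp_all)
  show "ell2_norm X (matrix_operator X A f) \<le> nrm A * ell2_norm X f"
    by (rule ell2_boundI(2)) (use out bd N0 in simp_all)
qed

lemma operator_mult:
  assumes A: "A \<in> mats" and B: "B \<in> mats" and f: "f \<in> ell2 X"
  shows "matrix_operator X (A \<otimes>\<^bsub>alg\<^esub> B) f = matrix_operator X A (matrix_operator X B f)"
proof
  fix k
  have "matrix_operator X (A \<otimes>\<^bsub>alg\<^esub> B) f k = (\<Sum>\<^sub>\<infinity>l\<in>X. \<Sum>\<^sub>\<infinity>n\<in>X. blinfun_apply (A k n) (blinfun_apply (B n l) (f l)))"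
    unfolding operator_apply[OF f]
    by (simp add: infsum_bounded_linear[OF blinfun.bounded_linear_left mult_summable[OF A B], symmetric])
  also have "\<dots> = (\<Sum>\<^sub>\<infinity>n\<in>X. \<Sum>\<^sub>\<infinity>l\<in>X. blinfun_apply (A k n) (blinfun_apply (B n l) (f l)))"
  \<comment> \<open>Boundedness of \<open>f\<close> suffices for absolute summability: the row sums
    of \<open>B\<close> are taken first, those of \<open>A\<close> afterwards.\<close>
  proof (rule infsum_swap_finite_sums[where c = "nrm A * (nrm B * ell2_norm X f)"])
    fix F G assume F: "finite F" "F \<subseteq> X" and G: "finite G" "G \<subseteq> X"
    have "norm (blinfun_apply (A k n) (blinfun_apply (B n l) (f l))) \<le> norm (A k n) * (norm (B n l) * ell2_norm X f)" for n l
      by (intro order_trans[OF norm_blinfun] mult_left_mono norm_le_ell2_norm f) simp_all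
    then have "(\<Sum>l\<in>F. \<Sum>n\<in>G. norm (blinfun_apply (A k n) (blinfun_apply (B n l) (f l))))
        \<le> (\<Sum>l\<in>F. \<Sum>n\<in>G. norm (A k n) * (norm (B n l) * ell2_norm X f))"
      by (intro sum_mono)
    also have "\<dots> = (\<Sum>n\<in>G. norm (A k n) * ((\<Sum>l\<in>F. norm (B n l)) * ell2_norm X f))"
      by (subst sum.swap) (simp add: sum_distrib_left sum_distrib_right)
    also have "\<dots> \<le> (\<Sum>n\<in>G. norm (A k n) * (nrm B * ell2_norm X f))"
      by (intro sum_mono mult_left_mono mult_right_mono row_sum_le B F) simp_all
    also have "\<dots> \<le> nrm A * (nrm B * ell2_norm X f)"
      unfolding sum_distrib_right[symmetric]
      by (intro mult_right_mono row_sum_le A G mult_nonneg_nonneg schur_norm_nonneg B) simp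
    finally show "(\<Sum>l\<in>F. \<Sum>n\<in>G. norm (blinfun_apply (A k n) (blinfun_apply (B n l) (f l))))
        \<le> nrm A * (nrm B * ell2_norm X f)" .
  qed
  also have "\<dots> = matrix_operator X A (matrix_operator X B f) k"
    by (simp add: operator_apply operator_bounded(1)[OF B f] f
        infsum_bounded_linear[OF blinfun.bounded_linear_right operator_summable[OF B f]])
  finally show "matrix_operator X (A \<otimes>\<^bsub>alg\<^esub> B) f k = matrix_operator X A (matrix_operator X B f) k" .
qed

lemma operator_adjoint:
  assumes A: "A \<in> mats" and f: "f \<in> ell2 X" and g: "g \<in> ell2 X"
  shows "ell2_inner X (matrix_operator X A f) g = ell2_inner X f (matrix_operator X (star alg A) g)"
proof -
  have "ell2_inner X (matrix_operator X A f) g = (\<Sum>\<^sub>\<infinity>k\<in>X. \<Sum>\<^sub>\<infinity>l\<in>X. inner (blinfun_apply (A k l) (f l)) (g k))"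
    unfolding ell2_inner_def operator_apply[OF f]
    by (simp add: infsum_bounded_linear[OF bounded_linear_inner_left operator_summable[OF A f], symmetric])
  also have "\<dots> = (\<Sum>\<^sub>\<infinity>l\<in>X. \<Sum>\<^sub>\<infinity>k\<in>X. inner (blinfun_apply (A k l) (f l)) (g k))"
  \<comment> \<open>The product of the norms of \<open>f l\<close> and \<open>g k\<close> is split
    into squares; the part with \<open>f\<close> is summed along columns of \<open>A\<close>, the
    part with \<open>g\<close> along rows.\<close>
  proof (rule infsum_swap_finite_sums[where c = "nrm A * (ell2_norm X f)\<^sup>2 + nrm A * (ell2_norm X g)\<^sup>2"])
    fix F G assume F: "finite F" "F \<subseteq> X" and G: "finite G" "G \<subseteq> X"
    have "norm (inner (blinfun_apply (A k l) (f l)) (g k))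
        \<le> norm (A k l) * (norm (f l))\<^sup>2 + norm (A k l) * (norm (g k))\<^sup>2" for k l
    proof -
      have "norm (inner (blinfun_apply (A k l) (f l)) (g k)) \<le> norm (blinfun_apply (A k l) (f l)) * norm (g k)"
        using Cauchy_Schwarz_ineq2 by simp
      also have "\<dots> \<le> (norm (A k l) * norm (f l)) * norm (g k)"
        by (intro mult_right_mono norm_blinfun) simp
      also have "\<dots> \<le> norm (A k l) * ((norm (f l))\<^sup>2 + (norm (g k))\<^sup>2)"
        unfolding mult.assoc
        using sum_squares_bound[of "norm (f l)" "norm (g k)"]
          mult_nonneg_nonneg[OF norm_ge_zero[of "f l"] norm_ge_zero[of "g k"]]
        unfolding mult.assoc by (intro mult_left_mono) (linarith, simp)
      finally show ?thesis by (simp add: distrib_left)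
    qed
    then have "(\<Sum>k\<in>F. \<Sum>l\<in>G. norm (inner (blinfun_apply (A k l) (f l)) (g k)))
      \<le> (\<Sum>k\<in>F. \<Sum>l\<in>G. norm (A k l) * (norm (f l))\<^sup>2 + norm (A k l) * (norm (g k))\<^sup>2)"
      by (intro sum_mono)
    also have "\<dots> = (\<Sum>l\<in>G. (\<Sum>k\<in>F. norm (A k l)) * (norm (f l))\<^sup>2)
        + (\<Sum>k\<in>F. (\<Sum>l\<in>G. norm (A k l)) * (norm (g k))\<^sup>2)"
      unfolding sum.distrib by (subst (1) sum.swap) (simp add: sum_distrib_right)
    also have "\<dots> \<le> (\<Sum>l\<in>G. nrm A * (norm (f l))\<^sup>2) + (\<Sum>k\<in>F. nrm A * (norm (g k))\<^sup>2)"
      by (intro add_mono sum_mono mult_right_mono row_sum_le col_sum_le A F G) simp_all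
    also have "\<dots> \<le> nrm A * (ell2_norm X f)\<^sup>2 + nrm A * (ell2_norm X g)\<^sup>2"
      unfolding sum_distrib_left[symmetric]
      by (intro add_mono mult_left_mono ell2_finite_sum_le f g F G schur_norm_nonneg A)
    finally show "(\<Sum>k\<in>F. \<Sum>l\<in>G. norm (inner (blinfun_apply (A k l) (f l)) (g k)))
      \<le> nrm A * (ell2_norm X f)\<^sup>2 + nrm A * (ell2_norm X g)\<^sup>2" .
  qed
  also have "\<dots> = (\<Sum>\<^sub>\<infinity>l\<in>X. \<Sum>\<^sub>\<infinity>k\<in>X. inner (f l) (blinfun_apply (adjoint_op (A k l)) (g k)))"
    by (simp add: inner_adjoint_op op_matrices_bounded_ops[OF schur_matrices_op[OF A]])
  also have "\<dots> = ell2_inner X f (matrix_operator X (star alg A) g)"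
    unfolding ell2_inner_def operator_apply[OF g]
    using operator_summable[OF star_closed[OF A] g]
    by (simp add: infsum_bounded_linear[OF bounded_linear_inner_right])
  finally show ?thesis .
qed

lemma operator_single:
  assumes "A \<in> mats" "l \<in> X"
  shows "matrix_operator X A (\<lambda>n. if n = l then x else 0) k = blinfun_apply (A k l) x"
proof -
  have "((\<lambda>n. blinfun_apply (A k n) (if n = l then x else 0)) has_sum blinfun_apply (A k l) x) X"
    by (rule has_sum_finite_neutralI[of "{l}"]) (use assms(2) in auto)
  then show ?thesis
    unfolding operator_apply[OF ell2_single(1)[OF assms(2)]] by (rule infsumI)
qed

text \<open>Families supported at one index pick out single columns. Injectivity lets algebra laws
  be proved for operators: associativity of the matrix product becomes associativity of composition,
  in place of a rearrangement of iterated sums.\<close>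

lemma operator_inj:
  assumes A: "A \<in> mats" and B: "B \<in> mats"
    and eq: "\<And>f. f \<in> ell2 X \<Longrightarrow> matrix_operator X A f = matrix_operator X B f"
  shows "A = B"
proof (intro ext)
  fix k l
  show "A k l = B k l"
  proof (cases "l \<in> X")
    case True
    show ?thesis
    proof (rule blinfun_eqI)
      fix x
      show "blinfun_apply (A k l) x = blinfun_apply (B k l) x"
        using eq[OF ell2_single(1)[OF True]] operator_single[OF A True] operator_single[OF B True]
        by metis
    qed
  qed (simp add: op_matrices_outside[OF schur_matrices_op[OF A]] op_matrices_outside[OF schur_matrices_op[OF B]])
qed

text \<open>An entry is recovered by letting the operator act on a family supported at one index and
  reading off one coordinate. This is how operator bounds reach the entries and, through them, the
  Schur norms.\<close>

lemma entry_le_operator_bound: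
  assumes A: "A \<in> (mats :: ('i, 'h::chilbert_space) op_matrix set)"
    and c: "\<And>f. f \<in> ell2 X \<Longrightarrow> ell2_norm X (matrix_operator X A f) \<le> c * ell2_norm X f"
    and "0 \<le> c"
  shows "norm (A k l) \<le> c"
proof (cases "l \<in> X")
  case True
  show ?thesis
  proof (rule norm_blinfun_bound)
    fix x :: 'h
    let ?f = "\<lambda>n. if n = l then x else 0"
    note f = ell2_single[OF True, of x]
    have "norm (blinfun_apply (A k l) x) \<le> ell2_norm X (matrix_operator X A ?f)"
      using norm_le_ell2_norm[OF operator_bounded(1)[OF A f(1)], of k] by (simp add: operator_single[OF A True])
    then show "norm (blinfun_apply (A k l) x) \<le> c * norm x"
      using c[OF f(1)] by (simp add: f(2))
  qed fact
qed (simp add: op_matrices_outside[OF schur_matrices_op[OF A]] \<open>0 \<le> c\<close>)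

end

section \<open>The axioms of a unital Banach star-algebra\<close>

lemma cring_complex_field: "cring complex_field"
proof (intro cringI abelian_groupI comm_monoidI)
  show "\<exists>y\<in>carrier complex_field. y \<oplus>\<^bsub>complex_field\<^esub> x = \<zero>\<^bsub>complex_field\<^esub>" for x
    by (rule bexI[of _ "- x"]) (simp_all add: complex_field_def)
qed (simp_all add: complex_field_def distrib_right)

context schur_weight
begin

lemma abelian_group_alg: "abelian_group (alg :: ('i, 'h::chilbert_space) op_matrix star_algebra)"
proof (rule abelian_groupI)
  fix A :: "('i, 'h) op_matrix" assume "A \<in> carrier alg"
  then have A: "A \<in> mats" by simp
  have "scaleC_blinfun (-1) T + T = 0" for T :: "'h \<Rightarrow>\<^sub>L 'h"
    by (rule blinfun_eqI) (simp add: blinfun.add_left scaleC_blinfun.rep_eq)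
  then show "\<exists>B\<in>carrier alg. B \<oplus>\<^bsub>alg\<^esub> A = \<zero>\<^bsub>alg\<^esub>"
    using scaleC_closed[OF A, of "-1"]
    by (intro bexI[of _ "\<lambda>k l. scaleC_blinfun (-1) (A k l)"]) simp_all
qed (simp_all add: add_closed zero_closed add_ac)

lemma operator_one:
  assumes f: "f \<in> ell2 X"
  shows "matrix_operator X \<one>\<^bsub>alg\<^esub> f = f"
proof
  fix k
  have "((\<lambda>l. blinfun_apply ((\<one>\<^bsub>alg\<^esub> :: ('i, 'a) op_matrix) k l) (f l)) has_sum f k) X"
    by (cases "k \<in> X"; rule has_sum_finite_neutralI[of "{k} \<inter> X"]) (use ell2_outside[OF f] in auto)
  then show "matrix_operator X \<one>\<^bsub>alg\<^esub> f k = f k"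
    unfolding operator_apply[OF f] by (rule infsumI)
qed

lemma monoid_alg: "monoid (alg :: ('i, 'h::chilbert_space) op_matrix star_algebra)"
proof
  fix A B C :: "('i, 'h) op_matrix"
  assume "A \<in> carrier alg" then have A: "A \<in> mats" by simp
  show "\<one>\<^bsub>alg\<^esub> \<otimes>\<^bsub>alg\<^esub> A = A"
    by (rule operator_inj[OF mult_closed[OF one_closed A] A])
      (simp only: operator_mult[OF one_closed A] operator_one operator_bounded[OF A])
  show "A \<otimes>\<^bsub>alg\<^esub> \<one>\<^bsub>alg\<^esub> = A"
    by (rule operator_inj[OF mult_closed[OF A one_closed] A])
      (simp only: operator_mult[OF A one_closed] operator_one)
  assume "B \<in> carrier alg" then have B: "B \<in> mats" by simp
  show "A \<otimes>\<^bsub>alg\<^esub> B \<in> carrier alg" using mult_closed[OF A B] by simp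
  assume "C \<in> carrier alg" then have C: "C \<in> mats" by simp
  show "A \<otimes>\<^bsub>alg\<^esub> B \<otimes>\<^bsub>alg\<^esub> C = A \<otimes>\<^bsub>alg\<^esub> (B \<otimes>\<^bsub>alg\<^esub> C)"
    by (rule operator_inj[OF mult_closed[OF mult_closed[OF A B] C] mult_closed[OF A mult_closed[OF B C]]])
      (simp only: operator_mult[OF A B] operator_mult[OF B C] operator_mult[OF mult_closed[OF A B] C]
        operator_mult[OF A mult_closed[OF B C]] operator_bounded(1)[OF C])
next
  show "\<one>\<^bsub>alg\<^esub> \<in> carrier alg" using one_closed by simp
qed

lemma operator_add:
  assumes A: "A \<in> mats" and B: "B \<in> mats" and f: "f \<in> ell2 X"
  shows "matrix_operator X (A \<oplus>\<^bsub>alg\<^esub> B) f = (\<lambda>k. matrix_operator X A f k + matrix_operator X B f k)"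
  by (rule ext) (simp add: operator_apply[OF f] blinfun.add_left infsum_add operator_summable A B f)

lemma operator_scaleC:
  assumes A: "A \<in> mats" and f: "f \<in> ell2 X"
  shows "matrix_operator X (c \<odot>\<^bsub>alg\<^esub> A) f = (\<lambda>k. c *\<^sub>C matrix_operator X A f k)"
  by (rule ext) (simp add: operator_apply[OF f] scaleC_blinfun.rep_eq
      infsum_bounded_linear[OF bounded_linear_scaleC] operator_summable A f)

lemma operator_linear_add:
  assumes A: "A \<in> mats" and f: "f \<in> ell2 X" and g: "g \<in> ell2 X"
  shows "matrix_operator X A (\<lambda>k. f k + g k) = (\<lambda>k. matrix_operator X A f k + matrix_operator X A g k)"
  by (rule ext) (simp add: operator_apply f g ell2_add blinfun.add_right infsum_add operator_summable A)

lemma operator_linear_scaleC: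
  assumes A: "A \<in> mats" and f: "f \<in> ell2 X"
  shows "matrix_operator X A (\<lambda>k. c *\<^sub>C f k) = (\<lambda>k. c *\<^sub>C matrix_operator X A f k)"
  by (rule ext) (simp add: operator_apply f ell2_scaleC operator_summable A
      bounded_opsD[OF op_matrices_bounded_ops[OF schur_matrices_op[OF A]]]
      infsum_bounded_linear[OF bounded_linear_scaleC])

lemma ring_alg: "ring (alg :: ('i, 'h::chilbert_space) op_matrix star_algebra)"
proof (rule ringI[OF abelian_group_alg monoid_alg])
  fix A B C :: "('i, 'h) op_matrix"
  assume "A \<in> carrier alg" "B \<in> carrier alg" "C \<in> carrier alg"
  then have A: "A \<in> mats" and B: "B \<in> mats" and C: "C \<in> mats" by simp_all
  show "(A \<oplus>\<^bsub>alg\<^esub> B) \<otimes>\<^bsub>alg\<^esub> C = A \<otimes>\<^bsub>alg\<^esub> C \<oplus>\<^bsub>alg\<^esub> B \<otimes>\<^bsub>alg\<^esub> C"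
    by (simp add: bounded_bilinear.add_left[OF bounded_bilinear_blinfun_compose] infsum_add
        mult_summable A B C)
  show "C \<otimes>\<^bsub>alg\<^esub> (A \<oplus>\<^bsub>alg\<^esub> B) = C \<otimes>\<^bsub>alg\<^esub> A \<oplus>\<^bsub>alg\<^esub> C \<otimes>\<^bsub>alg\<^esub> B"
    by (simp add: bounded_bilinear.add_right[OF bounded_bilinear_blinfun_compose] infsum_add
        mult_summable A B C)
qed

lemma minus_alg:
  assumes A: "A \<in> mats" and B: "B \<in> mats"
  shows "A \<ominus>\<^bsub>alg\<^esub> B = (\<lambda>k l. A k l - B k l)"
proof -
  interpret ring alg by (rule ring_alg)
  have neg: "(\<lambda>k l. - B k l) \<in> mats"
  proof -
    have "scaleC_blinfun (-1) T = - T" for T :: "'a \<Rightarrow>\<^sub>L 'a"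
      by (rule blinfun_eqI) (simp add: blinfun.minus_left scaleC_blinfun.rep_eq)
    then show ?thesis using scaleC_closed[OF B, of "-1"] by simp
  qed
  have "\<ominus>\<^bsub>alg\<^esub> B = (\<lambda>k l. - B k l)"
    by (rule minus_equality) (simp_all add: B neg)
  then show ?thesis by (simp add: a_minus_def)
qed

lemma diff_closed:
  assumes A: "A \<in> mats" and B: "B \<in> mats"
  shows "(\<lambda>k l. A k l - B k l) \<in> mats"
  using minus_alg[OF assms] abelian_group.minus_closed[OF abelian_group_alg, of A B] A B by simp

lemma complete_mats:
  fixes s :: "nat \<Rightarrow> ('i, 'h::chilbert_space) op_matrix"
  assumes s: "\<And>n. s n \<in> mats"
    and cauchy: "\<And>e. 0 < e \<Longrightarrow> \<exists>M. \<forall>m\<ge>M. \<forall>n\<ge>M. nrm (\<lambda>k l. s m k l - s n k l) < e"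
  shows "\<exists>A\<in>mats. (\<lambda>n. nrm (\<lambda>k l. s n k l - A k l)) \<longlonglongrightarrow> 0"
proof -
  have "Cauchy (\<lambda>n. s n k l)" for k l
  proof (rule metric_CauchyI)
    fix e :: real assume "0 < e"
    then obtain M where M: "\<forall>m\<ge>M. \<forall>n\<ge>M. nrm (\<lambda>k l. s m k l - s n k l) < e" using cauchy by blast
    have "dist (s m k l) (s n k l) < e" if "M \<le> m" "M \<le> n" for m n
      using entry_le[OF diff_closed[OF s[of m] s[of n]], of k l] M that
      by (auto simp: dist_norm intro: le_less_trans)
    then show "\<exists>M. \<forall>m\<ge>M. \<forall>n\<ge>M. dist (s m k l) (s n k l) < e" by blast
  qed
  then have "\<exists>T. (\<lambda>n. s n k l) \<longlonglongrightarrow> T" for k l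
    using Cauchy_convergent convergent_def by blast
  then obtain A where lim: "\<And>k l. (\<lambda>n. s n k l) \<longlonglongrightarrow> A k l" by metis
  have op: "A \<in> op_matrices X"
  proof -
    have "A k l \<in> bounded_ops" for k l
      by (rule Lim_in_closed_set[OF closed_bounded_ops _ _ lim])
        (simp_all add: op_matrices_bounded_ops[OF schur_matrices_op[OF s]])
    moreover have "A k l = 0" if "k \<notin> X \<or> l \<notin> X" for k l
      using lim[of k l] op_matrices_outside[OF schur_matrices_op[OF s] that]
      by (simp add: LIMSEQ_const_iff)
    ultimately show ?thesis by (simp add: op_matrices_def)
  qed
  have bd: "\<exists>M. \<forall>m\<ge>M. schur_bound X W (\<lambda>k l. s m k l - A k l) e" if e: "0 < e" for e
  proof -
    obtain M where M: "\<forall>m\<ge>M. \<forall>n\<ge>M. nrm (\<lambda>k l. s m k l - s n k l) < e" using cauchy e by blast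
    have "schur_bound X W (\<lambda>k l. s m k l - A k l) e" if m: "M \<le> m" for m
    \<comment> \<open>In the Cauchy estimate \<open>m\<close> stays fixed while \<open>n\<close>
      tends to infinity.\<close>
    proof (rule schur_bound_limit[where Q = sequentially and A = "\<lambda>n k l. s m k l - s n k l"])
      show "(\<lambda>n. s m k l - s n k l) \<longlonglongrightarrow> s m k l - A k l" for k l
        by (intro tendsto_intros lim)
      have "schur_bound X W (\<lambda>k l. s m k l - s n k l) e" if "M \<le> n" for n
        by (rule schur_bound_mono[OF schur_bound_norm[OF diff_closed[OF s[of m] s[of n]]]])
          (use M m that e less_imp_le in auto)
      then show "\<forall>\<^sub>F n in sequentially. schur_bound X W (\<lambda>k l. s m k l - s n k l) e"
        using eventually_sequentially by blast
    qed simp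
    then show ?thesis by blast
  qed
  have A: "A \<in> mats"
  proof -
    obtain M where "schur_bound X W (\<lambda>k l. s M k l - A k l) 1" using bd[of 1] by auto
    moreover have "(\<lambda>k l. s M k l - A k l) \<in> op_matrices X"
      using schur_matrices_op[OF s[of M]] op by (auto simp: op_matrices_def bounded_ops_diff)
    ultimately have "(\<lambda>k l. s M k l - A k l) \<in> mats" by (rule schur_matricesI[rotated])
    \<comment> \<open>\<open>A\<close> is the difference of \<open>s M\<close> and
      \<open>s M - A\<close>, both of which lie in the class.\<close>
    from diff_closed[OF s[of M] this] show ?thesis by simp
  qed
  have "(\<lambda>n. nrm (\<lambda>k l. s n k l - A k l)) \<longlonglongrightarrow> 0"
  proof (rule LIMSEQ_I)
    fix r :: real assume "0 < r"
    then obtain M where M: "\<forall>m\<ge>M. schur_bound X W (\<lambda>k l. s m k l - A k l) (r/2)"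
      using bd[of "r/2"] by auto
    have "norm (nrm (\<lambda>k l. s m k l - A k l) - 0) < r" if "M \<le> m" for m
      using schur_norm_le[OF M[rule_format, OF that]] schur_norm_nonneg[OF diff_closed[OF s[of m] A]] \<open>0 < r\<close>
      by simp
    then show "\<exists>no. \<forall>n\<ge>no. norm (nrm (\<lambda>k l. s n k l - A k l) - 0) < r" by blast
  qed
  with A show ?thesis by blast
qed

lemma mult_scaleC:
  fixes A B :: "('i, 'h::chilbert_space) op_matrix"
  assumes A: "A \<in> mats" and B: "B \<in> mats"
  shows "(c \<odot>\<^bsub>alg\<^esub> A) \<otimes>\<^bsub>alg\<^esub> B = c \<odot>\<^bsub>alg\<^esub> (A \<otimes>\<^bsub>alg\<^esub> B)"
    and "A \<otimes>\<^bsub>alg\<^esub> (c \<odot>\<^bsub>alg\<^esub> B) = c \<odot>\<^bsub>alg\<^esub> (A \<otimes>\<^bsub>alg\<^esub> B)"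
proof -
  have C: "c \<odot>\<^bsub>alg\<^esub> C \<in> mats" if "C \<in> mats" for C :: "('i, 'h) op_matrix"
    using scaleC_closed[OF that] by simp
  show "(c \<odot>\<^bsub>alg\<^esub> A) \<otimes>\<^bsub>alg\<^esub> B = c \<odot>\<^bsub>alg\<^esub> (A \<otimes>\<^bsub>alg\<^esub> B)"
    by (rule operator_inj[OF mult_closed[OF C[OF A] B] C[OF mult_closed[OF A B]]])
      (simp only: operator_mult[OF C[OF A] B] operator_scaleC[OF mult_closed[OF A B]]
        operator_scaleC[OF A] operator_bounded(1)[OF B] operator_mult[OF A B])
  show "A \<otimes>\<^bsub>alg\<^esub> (c \<odot>\<^bsub>alg\<^esub> B) = c \<odot>\<^bsub>alg\<^esub> (A \<otimes>\<^bsub>alg\<^esub> B)"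
    by (rule operator_inj[OF mult_closed[OF A C[OF B]] C[OF mult_closed[OF A B]]])
      (simp only: operator_mult[OF A C[OF B]] operator_scaleC[OF mult_closed[OF A B]]
        operator_scaleC[OF B] operator_linear_scaleC[OF A] operator_bounded(1)[OF B] operator_mult[OF A B])
qed

lemma module_alg: "Module.module complex_field (alg :: ('i, 'h::chilbert_space) op_matrix star_algebra)"
proof (rule moduleI[OF cring_complex_field abelian_group_alg])
  show "a \<odot>\<^bsub>alg\<^esub> x \<in> carrier alg" if "x \<in> carrier alg" for a and x :: "('i, 'h) op_matrix"
    using that by (simp add: scaleC_closed)
qed (auto simp: complex_field_def intro!: blinfun_eqI ext
    simp: scaleC_blinfun.rep_eq blinfun.add_left scaleC_add_left scaleC_add_right scaleC_scaleC)

lemma nrm_zero: "nrm (\<lambda>k l. 0 :: 'h::chilbert_space \<Rightarrow>\<^sub>L 'h) = 0"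
  by (rule antisym[OF schur_norm_le[OF schur_bound_zero] schur_norm_nonneg[OF zero_closed]])

lemma nrm_scaleC:
  assumes A: "A \<in> mats"
  shows "nrm (\<lambda>k l. scaleC_blinfun c (A k l)) = cmod c * nrm A"
proof (cases "c = 0")
  case True
  have "scaleC_blinfun 0 T = 0" for T :: "'a \<Rightarrow>\<^sub>L 'a"
    by (rule blinfun_eqI) (simp add: scaleC_blinfun.rep_eq)
  then show ?thesis
    using True by (simp add: nrm_zero)
next
  case False
  have le: "nrm (\<lambda>k l. scaleC_blinfun d (B k l)) \<le> cmod d * nrm B" if "B \<in> mats" for d and B :: "('i, 'a) op_matrix"
    by (rule schur_norm_le[OF schur_bound_scaleC[OF schur_bound_norm[OF that]]])
  have "A = (\<lambda>k l. scaleC_blinfun (inverse c) (scaleC_blinfun c (A k l)))"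
    using False by (intro ext blinfun_eqI) (simp add: scaleC_blinfun.rep_eq scaleC_scaleC)
  then have "nrm A \<le> inverse (cmod c) * nrm (\<lambda>k l. scaleC_blinfun c (A k l))"
    using le[OF scaleC_closed[OF A], of "inverse c" c] by (simp add: norm_inverse)
  then have "cmod c * nrm A \<le> nrm (\<lambda>k l. scaleC_blinfun c (A k l))"
    using False by (simp add: field_simps)
  with le[OF A, of c] show ?thesis by simp
qed

text \<open>The adjoint of an infinite sum is found by testing with vectors: evaluation followed by
  \<open>inner\<close> is bounded linear, hence passes through the sum and meets the adjoints of the
  single terms. The imaginary part follows by testing at \<open>\<i> *\<^sub>C x\<close>.\<close>

lemma star_mult_alg:
  fixes A B :: "('i, 'h::chilbert_space) op_matrix"
  assumes A: "A \<in> mats" and B: "B \<in> mats"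
  shows "star alg (A \<otimes>\<^bsub>alg\<^esub> B) = star alg B \<otimes>\<^bsub>alg\<^esub> star alg A"
proof -
  have "adjoint_op (\<Sum>\<^sub>\<infinity>n\<in>X. A l n o\<^sub>L B n k) = (\<Sum>\<^sub>\<infinity>n\<in>X. adjoint_op (B n k) o\<^sub>L adjoint_op (A l n))" for k l
  proof (rule adjoint_op_eqI)
    fix x y :: 'h
    note bop = op_matrices_bounded_ops[OF schur_matrices_op[OF A]] op_matrices_bounded_ops[OF schur_matrices_op[OF B]]
    have sum: "(\<lambda>n. adjoint_op (B n k) o\<^sub>L adjoint_op (A l n)) summable_on X"
      using mult_summable[OF star_closed[OF B] star_closed[OF A], of k l] by simp
    have inner: "inner (blinfun_apply (\<Sum>\<^sub>\<infinity>n\<in>X. A l n o\<^sub>L B n k) z) y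
        = inner z (blinfun_apply (\<Sum>\<^sub>\<infinity>n\<in>X. adjoint_op (B n k) o\<^sub>L adjoint_op (A l n)) y)" for z
    proof -
      have "inner (blinfun_apply (\<Sum>\<^sub>\<infinity>n\<in>X. A l n o\<^sub>L B n k) z) y
          = (\<Sum>\<^sub>\<infinity>n\<in>X. inner (blinfun_apply (A l n o\<^sub>L B n k) z) y)"
        by (rule infsum_bounded_linear[OF bounded_linear_compose[OF bounded_linear_inner_left
              blinfun.bounded_linear_left] mult_summable[OF A B], symmetric])
      also have "\<dots> = (\<Sum>\<^sub>\<infinity>n\<in>X. inner z (blinfun_apply (adjoint_op (B n k) o\<^sub>L adjoint_op (A l n)) y))"
        by (simp add: inner_adjoint_op bop)
      also have "\<dots> = inner z (blinfun_apply (\<Sum>\<^sub>\<infinity>n\<in>X. adjoint_op (B n k) o\<^sub>L adjoint_op (A l n)) y)"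
        by (rule infsum_bounded_linear[OF bounded_linear_compose[OF bounded_linear_inner_right
              blinfun.bounded_linear_left] sum])
      finally show ?thesis .
    qed
    have "(\<Sum>\<^sub>\<infinity>n\<in>X. A l n o\<^sub>L B n k) \<in> bounded_ops"
      using op_matrices_bounded_ops[OF schur_matrices_op[OF mult_closed[OF A B]], of l k] by simp
    note opc = bounded_opsD[OF this]
    show "cinner (blinfun_apply (\<Sum>\<^sub>\<infinity>n\<in>X. A l n o\<^sub>L B n k) x) y
        = cinner x (blinfun_apply (\<Sum>\<^sub>\<infinity>n\<in>X. adjoint_op (B n k) o\<^sub>L adjoint_op (A l n)) y)"
      by (rule complex_eqI) (simp_all add: Re_cinner Im_cinner inner[symmetric] opc)
  qed
  then show ?thesis by simp
qed

theorem unital_banach_star_algebra_alg: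
  "unital_banach_star_algebra (alg :: ('i, 'h::chilbert_space) op_matrix star_algebra)"
proof (intro unital_banach_star_algebra.intro ring_alg module_alg unital_banach_star_algebra_axioms.intro)
  fix A B :: "('i, 'h) op_matrix" and c :: complex
  assume "A \<in> carrier alg" then have A: "A \<in> mats" by simp
  note bop = op_matrices_bounded_ops[OF schur_matrices_op[OF A]]
  show "0 \<le> anorm alg A" using schur_norm_nonneg[OF A] by simp
  show "anorm alg A = 0 \<longleftrightarrow> A = \<zero>\<^bsub>alg\<^esub>"
  proof
    assume "anorm alg A = 0"
    then have "norm (A k l) \<le> 0" for k l using entry_le[OF A, of k l] by simp
    then show "A = \<zero>\<^bsub>alg\<^esub>" by (simp add: fun_eq_iff)
  next
    assume "A = \<zero>\<^bsub>alg\<^esub>"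
    then show "anorm alg A = 0"
      by (simp add: nrm_zero)
  qed
  show "anorm alg (c \<odot>\<^bsub>alg\<^esub> A) = cmod c * anorm alg A" using nrm_scaleC[OF A] by simp
  show "star alg A \<in> carrier alg" using star_closed[OF A] by simp
  show "star alg (star alg A) = A" by (simp add: adjoint_op_adjoint_op bop)
  show "star alg (c \<odot>\<^bsub>alg\<^esub> A) = cnj c \<odot>\<^bsub>alg\<^esub> star alg A" by (simp add: adjoint_op_scaleC bop)
  have le: "nrm (\<lambda>k l. adjoint_op (C l k)) \<le> nrm C" if "C \<in> mats" for C :: "('i, 'h) op_matrix"
    by (rule schur_norm_le[OF schur_bound_star[OF schur_bound_norm[OF that] schur_matrices_op[OF that]]])
  show "anorm alg (star alg A) = anorm alg A"
    using le[OF A] le[OF star_closed[OF A]] by (simp add: adjoint_op_adjoint_op bop)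
  assume "B \<in> carrier alg" then have B: "B \<in> mats" by simp
  show "(c \<odot>\<^bsub>alg\<^esub> A) \<otimes>\<^bsub>alg\<^esub> B = c \<odot>\<^bsub>alg\<^esub> (A \<otimes>\<^bsub>alg\<^esub> B)" by (rule mult_scaleC[OF A B])
  show "A \<otimes>\<^bsub>alg\<^esub> (c \<odot>\<^bsub>alg\<^esub> B) = c \<odot>\<^bsub>alg\<^esub> (A \<otimes>\<^bsub>alg\<^esub> B)" by (rule mult_scaleC[OF A B])
  show "anorm alg (A \<oplus>\<^bsub>alg\<^esub> B) \<le> anorm alg A + anorm alg B"
    using schur_norm_le[OF schur_bound_add[OF schur_bound_norm[OF A] schur_bound_norm[OF B]]] by simp
  show "anorm alg (A \<otimes>\<^bsub>alg\<^esub> B) \<le> anorm alg A * anorm alg B"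
    using norm_mult_le[OF A B] by simp
  show "star alg (A \<oplus>\<^bsub>alg\<^esub> B) = star alg A \<oplus>\<^bsub>alg\<^esub> star alg B"
    by (simp add: adjoint_op_add bop op_matrices_bounded_ops[OF schur_matrices_op[OF B]])
  show "star alg (A \<otimes>\<^bsub>alg\<^esub> B) = star alg B \<otimes>\<^bsub>alg\<^esub> star alg A"
    by (rule star_mult_alg[OF A B])
next
  assume ne: "(\<one>\<^bsub>alg\<^esub> :: ('i, 'h) op_matrix) \<noteq> \<zero>\<^bsub>alg\<^esub>"
  then obtain k where k: "k \<in> X" and id: "(id_blinfun :: 'h \<Rightarrow>\<^sub>L 'h) \<noteq> 0"
    by (auto simp: fun_eq_iff split: if_splits)
  have "nrm (\<one>\<^bsub>alg\<^esub> :: ('i, 'h) op_matrix) \<le> norm (id_blinfun :: 'h \<Rightarrow>\<^sub>L 'h)"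
    by (rule schur_norm_le[OF schur_bound_one])
  moreover have "norm ((\<one>\<^bsub>alg\<^esub> :: ('i, 'h) op_matrix) k k) \<le> nrm (\<one>\<^bsub>alg\<^esub> :: ('i, 'h) op_matrix)"
    by (rule entry_le[OF one_closed])
  ultimately show "anorm alg (\<one>\<^bsub>alg\<^esub> :: ('i, 'h) op_matrix) = 1"
    using norm_id_blinfun_eq[OF id] k by simp
next
  fix s :: "nat \<Rightarrow> ('i, 'h) op_matrix"
  assume "\<And>n. s n \<in> carrier alg"
  then have s: "\<And>n. s n \<in> mats" by simp
  assume "\<And>e. 0 < e \<Longrightarrow> \<exists>M. \<forall>m\<ge>M. \<forall>n\<ge>M. anorm alg (s m \<ominus>\<^bsub>alg\<^esub> s n) < e"
  then have "\<And>e. 0 < e \<Longrightarrow> \<exists>M. \<forall>m\<ge>M. \<forall>n\<ge>M. nrm (\<lambda>k l. s m k l - s n k l) < e"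
    by (simp add: minus_alg[OF s s])
  from complete_mats[OF s this] obtain A where A: "A \<in> mats" "(\<lambda>n. nrm (\<lambda>k l. s n k l - A k l)) \<longlonglongrightarrow> 0"
    by blast
  then show "\<exists>a\<in>carrier alg. (\<lambda>n. anorm alg (s n \<ominus>\<^bsub>alg\<^esub> a)) \<longlonglongrightarrow> 0"
    by (intro bexI[of _ A]) (simp_all add: minus_alg[OF s A(1)])
qed

end

section \<open>Spectral radius and left inverses\<close>

text \<open>The sum of the first \<open>n\<close> powers, beginning with the zeroth. It is built
  from the ring operations since the algebra is a record and not a type with its own
  addition.\<close>

primrec partial_geometric :: "('a, 'b) ring_scheme \<Rightarrow> 'a \<Rightarrow> nat \<Rightarrow> 'a" where
  "partial_geometric G r 0 = \<zero>\<^bsub>G\<^esub>"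
| "partial_geometric G r (Suc n) = partial_geometric G r n \<oplus>\<^bsub>G\<^esub> r [^]\<^bsub>G\<^esub> n"

lemma (in ring) partial_geometric_closed: "r \<in> carrier R \<Longrightarrow> partial_geometric R r n \<in> carrier R"
  by (induction n) auto

lemma (in ring) minus_minus_one: "x \<in> carrier R \<Longrightarrow> \<one> \<ominus> (\<one> \<ominus> x) = x"
  by (simp add: a_minus_def minus_add r_neg1 r_neg2)

lemma (in ring) minus_self: "x \<in> carrier R \<Longrightarrow> x \<ominus> x = \<zero>"
  by (simp add: a_minus_def r_neg)

lemma (in ring) minus_eq_zeroD:
  "x \<in> carrier R \<Longrightarrow> y \<in> carrier R \<Longrightarrow> x \<ominus> y = \<zero> \<Longrightarrow> x = y"
  using minus_equality[of x "\<ominus> y"] by (simp add: a_minus_def)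

lemma (in ring) minus_swap: "a \<in> carrier R \<Longrightarrow> b \<in> carrier R \<Longrightarrow> a \<ominus> b = \<ominus> (b \<ominus> a)"
  by (simp add: a_minus_def minus_add a_ac)

lemma (in ring) add_minus_cancel_mid:
  "x \<in> carrier R \<Longrightarrow> y \<in> carrier R \<Longrightarrow> p \<in> carrier R \<Longrightarrow> (x \<oplus> p) \<ominus> y = (x \<ominus> y) \<oplus> p"
  by (simp add: a_minus_def a_ac)

text \<open>Error splitting for the Neumann series: \<open>s\<close> is a partial sum,
  \<open>p\<close> the power left over by telescoping, \<open>u\<close> the element to be inverted,
  and \<open>b\<close> the limit of the partial sums.\<close>

lemma (in ring) minus_one_decomp:
  assumes "b \<in> carrier R" "s \<in> carrier R" "u \<in> carrier R" "p \<in> carrier R" "s \<otimes> u = \<one> \<ominus> p"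
  shows "b \<otimes> u \<ominus> \<one> = (b \<ominus> s) \<otimes> u \<oplus> \<ominus> p"
proof -
  have "(b \<ominus> s) \<otimes> u = b \<otimes> u \<oplus> (\<ominus> \<one> \<oplus> p)"
    using assms by (simp add: a_minus_def l_distr l_minus minus_add)
  then show ?thesis using assms by (simp add: a_minus_def a_assoc r_neg)
qed

lemma (in ring) partial_geometric_mult:
  assumes r: "r \<in> carrier R"
  shows "partial_geometric R r n \<otimes> (\<one> \<ominus> r) = \<one> \<ominus> r [^] n"
proof (induction n)
  case 0
  then show ?case using r by (simp add: a_minus_def r_neg)
next
  case (Suc n)
  have c: "r [^] n \<in> carrier R" "partial_geometric R r n \<in> carrier R"
    using r partial_geometric_closed by auto
  have "partial_geometric R r (Suc n) \<otimes> (\<one> \<ominus> r) = (\<one> \<ominus> r [^] n) \<oplus> r [^] n \<otimes> (\<one> \<ominus> r)"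
    using c r by (simp add: l_distr Suc.IH)
  also have "\<dots> = (\<one> \<oplus> \<ominus> (r [^] n)) \<oplus> (r [^] n \<oplus> \<ominus> (r [^] n \<otimes> r))"
    using c r by (simp add: a_minus_def r_distr r_minus)
  also have "\<dots> = \<one> \<ominus> r [^] n \<otimes> r"
    using c r by (simp add: a_minus_def a_assoc r_neg1)
  finally show ?case by simp
qed

lemma (in ring) partial_geometric_left_inverse:
  assumes "r \<in> carrier R" "b \<in> carrier R" "b \<otimes> (\<one> \<ominus> r [^] n) = \<one>"
  shows "(b \<otimes> partial_geometric R r n) \<otimes> (\<one> \<ominus> r) = \<one>"
  using assms partial_geometric_closed[OF assms(1), of n]
  by (simp add: m_assoc partial_geometric_mult)

context unital_banach_star_algebra
begin

lemma ring_self: "ring A"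
  using unital_banach_star_algebra_axioms by (simp add: unital_banach_star_algebra_def)

lemma anorm_minus:
  assumes "a \<in> carrier A" shows "anorm A (\<ominus> a) = anorm A a"
proof -
  have cf: "carrier complex_field = UNIV" "\<And>x y. x \<oplus>\<^bsub>complex_field\<^esub> y = x + y" "\<zero>\<^bsub>complex_field\<^esub> = 0"
    "\<one>\<^bsub>complex_field\<^esub> = 1"
    by (simp_all add: complex_field_def)
  have closed: "(-1) \<odot> a \<in> carrier A" using smult_closed[of "-1" a] assms by (simp add: cf)
  have "(-1) \<odot> a \<oplus> a = 0 \<odot> a"
    using smult_l_distr[of "-1" 1 a] smult_one[of a] assms by (simp add: cf)
  also have "\<dots> = \<zero>" using smult_l_null[of a] assms by (simp add: cf)
  finally have "\<ominus> a = (-1) \<odot> a" using abelian_group.minus_equality[OF ring.is_abelian_group[OF ring_self] _ assms closed] by simp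
  then show ?thesis using anorm_smult[OF assms, of "-1"] by simp
qed

lemma anorm_one_le: "anorm A \<one> \<le> 1"
  using anorm_one anorm_eq_zero[of \<one>] by (cases "\<one> = \<zero>") auto

lemma anorm_pow:
  assumes "a \<in> carrier A" shows "anorm A (a [^] (n::nat)) \<le> anorm A a ^ n"
proof (induction n)
  case 0
  then show ?case by (simp add: anorm_one_le)
next
  case (Suc n)
  have "anorm A (a [^] Suc n) \<le> anorm A (a [^] n) * anorm A a"
    using anorm_mult[of "a [^] n" a] assms by simp
  also have "\<dots> \<le> anorm A a ^ n * anorm A a"
    by (intro mult_right_mono Suc.IH anorm_nonneg assms)
  finally show ?case by (simp add: mult.commute)
qed

lemma neumann_left_inverse:
  assumes r: "r \<in> carrier A" and small: "anorm A r < 1"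
  shows "\<exists>b\<in>carrier A. b \<otimes> (\<one> \<ominus> r) = \<one>"
proof -
  let ?s = "partial_geometric A r"
  define x where "x = anorm A r"
  have x: "0 \<le> x" "x < 1" using small anorm_nonneg[OF r] by (simp_all add: x_def)
  note s = ring.partial_geometric_closed[OF ring_self r]
  have step: "anorm A (?s (n + m) \<ominus> ?s n) \<le> (\<Sum>i=n..<n+m. x ^ i)" for n m
  proof (induction m)
    case 0
    have "?s n \<ominus> ?s n = \<zero>" by (rule ring.minus_self[OF ring_self s])
    then show ?case using anorm_eq_zero[of \<zero>] by simp
  next
    case (Suc m)
    have c: "r [^] (n + m) \<in> carrier A" using r by simp
    have "?s (n + Suc m) \<ominus> ?s n = (?s (n + m) \<ominus> ?s n) \<oplus> r [^] (n + m)"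
      using s[of "n + m"] s[of n] c by (simp add: ring.add_minus_cancel_mid[OF ring_self])
    then have "anorm A (?s (n + Suc m) \<ominus> ?s n) \<le> anorm A (?s (n + m) \<ominus> ?s n) + anorm A (r [^] (n + m))"
      using anorm_add[of "?s (n + m) \<ominus> ?s n" "r [^] (n + m)"] s c by simp
    also have "\<dots> \<le> (\<Sum>i=n..<n+m. x ^ i) + x ^ (n + m)"
      unfolding x_def[symmetric] using anorm_pow[OF r, of "n + m"] Suc.IH by (simp add: x_def)
    finally show ?case by simp
  qed
  have swap: "anorm A (a \<ominus> b) = anorm A (b \<ominus> a)" if "a \<in> carrier A" "b \<in> carrier A" for a b
    using anorm_minus[of "b \<ominus> a"] ring.minus_swap[OF ring_self that] that by simp
  have summ: "summable (\<lambda>i. x ^ i)" using x by (intro summable_geometric) simp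
  have "\<exists>M. \<forall>m\<ge>M. \<forall>n\<ge>M. anorm A (?s m \<ominus> ?s n) < e" if e: "0 < e" for e
  proof -
    obtain M where M: "\<And>m n. M \<le> m \<Longrightarrow> norm (\<Sum>i=m..<n. x ^ i) < e"
      using summ e unfolding summable_Cauchy by blast
    have *: "anorm A (?s m \<ominus> ?s n) < e" if "M \<le> n" "n \<le> m" for m n
      using step[of n "m - n"] M[OF that(1), of m] that by simp
    have "anorm A (?s m \<ominus> ?s n) < e" if "M \<le> m" "M \<le> n" for m n
      using *[of n m] *[of m n] swap[OF s s, of m n] that by (cases "n \<le> m") auto
    then show ?thesis by blast
  qed
  from complete[OF s this] obtain b where b: "b \<in> carrier A"
    and lim: "(\<lambda>n. anorm A (?s n \<ominus> b)) \<longlonglongrightarrow> 0" by blast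
  let ?u = "\<one> \<ominus> r"
  have u: "?u \<in> carrier A" using r by simp
  \<comment> \<open>The left-hand side does not depend on \<open>n\<close>, while the right-hand
    side tends to 0; this forces \<open>b\<close> to be a left inverse.\<close>
  have bound: "anorm A (b \<otimes> ?u \<ominus> \<one>) \<le> anorm A (?s n \<ominus> b) * anorm A ?u + x ^ n" for n
  proof -
    have p: "r [^] n \<in> carrier A" using r by simp
    have "b \<otimes> ?u \<ominus> \<one> = (b \<ominus> ?s n) \<otimes> ?u \<oplus> \<ominus> (r [^] n)"
      using b s u p by (intro ring.minus_one_decomp[OF ring_self] ring.partial_geometric_mult[OF ring_self] r)
    then have "anorm A (b \<otimes> ?u \<ominus> \<one>) \<le> anorm A ((b \<ominus> ?s n) \<otimes> ?u) + anorm A (\<ominus> (r [^] n))"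
      using anorm_add[of "(b \<ominus> ?s n) \<otimes> ?u" "\<ominus> (r [^] n)"] b s[of n] u p by simp
    also have "\<dots> \<le> anorm A (b \<ominus> ?s n) * anorm A ?u + x ^ n"
      using anorm_mult[of "b \<ominus> ?s n" ?u] b s[of n] u anorm_pow[OF r, of n] anorm_minus[OF p]
      by (simp add: x_def)
    finally show ?thesis using swap[OF b s[of n]] by simp
  qed
  have "(\<lambda>n. anorm A (?s n \<ominus> b) * anorm A ?u + x ^ n) \<longlonglongrightarrow> 0 * anorm A ?u + 0"
    using x by (intro tendsto_intros lim LIMSEQ_realpow_zero) auto
  then have "anorm A (b \<otimes> ?u \<ominus> \<one>) \<le> 0 * anorm A ?u + 0"
    by (rule LIMSEQ_le_const) (use bound in blast)
  moreover have c: "b \<otimes> ?u \<ominus> \<one> \<in> carrier A" using b u by simp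
  ultimately have "b \<otimes> ?u \<ominus> \<one> = \<zero>" using anorm_nonneg[OF c] anorm_eq_zero[OF c] by simp
  then have "b \<otimes> ?u = \<one>" by (rule ring.minus_eq_zeroD[OF ring_self, rotated 2]) (use b u in simp_all)
  with b show ?thesis by blast
qed

text \<open>By telescoping, \<open>1 - r^n\<close> is the partial geometric sum times
  \<open>1 - r\<close>. A left inverse of the former, multiplied by the partial sum, is therefore a
  left inverse of the latter.\<close>

lemma neumann_left_inverse_pow:
  assumes r: "r \<in> carrier A" and small: "anorm A (r [^] (n::nat)) < 1"
  shows "\<exists>b\<in>carrier A. b \<otimes> (\<one> \<ominus> r) = \<one>"
proof -
  have "r [^] n \<in> carrier A" using r by simp
  from neumann_left_inverse[OF this small] obtain b where b: "b \<in> carrier A" "b \<otimes> (\<one> \<ominus> r [^] n) = \<one>"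
    by blast
  show ?thesis
    using b ring.partial_geometric_closed[OF ring_self r, of n] ring.partial_geometric_left_inverse[OF ring_self r b]
    by (intro bexI[of _ "b \<otimes> partial_geometric A r n"]) simp_all
qed

end

text \<open>If \<open>r\<close> denotes the infimum of the \<open>a n powr (1/n)\<close>, then the hypothesis on \<open>a (n * m)\<close> gives
  \<open>r ^ n \<le> c1 * S ^ d * q ^ n + c2 * S powr - \<delta> * a n\<close> for all \<open>S\<close>. If \<open>r \<ge> 1\<close>, this fails for
  \<open>S \<approx> \<sigma> ^ n\<close> with \<open>\<sigma> > 1\<close> close to 1, since \<open>a n\<close> is essentially \<open>r ^ n\<close>.\<close>

lemma exists_lt_1_of_scale_bounds:
  fixes a :: "nat \<Rightarrow> real" and q c1 c2 \<delta> :: real and d :: nat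
  assumes submult: "\<And>m n. a (m + n) \<le> a m * a n"
    and q: "0 \<le> q" "q < 1" and \<delta>: "0 < \<delta>" and c: "0 \<le> c1" "0 \<le> c2"
    and scale: "\<And>S n. 1 \<le> S \<Longrightarrow>
      \<exists>K. \<forall>m. a (n * m) \<le> K * (c1 * real S ^ d * q ^ n + c2 * real S powr - \<delta> * a n) ^ m"
  shows "\<exists>n. a n < 1"
proof (rule ccontr)
  assume "\<not> ?thesis"
  then have a1: "1 \<le> a n" for n by (simp add: not_less)
  then have a0: "0 \<le> a n" for n using order_trans zero_le_one by blast
  \<comment> \<open>An infimum, so that \<open>r ^ n \<le> a n\<close> holds for every
    \<open>n\<close>; near equality is used later at a single \<open>n0\<close> and its
    multiples.\<close>
  define r where "r = (INF n\<in>{1..}. root n (a n))"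
  have r1: "1 \<le> r" unfolding r_def by (rule cINF_greatest) (auto simp: a1)
  have bdd: "bdd_below ((\<lambda>n. root n (a n)) ` {1..})"
    by (rule bdd_belowI2[of _ 1]) (simp add: a1)
  have r_le: "r ^ n \<le> a n" for n
  proof (cases "n = 0")
    case False
    then have "r \<le> root n (a n)" unfolding r_def by (intro cINF_lower bdd) auto
    then have "r ^ n \<le> root n (a n) ^ n" by (rule power_mono) (use r1 in simp)
    then show ?thesis using False a0 by simp
  qed (simp add: a1)
  have pow: "a (n * m) \<le> a n ^ m" if "1 \<le> m" for n m
    using that
  proof (induction m rule: dec_induct)
    case (step m)
    have "a (n * Suc m) \<le> a n * a (n * m)" using submult[of n "n * m"] by simp
    also have "\<dots> \<le> a n * a n ^ m" by (intro mult_left_mono step.IH a0)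
    finally show ?case by simp
  qed simp
  \<comment> \<open>Take high powers of both sides: the factor \<open>K\<close>, which may depend on
    \<open>S\<close> and \<open>n\<close> but not on \<open>m\<close>, cannot compensate a strict
    inequality between the bases.\<close>
  have key: "r ^ n \<le> c1 * real S ^ d * q ^ n + c2 * real S powr - \<delta> * a n" if S: "1 \<le> S" for S n
  proof (rule ccontr)
    define E where "E = c1 * real S ^ d * q ^ n + c2 * real S powr - \<delta> * a n"
    assume "\<not> ?thesis"
    then have E: "E < r ^ n" by (simp add: E_def)
    have E0: "0 \<le> E" unfolding E_def using c q a0 by simp
    obtain K where K: "\<And>m. a (n * m) \<le> K * E ^ m" using scale[OF S, of n] unfolding E_def by blast
    have rn: "0 < r ^ n" using r1 by simp
    have "1 \<le> K * (E / r ^ n) ^ m" for m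
    proof -
      have "(r ^ n) ^ m \<le> K * E ^ m" using K[of m] r_le[of "n * m"] by (simp add: power_mult)
      then show ?thesis using rn by (simp add: power_divide field_simps)
    qed
    moreover have "(\<lambda>m. K * (E / r ^ n) ^ m) \<longlonglongrightarrow> K * 0"
      using E E0 rn by (intro tendsto_intros LIMSEQ_realpow_zero) auto
    ultimately have "1 \<le> K * 0" by (intro LIMSEQ_le_const[of "\<lambda>m. K * (E / r ^ n) ^ m" "K * 0"]) auto
    then show False by simp
  qed
  obtain \<sigma> where \<sigma>: "1 < \<sigma>" "\<sigma> ^ d * q < 1"
  proof -
    have "((\<lambda>s::real. s ^ d * q) \<longlongrightarrow> 1 ^ d * q) (at_right 1)"
      by (intro tendsto_intros)
    then have "eventually (\<lambda>s::real. s ^ d * q < 1) (at_right 1)"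
      by (rule order_tendstoD) (use q in simp)
    moreover have "eventually (\<lambda>s::real. 1 < s) (at_right 1)"
      by (simp add: eventually_at_right_less)
    ultimately have "eventually (\<lambda>s::real. 1 < s \<and> s ^ d * q < 1) (at_right 1)"
      by eventually_elim simp
    then show ?thesis using that eventually_happens[of _ "at_right (1::real)"] by auto
  qed
  \<comment> \<open>The far term gains \<open>\<sigma> powr - \<delta>\<close> per step. Half of
    this gain pays for \<open>a n\<close> exceeding \<open>r ^ n\<close> by a factor of up to
    \<open>\<beta> ^ n\<close>; the other half remains and makes \<open>y < 1\<close>.\<close>
  define \<beta> where "\<beta> = \<sigma> powr (\<delta> / 2)"
  have \<beta>: "1 < \<beta>" unfolding \<beta>_def using \<sigma> \<delta> by (intro gr_one_powr) auto
  have "r < \<beta> * r" using \<beta> r1 by simp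
  then have "\<exists>n\<in>{1..}. root n (a n) < \<beta> * r"
    unfolding r_def[symmetric] using cINF_less_iff[OF _ bdd, of "\<beta> * r"] r_def by auto
  then obtain n0 where n0: "1 \<le> n0" "root n0 (a n0) < \<beta> * r" by auto
  have an0: "a n0 \<le> (\<beta> * r) ^ n0"
  proof -
    have "root n0 (a n0) ^ n0 \<le> (\<beta> * r) ^ n0"
      using n0 a0 by (intro power_mono) (auto simp: real_root_ge_zero)
    then show ?thesis using n0 a0 by simp
  qed
  define x where "x = \<sigma> ^ d * q"
  define y where "y = \<sigma> powr - \<delta> * \<beta>"
  have x: "0 \<le> x" "x < 1" using \<sigma> q by (auto simp: x_def)
  have y: "0 \<le> y" "y < 1"
  proof -
    have "y = \<sigma> powr (- \<delta> / 2)" unfolding y_def \<beta>_def powr_add[symmetric] by (simp add: field_simps)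
    also have "\<dots> < \<sigma> powr 0" using \<sigma> \<delta> by (intro powr_less_mono) auto
    finally show "0 \<le> y" "y < 1" using \<sigma> \<beta> by (auto simp: y_def)
  qed
  have "1 \<le> c1 * 2 ^ d * (x ^ n0) ^ m + c2 * (y ^ n0) ^ m" if m: "1 \<le> m" for m
  proof -
    define n where "n = n0 * m"
    \<comment> \<open>Rounding up keeps \<open>S\<close> below \<open>2 * \<sigma> ^ n\<close>,
      whence the factor \<open>2 ^ d\<close>. Only multiples \<open>n\<close> of \<open>n0\<close>
      are considered, because there \<open>a n\<close> is at most
      \<open>\<beta> ^ n * r ^ n\<close>.\<close>
    define S where "S = nat \<lceil>\<sigma> ^ n\<rceil>"
    have s1: "1 \<le> \<sigma> ^ n" using \<sigma> by simp
    then have S: "\<sigma> ^ n \<le> real S" "real S \<le> 2 * \<sigma> ^ n"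
      unfolding S_def by linarith+
    have S1: "1 \<le> S" using S s1 by linarith
    have "a n \<le> ((\<beta> * r) ^ n0) ^ m"
      unfolding n_def by (rule order_trans[OF pow[OF m] power_mono[OF an0 a0]])
    then have an: "a n \<le> \<beta> ^ n * r ^ n" by (simp add: n_def power_mult power_mult_distrib)
    have "real S powr - \<delta> \<le> (\<sigma> ^ n) powr - \<delta>"
      using S s1 \<delta> by (intro powr_mono2') auto
    also have "\<dots> = (\<sigma> powr - \<delta>) ^ n"
      using \<sigma> by (simp add: powr_realpow[symmetric] powr_powr mult.commute)
    finally have Sp: "real S powr - \<delta> \<le> (\<sigma> powr - \<delta>) ^ n" .
    have rn: "1 \<le> r ^ n" using r1 by simp
    have "real S ^ d \<le> (2 * \<sigma> ^ n) ^ d" using S by (intro power_mono) auto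
    then have "c1 * real S ^ d * q ^ n \<le> c1 * (2 * \<sigma> ^ n) ^ d * q ^ n"
      using c q by (intro mult_right_mono mult_left_mono) auto
    also have "\<dots> = c1 * 2 ^ d * x ^ n"
      by (simp add: x_def power_mult_distrib power_mult[symmetric] mult_ac)
    also have "\<dots> \<le> c1 * 2 ^ d * x ^ n * r ^ n"
      using mult_left_mono[OF rn, of "c1 * 2 ^ d * x ^ n"] c x by simp
    finally have 1: "c1 * real S ^ d * q ^ n \<le> c1 * 2 ^ d * x ^ n * r ^ n" .
    have "c2 * real S powr - \<delta> * a n \<le> c2 * (\<sigma> powr - \<delta>) ^ n * (\<beta> ^ n * r ^ n)"
      using c Sp an a0 by (intro mult_mono mult_left_mono) auto
    also have "\<dots> = c2 * y ^ n * r ^ n" by (simp add: y_def power_mult_distrib mult_ac)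
    finally have 2: "c2 * real S powr - \<delta> * a n \<le> c2 * y ^ n * r ^ n" .
    have "1 * r ^ n \<le> (c1 * 2 ^ d * x ^ n + c2 * y ^ n) * r ^ n"
      using key[OF S1, of n] 1 2 by (simp add: distrib_right)
    then have "1 \<le> c1 * 2 ^ d * x ^ n + c2 * y ^ n"
      using rn by (simp only: mult_le_cancel_right_pos[OF less_le_trans[OF zero_less_one rn]])
    then show ?thesis by (simp add: n_def power_mult)
  qed
  moreover have "(\<lambda>m. c1 * 2 ^ d * (x ^ n0) ^ m + c2 * (y ^ n0) ^ m) \<longlonglongrightarrow> c1 * 2 ^ d * 0 + c2 * 0"
    using x y n0 by (intro tendsto_intros LIMSEQ_realpow_zero) (auto simp: power_less_one_iff)
  ultimately have "1 \<le> c1 * 2 ^ d * 0 + c2 * 0"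
    by (intro LIMSEQ_le_const[of "\<lambda>m. c1 * 2 ^ d * (x ^ n0) ^ m + c2 * (y ^ n0) ^ m"]) auto
  then show False by simp
qed

section \<open>Inverse-closedness\<close>

lemma adjoint_op_diff:
  assumes "S \<in> bounded_ops" "T \<in> bounded_ops"
  shows "adjoint_op (S - T) = adjoint_op S - adjoint_op T"
  using adjoint_op_add[OF bounded_ops_diff[OF assms] assms(2)] by simp

text \<open>With the decay of powers of strict contractions as a hypothesis, what remains is to make
  a contraction out of \<open>T\<close>. When the squared norm of \<open>f - t T\<^sup>*T f\<close>
  is expanded, half of the cross term absorbs the quadratic term; the other half, by the lower bound
  for \<open>T\<close>, is the gain.\<close>

lemma (in schur_weight) left_inverse_mats:
  fixes T :: "('i, 'h::chilbert_space) op_matrix"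
  assumes T: "T \<in> mats" and c: "0 < c"
    and lower: "\<And>f. f \<in> ell2 X \<Longrightarrow> c * ell2_norm X f \<le> ell2_norm X (matrix_operator X T f)"
    and decay: "\<And>(R :: ('i, 'h) op_matrix) q. R \<in> mats \<Longrightarrow> 0 \<le> q \<Longrightarrow> q < 1 \<Longrightarrow>
      (\<And>f. f \<in> ell2 X \<Longrightarrow> ell2_norm X (matrix_operator X R f) \<le> q * ell2_norm X f) \<Longrightarrow>
      \<exists>n. nrm (R [^]\<^bsub>alg\<^esub> (n::nat)) < 1"
  shows "\<exists>L\<in>mats. L \<otimes>\<^bsub>alg\<^esub> T = \<one>\<^bsub>alg\<^esub>"
proof -
  interpret B: unital_banach_star_algebra "alg :: ('i, 'h) op_matrix star_algebra"
    by (rule unital_banach_star_algebra_alg)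
  define S where "S = star alg T"
  have S: "S \<in> mats" using star_closed[OF T] by (simp add: S_def)
  \<comment> \<open>The summand \<open>nrm S\<close> makes \<open>K\<close> dominate the operator
    norm of \<open>S\<close>; the summand \<open>c\<close> makes it positive and gives
    \<open>t * c\<^sup>2 \<le> 1\<close>, so that the argument of the root in \<open>q\<close> is
    nonnegative.\<close>
  define K where "K = nrm S + c"
  have K: "0 < K" "c \<le> K" "nrm S \<le> K" using schur_norm_nonneg[OF S] c by (simp_all add: K_def)
  define t where "t = 1 / K\<^sup>2"
  have t0: "0 < t" using K by (simp add: t_def)
  define P where "P = S \<otimes>\<^bsub>alg\<^esub> T"
  have P: "P \<in> mats" unfolding P_def by (rule mult_closed[OF S T])
  define Q where "Q = complex_of_real t \<odot>\<^bsub>alg\<^esub> P"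
  have Q: "Q \<in> mats" unfolding Q_def using scaleC_closed[OF P] by simp
  define R where "R = \<one>\<^bsub>alg\<^esub> \<ominus>\<^bsub>alg\<^esub> Q"
  have R: "R \<in> mats" unfolding R_def minus_alg[OF one_closed Q] by (rule diff_closed[OF one_closed Q])
  define q where "q = sqrt (1 - t * c\<^sup>2)"
  have tc: "0 < t * c\<^sup>2" "t * c\<^sup>2 \<le> 1"
    using K c by (simp_all add: t_def power_mono)
  have q: "0 \<le> q" "q < 1" using tc by (simp_all add: q_def real_sqrt_lt_1_iff)
  have "ell2_norm X (matrix_operator X R f) \<le> q * ell2_norm X f" if f: "f \<in> ell2 X" for f
  proof -
    let ?g = "matrix_operator X T f"
    let ?h = "matrix_operator X S ?g"
    have g: "?g \<in> ell2 X" by (rule operator_bounded(1)[OF T f])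
    have h: "?h \<in> ell2 X" by (rule operator_bounded(1)[OF S g])
    have "matrix_operator X R f = (\<lambda>k. f k - t *\<^sub>R ?h k)"
    proof -
      have "R \<oplus>\<^bsub>alg\<^esub> Q = \<one>\<^bsub>alg\<^esub>"
        unfolding R_def minus_alg[OF one_closed Q] by simp
      then have "matrix_operator X (R \<oplus>\<^bsub>alg\<^esub> Q) f = f" using operator_one[OF f] by simp
      then have "matrix_operator X R f k + matrix_operator X Q f k = f k" for k
        unfolding operator_add[OF R Q f] by (rule fun_cong)
      moreover have "matrix_operator X Q f = (\<lambda>k. t *\<^sub>R ?h k)"
        unfolding Q_def P_def operator_scaleC[OF P[unfolded P_def] f] operator_mult[OF S T f] scaleC_of_real ..
      ultimately show ?thesis by (simp add: fun_eq_iff eq_diff_eq)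
    qed
    then have "(ell2_norm X (matrix_operator X R f))\<^sup>2
        = (ell2_norm X f)\<^sup>2 - 2 * ell2_inner X f (\<lambda>k. t *\<^sub>R ?h k) + (ell2_norm X (\<lambda>k. t *\<^sub>R ?h k))\<^sup>2"
      using ell2_norm_diff_square[OF f ell2_scaleR[OF h]] by simp
    also have "ell2_inner X f (\<lambda>k. t *\<^sub>R ?h k) = t * (ell2_norm X ?g)\<^sup>2"
      using operator_adjoint[OF T f g] by (simp add: ell2_inner_scaleR_right ell2_norm_square S_def)
    also have "ell2_norm X (\<lambda>k. t *\<^sub>R ?h k) = t * ell2_norm X ?h"
      using ell2_norm_scaleC[of X "of_real t" ?h] t0 by (simp add: scaleC_of_real)
    finally have eq: "(ell2_norm X (matrix_operator X R f))\<^sup>2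
        = (ell2_norm X f)\<^sup>2 - 2 * (t * (ell2_norm X ?g)\<^sup>2) + (t * ell2_norm X ?h)\<^sup>2" .
    have "ell2_norm X ?h \<le> K * ell2_norm X ?g"
      using operator_bounded(2)[OF S g] mult_right_mono[OF K(3) ell2_norm_nonneg[of X ?g]] by linarith
    then have "(t * ell2_norm X ?h)\<^sup>2 \<le> (t * (K * ell2_norm X ?g))\<^sup>2"
      using t0 by (intro power_mono mult_left_mono) auto
    also have "\<dots> = t * (ell2_norm X ?g)\<^sup>2" using K by (simp add: t_def power2_eq_square)
    finally have "(ell2_norm X (matrix_operator X R f))\<^sup>2 \<le> (ell2_norm X f)\<^sup>2 - t * (ell2_norm X ?g)\<^sup>2"
      unfolding eq by simp
    also have "\<dots> \<le> (ell2_norm X f)\<^sup>2 - t * (c * ell2_norm X f)\<^sup>2"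
      using lower[OF f] t0 c by (intro diff_left_mono mult_left_mono power_mono) auto
    also have "\<dots> = (q * ell2_norm X f)\<^sup>2"
      using tc by (simp add: q_def power_mult_distrib left_diff_distrib)
    finally show ?thesis by (rule power2_le_imp_le) (use q in simp)
  qed
  from decay[OF R q this] obtain n where "nrm (R [^]\<^bsub>alg\<^esub> (n::nat)) < 1" by blast
  then obtain b where b: "b \<in> mats" "b \<otimes>\<^bsub>alg\<^esub> (\<one>\<^bsub>alg\<^esub> \<ominus>\<^bsub>alg\<^esub> R) = \<one>\<^bsub>alg\<^esub>"
    using B.neumann_left_inverse_pow[of R n] R by auto
  have "\<one>\<^bsub>alg\<^esub> \<ominus>\<^bsub>alg\<^esub> R = Q"
    unfolding R_def by (rule ring.minus_minus_one[OF ring_alg]) (use Q in simp)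
  then have "b \<otimes>\<^bsub>alg\<^esub> (complex_of_real t \<odot>\<^bsub>alg\<^esub> P) = \<one>\<^bsub>alg\<^esub>"
    using b(2) unfolding Q_def by simp
  then have "complex_of_real t \<odot>\<^bsub>alg\<^esub> (b \<otimes>\<^bsub>alg\<^esub> P) = \<one>\<^bsub>alg\<^esub>"
    unfolding mult_scaleC(2)[OF b(1) P] .
  moreover have "b \<otimes>\<^bsub>alg\<^esub> P = (b \<otimes>\<^bsub>alg\<^esub> S) \<otimes>\<^bsub>alg\<^esub> T"
    unfolding P_def using monoid.m_assoc[OF monoid_alg, of b S T] b(1) S T by simp
  ultimately have "(complex_of_real t \<odot>\<^bsub>alg\<^esub> (b \<otimes>\<^bsub>alg\<^esub> S)) \<otimes>\<^bsub>alg\<^esub> T = \<one>\<^bsub>alg\<^esub>"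
    unfolding mult_scaleC(1)[OF mult_closed[OF b(1) S] T] by (simp only:)
  moreover have "complex_of_real t \<odot>\<^bsub>alg\<^esub> (b \<otimes>\<^bsub>alg\<^esub> S) \<in> mats"
    using scaleC_closed[OF mult_closed[OF b(1) S]] by simp
  ultimately show ?thesis by blast
qed

text \<open>The weights \<open>V\<close> define the same algebra as \<open>W\<close>, but their norms are dominated by a
  multiple of the operator norm plus a small multiple of the original norm.\<close>

locale schur_weight_approx = schur_weight +
  fixes near :: "nat \<Rightarrow> 'a \<Rightarrow> 'a \<Rightarrow> bool" and d :: nat and c1 c2 \<delta> :: real
  assumes \<delta>_pos: "0 < \<delta>" and c1_nonneg: "0 \<le> c1" and c2_nonneg: "0 \<le> c2"
    and near_sym: "near S k l \<Longrightarrow> near S l k"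
    and near_card: "1 \<le> S \<Longrightarrow> k \<in> X \<Longrightarrow> F \<subseteq> X \<Longrightarrow> finite F \<Longrightarrow>
      real (card {l \<in> F. near S k l}) \<le> c1 * real S ^ d"
    and approx: "1 \<le> S \<Longrightarrow> \<exists>V K. schur_weight V \<and> (\<forall>k l. W k l \<le> K * V k l) \<and>
      (\<forall>k l. V k l \<le> (if near S k l then 4 else c2 * real S powr - \<delta> * W k l))"
begin

text \<open>Rows and columns are cut at the near set. Inside, few points of weight at most 4 meet
  entries of size at most \<open>e\<close>; outside, the weight is a small multiple of
  \<open>W\<close> and the original norm takes over. In the application \<open>A\<close> is a power
  of a contraction and \<open>e\<close> is \<open>q ^ n\<close>.\<close>

lemma schur_bound_approx:
  fixes A :: "('a, 'h::chilbert_space) op_matrix"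
  assumes A: "A \<in> mats" and S: "1 \<le> S" and V: "schur_weight V"
    and V_le: "\<And>k l. V k l \<le> (if near S k l then 4 else c2 * real S powr - \<delta> * W k l)"
    and e: "\<And>k l. norm (A k l) \<le> e"
  shows "schur_bound X V A (4 * c1 * real S ^ d * e + c2 * real S powr - \<delta> * nrm A)"
proof (rule schur_boundI)
  interpret V: schur_weight X V by fact
  have e0: "0 \<le> e" using e norm_ge_zero order_trans by blast
  define \<eta> where "\<eta> = c2 * real S powr - \<delta>"
  have \<eta>: "0 \<le> \<eta>" using c2_nonneg by (simp add: \<eta>_def)
  show "0 \<le> 4 * c1 * real S ^ d * e + c2 * real S powr - \<delta> * nrm A"
    using c1_nonneg c2_nonneg e0 schur_norm_nonneg[OF A] by simp
  have entry_est: "V k l * norm (A k l) \<le> (if near S k l then 4 * e else 0) + \<eta> * (W k l * norm (A k l))" for k l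
  proof (cases "near S k l")
    case True
    have "V k l * norm (A k l) \<le> 4 * e"
      using V_le[of k l] True e[of k l] by (intro mult_mono) auto
    moreover have "0 \<le> \<eta> * (W k l * norm (A k l))" using \<eta> by simp
    ultimately show ?thesis using True by simp
  next
    case False
    have "V k l * norm (A k l) \<le> (\<eta> * W k l) * norm (A k l)"
      using V_le[of k l] False by (intro mult_right_mono) (auto simp: \<eta>_def)
    then show ?thesis using False by (simp add: mult.assoc)
  qed
  fix i F assume F: "i \<in> X" "finite F" "F \<subseteq> X"
  have near_sum: "(\<Sum>l\<in>F. if near S i l then 4 * e else 0) \<le> 4 * c1 * real S ^ d * e"
  proof -
    have "(\<Sum>l\<in>F. if near S i l then 4 * e else 0) = real (card {l \<in> F. near S i l}) * (4 * e)"
      using F by (simp add: sum.inter_filter[symmetric])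
    also have "\<dots> \<le> (c1 * real S ^ d) * (4 * e)"
      using near_card[OF S F(1,3,2)] e0 by (intro mult_right_mono) auto
    finally show ?thesis by (simp add: mult_ac)
  qed
  note sb = schur_bound_norm[OF A]
  have "(\<Sum>l\<in>F. V i l * norm (A i l))
      \<le> (\<Sum>l\<in>F. (if near S i l then 4 * e else 0) + \<eta> * (W i l * norm (A i l)))"
    by (intro sum_mono entry_est)
  also have "\<dots> \<le> 4 * c1 * real S ^ d * e + \<eta> * nrm A"
    unfolding sum.distrib sum_distrib_left[symmetric]
    by (intro add_mono near_sum mult_left_mono \<eta> schur_boundD(2)[OF sb F])
  finally show "(\<Sum>l\<in>F. V i l * norm (A i l)) \<le> 4 * c1 * real S ^ d * e + c2 * real S powr - \<delta> * nrm A"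
    by (simp add: \<eta>_def)
  have sym: "near S k i = near S i k" for k using near_sym by blast
  have "(\<Sum>k\<in>F. V k i * norm (A k i))
      \<le> (\<Sum>k\<in>F. (if near S i k then 4 * e else 0) + \<eta> * (W k i * norm (A k i)))"
    unfolding sym[symmetric] by (intro sum_mono entry_est)
  also have "\<dots> \<le> 4 * c1 * real S ^ d * e + \<eta> * nrm A"
    unfolding sum.distrib sum_distrib_left[symmetric]
    by (intro add_mono near_sum mult_left_mono \<eta> schur_boundD(3)[OF sb F])
  finally show "(\<Sum>k\<in>F. V k i * norm (A k i)) \<le> 4 * c1 * real S ^ d * e + c2 * real S powr - \<delta> * nrm A"
    by (simp add: \<eta>_def)
qed

lemma power_decay:
  fixes R :: "('a, 'h::chilbert_space) op_matrix"
  assumes R: "R \<in> mats" and q: "0 \<le> q" "q < 1"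
    and contr: "\<And>f. f \<in> ell2 X \<Longrightarrow> ell2_norm X (matrix_operator X R f) \<le> q * ell2_norm X f"
  shows "\<exists>n. nrm (R [^]\<^bsub>alg\<^esub> (n::nat)) < 1"
proof -
  interpret B: unital_banach_star_algebra "alg :: ('a, 'h) op_matrix star_algebra"
    by (rule unital_banach_star_algebra_alg)
  let ?a = "\<lambda>n::nat. nrm (R [^]\<^bsub>alg\<^esub> n)"
  have Rn: "R [^]\<^bsub>alg\<^esub> n \<in> mats" for n :: nat
    using monoid.nat_pow_closed[OF monoid_alg, of R n] R by simp
  have pow_contr: "ell2_norm X (matrix_operator X (R [^]\<^bsub>alg\<^esub> n) f) \<le> q ^ n * ell2_norm X f"
    if "f \<in> ell2 X" for n :: nat and f
    using that
  proof (induction n arbitrary: f)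
    case 0
    then show ?case using operator_one[OF 0] by simp
  next
    case (Suc n)
    have "matrix_operator X (R [^]\<^bsub>alg\<^esub> Suc n) f = matrix_operator X (R [^]\<^bsub>alg\<^esub> n) (matrix_operator X R f)"
      unfolding nat_pow_Suc by (rule operator_mult[OF Rn R Suc.prems])
    then have "ell2_norm X (matrix_operator X (R [^]\<^bsub>alg\<^esub> Suc n) f) \<le> q ^ n * ell2_norm X (matrix_operator X R f)"
      using Suc.IH[OF operator_bounded(1)[OF R Suc.prems]] by simp
    also have "\<dots> \<le> q ^ n * (q * ell2_norm X f)"
      by (intro mult_left_mono contr Suc.prems) (use q in simp)
    finally show ?case by (simp add: mult_ac)
  qed
  have entry: "norm ((R [^]\<^bsub>alg\<^esub> n) k l) \<le> q ^ n" for n :: nat and k l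
    by (rule entry_le_operator_bound[OF Rn pow_contr]) (use q in simp_all)
  show ?thesis
  proof (rule exists_lt_1_of_scale_bounds[OF _ q \<delta>_pos])
    show "?a (m + n) \<le> ?a m * ?a n" for m n
      using norm_mult_le[OF Rn Rn, of m n] monoid.nat_pow_mult[OF monoid_alg, of R m n] R by simp
    show "0 \<le> 4 * c1" "0 \<le> c2" using c1_nonneg c2_nonneg by simp_all
    fix S n :: nat
    assume S: "1 \<le> S"
    obtain V K where V: "schur_weight V" and K: "\<And>k l. W k l \<le> K * V k l"
      and V_le: "\<And>k l. V k l \<le> (if near S k l then 4 else c2 * real S powr - \<delta> * W k l)"
      using approx[OF S] by blast
    interpret V: schur_weight X V by fact
    interpret VB: unital_banach_star_algebra "V.alg :: ('a, 'h) op_matrix star_algebra"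
      by (rule V.unital_banach_star_algebra_alg)
    define E where "E = 4 * c1 * real S ^ d * q ^ n + c2 * real S powr - \<delta> * ?a n"
    have sb: "schur_bound X V (R [^]\<^bsub>alg\<^esub> n) E"
      unfolding E_def by (rule schur_bound_approx[OF Rn S V V_le entry])
    have E0: "0 \<le> E" by (rule schur_boundD(1)[OF sb])
    have RV: "R [^]\<^bsub>alg\<^esub> n \<in> V.mats" by (rule schur_matricesI[OF schur_matrices_op[OF Rn] sb])
    \<comment> \<open>On the diagonal both weights equal 1, so \<open>K\<close> is in fact at least
      1.\<close>
    have K0: "0 \<le> K"
      using K[of undefined undefined] W_refl[of undefined] V.W_refl[of undefined] by simp
    have "?a (n * m) \<le> K * E ^ m" for m
    proof -
      let ?M = "(R [^]\<^bsub>alg\<^esub> n) [^]\<^bsub>V.alg\<^esub> m"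
      \<comment> \<open>Product and identity of the matrix algebra do not involve the weight, so
        powers formed in the two algebras are the same matrices.\<close>
      have eq: "B [^]\<^bsub>alg\<^esub> m = B [^]\<^bsub>V.alg\<^esub> m" for B :: "('a, 'h) op_matrix"
        by (induction m) simp_all
      have M: "R [^]\<^bsub>alg\<^esub> (n * m) = ?M"
        using monoid.nat_pow_pow[OF monoid_alg, of R n m] R unfolding eq by simp
      have MV: "?M \<in> V.mats" using monoid.nat_pow_closed[OF V.monoid_alg, of "R [^]\<^bsub>alg\<^esub> n" m] RV by simp
      have "schur_norm X V ?M \<le> (schur_norm X V (R [^]\<^bsub>alg\<^esub> n)) ^ m"
        using VB.anorm_pow[of "R [^]\<^bsub>alg\<^esub> n" m] RV by simp
      also have "\<dots> \<le> E ^ m"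
        by (intro power_mono schur_norm_le sb schur_norm_nonneg RV)
      finally have "schur_norm X V ?M \<le> E ^ m" .
      \<comment> \<open>The return to \<open>W\<close> takes place after the \<open>m\<close>-th
        power has been estimated, so \<open>K\<close> enters once and not with exponent
        \<open>m\<close>.\<close>
      moreover have "schur_bound X W ?M (K * schur_norm X V ?M)"
      proof (rule schur_boundI)
        note sbM = schur_bound_norm[OF MV]
        show "0 \<le> K * schur_norm X V ?M" using K0 schur_norm_nonneg[OF MV] by simp
        have t: "W k l * norm (?M k l) \<le> K * (V k l * norm (?M k l))" for k l
          using mult_right_mono[OF K norm_ge_zero] by (simp add: mult.assoc)
        fix i F assume F: "i \<in> X" "finite F" "F \<subseteq> X"
        show "(\<Sum>l\<in>F. W i l * norm (?M i l)) \<le> K * schur_norm X V ?M"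
          by (rule order_trans[OF sum_mono[OF t]])
            (unfold sum_distrib_left[symmetric], intro mult_left_mono K0 schur_boundD(2)[OF sbM F])
        show "(\<Sum>k\<in>F. W k i * norm (?M k i)) \<le> K * schur_norm X V ?M"
          by (rule order_trans[OF sum_mono[OF t]])
            (unfold sum_distrib_left[symmetric], intro mult_left_mono K0 schur_boundD(3)[OF sbM F])
      qed
      ultimately show ?thesis
        unfolding M using schur_norm_le mult_left_mono[OF _ K0] order_trans by blast
    qed
    then show "\<exists>K. \<forall>m. ?a (n * m) \<le> K * (4 * c1 * real S ^ d * q ^ n + c2 * real S powr - \<delta> * ?a n) ^ m"
      unfolding E_def by blast
  qed
qed

lemma left_inverse:
  fixes T :: "('a, 'h::chilbert_space) op_matrix"
  assumes "T \<in> mats" "0 < c"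
    "\<And>f. f \<in> ell2 X \<Longrightarrow> c * ell2_norm X f \<le> ell2_norm X (matrix_operator X T f)"
  shows "\<exists>L\<in>mats. L \<otimes>\<^bsub>alg\<^esub> T = \<one>\<^bsub>alg\<^esub>"
  using left_inverse_mats[OF assms power_decay] .

text \<open>Boundedness of the inverse \<open>U\<close> is a lower bound for the operator of
  \<open>T\<close>, which produces a left inverse \<open>L\<close> in the algebra. Since
  \<open>T\<close> followed by \<open>L\<close> is the identity and \<open>U\<close> is a right
  inverse of \<open>T\<close>, the operator of \<open>L\<close> is \<open>U\<close> itself.\<close>

theorem inverse_closed_alg:
  "inverse_closed_via (matrix_operator X) (alg :: ('a, 'h::chilbert_space) op_matrix star_algebra) (ell2_operators X)"
proof -
  let ?A = "alg :: ('a, 'h) op_matrix star_algebra"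
  let ?\<phi> = "matrix_operator X :: ('a, 'h) op_matrix \<Rightarrow> _"
  let ?B = "ell2_operators X :: (complex, ('a \<Rightarrow> 'h) \<Rightarrow> ('a \<Rightarrow> 'h)) module"
  have ext: "S = T" if "S \<in> extensional (ell2 X)" "T \<in> extensional (ell2 X)" "\<And>f. f \<in> ell2 X \<Longrightarrow> S f = T f"
    for S T :: "('a \<Rightarrow> 'h) \<Rightarrow> ('a \<Rightarrow> 'h)"
    using that by (rule extensionalityI)
  have \<phi>_ext: "?\<phi> M \<in> extensional (ell2 X)" for M by (simp add: matrix_operator_def)
  have closed: "?\<phi> M \<in> carrier ?B" if M: "M \<in> mats" for M
    using operator_bounded[OF M] operator_linear_add[OF M] operator_linear_scaleC[OF M] \<phi>_ext
    unfolding ell2_operators_def by (auto simp: PiE_iff)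
  have sub: "subalgebra_via ?\<phi> ?A ?B"
    unfolding subalgebra_via_def
  proof (intro conjI ballI allI)
    show "?\<phi> \<in> ring_hom ?A ?B"
    proof (rule ring_hom_memI)
      fix M N assume "M \<in> carrier ?A" then have M: "M \<in> mats" by simp
      show "?\<phi> M \<in> carrier ?B" by (rule closed[OF M])
      assume "N \<in> carrier ?A" then have N: "N \<in> mats" by simp
      show "?\<phi> (M \<otimes>\<^bsub>?A\<^esub> N) = ?\<phi> M \<otimes>\<^bsub>?B\<^esub> ?\<phi> N"
        by (rule ext[OF \<phi>_ext]) (use operator_mult[OF M N] in
            \<open>auto simp: ell2_operators_def compose_def simp del: matrix_algebra_simps\<close>)
      show "?\<phi> (M \<oplus>\<^bsub>?A\<^esub> N) = ?\<phi> M \<oplus>\<^bsub>?B\<^esub> ?\<phi> N"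
        by (rule ext[OF \<phi>_ext]) (use operator_add[OF M N] in
            \<open>auto simp: ell2_operators_def simp del: matrix_algebra_simps\<close>)
    next
      show "?\<phi> \<one>\<^bsub>?A\<^esub> = \<one>\<^bsub>?B\<^esub>"
        by (rule ext[OF \<phi>_ext]) (use operator_one[where 'a = 'h] in
            \<open>auto simp: ell2_operators_def simp del: matrix_algebra_simps\<close>)
    qed
    show "inj_on ?\<phi> (carrier ?A)"
      by (rule inj_onI) (use operator_inj in \<open>simp, metis\<close>)
    show "?\<phi> (c \<odot>\<^bsub>?A\<^esub> M) = c \<odot>\<^bsub>?B\<^esub> ?\<phi> M" if "M \<in> carrier ?A" for c M
      by (rule ext[OF \<phi>_ext]) (use operator_scaleC[of M _ c] that in
          \<open>auto simp: ell2_operators_def simp del: matrix_algebra_simps(6)\<close>)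
  qed
  show ?thesis
    unfolding inverse_closed_via_def
  proof (intro conjI sub ballI impI)
    fix T assume "T \<in> carrier ?A" then have T: "T \<in> mats" by simp
    assume "?\<phi> T \<in> Units ?B"
    then obtain U where U: "U \<in> carrier ?B" "U \<otimes>\<^bsub>?B\<^esub> ?\<phi> T = \<one>\<^bsub>?B\<^esub>" "?\<phi> T \<otimes>\<^bsub>?B\<^esub> U = \<one>\<^bsub>?B\<^esub>"
      by (auto simp: Units_def)
    have U_mem: "U f \<in> ell2 X" if "f \<in> ell2 X" for f
      using U(1) that by (auto simp: ell2_operators_def)
    have UT: "U (?\<phi> T f) = f" if "f \<in> ell2 X" for f
      using fun_cong[OF U(2), of f] that by (simp add: ell2_operators_def compose_def)
    have TU: "?\<phi> T (U f) = f" if "f \<in> ell2 X" for f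
      using fun_cong[OF U(3), of f] that by (simp add: ell2_operators_def compose_def)
    have "\<exists>K. \<forall>f\<in>ell2 X. ell2_norm X (U f) \<le> K * ell2_norm X f"
      using U(1) by (simp add: ell2_operators_def)
    then obtain K where K: "\<And>f. f \<in> ell2 X \<Longrightarrow> ell2_norm X (U f) \<le> K * ell2_norm X f"
      by blast
    define K' where "K' = \<bar>K\<bar> + 1"
    have K': "0 < K'" by (simp add: K'_def add_nonneg_pos)
    have "1 / K' * ell2_norm X f \<le> ell2_norm X (?\<phi> T f)" if f: "f \<in> ell2 X" for f
    proof -
      have "ell2_norm X f \<le> K * ell2_norm X (?\<phi> T f)"
        using K[OF operator_bounded(1)[OF T f]] UT[OF f] by simp
      also have "\<dots> \<le> K' * ell2_norm X (?\<phi> T f)"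
        by (intro mult_right_mono) (auto simp: K'_def)
      finally show ?thesis using K' by (simp add: field_simps)
    qed
    then obtain L where L: "L \<in> mats" "L \<otimes>\<^bsub>alg\<^esub> T = \<one>\<^bsub>alg\<^esub>"
      using left_inverse[OF T, of "1 / K'"] K' by auto
    have "?\<phi> L = U"
    proof (rule ext[OF \<phi>_ext])
      show "U \<in> extensional (ell2 X)" using U(1) by (auto simp: ell2_operators_def PiE_iff)
      fix f :: "'a \<Rightarrow> 'h" assume f: "f \<in> ell2 X"
      have "?\<phi> L (?\<phi> T (U f)) = U f"
        using operator_mult[OF L(1) T U_mem[OF f]] L(2) operator_one[OF U_mem[OF f]] by simp
      then show "?\<phi> L f = U f" by (simp add: TU[OF f])
    qed
    \<comment> \<open>The inverse is a definite description. Uniqueness is checked at each family: a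
      further inverse \<open>y\<close> satisfies \<open>y f = y (T (U f)) = U f\<close>.\<close>
    moreover have "inv\<^bsub>?B\<^esub> (?\<phi> T) = U"
      unfolding m_inv_def
    proof (rule the_equality)
      fix y assume y: "y \<in> carrier ?B \<and> ?\<phi> T \<otimes>\<^bsub>?B\<^esub> y = \<one>\<^bsub>?B\<^esub> \<and> y \<otimes>\<^bsub>?B\<^esub> ?\<phi> T = \<one>\<^bsub>?B\<^esub>"
      show "y = U"
      proof (rule ext)
        show "y \<in> extensional (ell2 X)" "U \<in> extensional (ell2 X)"
          using y U(1) by (auto simp: ell2_operators_def PiE_iff)
        fix f :: "'a \<Rightarrow> 'h" assume f: "f \<in> ell2 X"
        have yT: "y (?\<phi> T g) = g" if "g \<in> ell2 X" for g
          using fun_cong[OF conjunct2[OF conjunct2[OF y]], of g] that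
          by (simp add: ell2_operators_def compose_def)
        show "y f = U f" using yT[OF U_mem[OF f]] TU[OF f] by simp
      qed
    qed (use U in simp)
    ultimately show "inv\<^bsub>?B\<^esub> (?\<phi> T) \<in> ?\<phi> ` carrier ?A" using L(1) by auto
  qed
qed

text \<open>The quadratic form of \<open>P\<close> takes values in the nonnegative half-line, and a
  line through 0 separates \<open>z\<close> from it. The distance of \<open>z\<close> from that line
  is the lower bound \<open>c\<close>.\<close>

lemma shifted_left_inverse:
  fixes A :: "('a, 'h::chilbert_space) op_matrix"
  assumes A: "A \<in> mats" and z: "z \<notin> \<real>\<^sub>\<ge>\<^sub>0"
  defines "P \<equiv> star alg A \<otimes>\<^bsub>alg\<^esub> A"
  shows "\<exists>L\<in>mats. L \<otimes>\<^bsub>alg\<^esub> ((z \<odot>\<^bsub>alg\<^esub> \<one>\<^bsub>alg\<^esub>) \<ominus>\<^bsub>alg\<^esub> P) = \<one>\<^bsub>alg\<^esub>"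
proof -
  have S: "star alg A \<in> mats" using star_closed[OF A] by simp
  have P: "P \<in> mats" unfolding P_def by (rule mult_closed[OF S A])
  have Z: "z \<odot>\<^bsub>alg\<^esub> \<one>\<^bsub>alg\<^esub> \<in> (mats :: ('a, 'h) op_matrix set)"
    using scaleC_closed[OF one_closed] by simp
  define T where "T = (z \<odot>\<^bsub>alg\<^esub> \<one>\<^bsub>alg\<^esub>) \<ominus>\<^bsub>alg\<^esub> P"
  have T: "T \<in> mats" unfolding T_def minus_alg[OF Z P] by (rule diff_closed[OF Z P])
  \<comment> \<open>\<open>w\<close> is the unit normal of the separating line: pairing with it
    makes \<open>z\<close> positive and the half-line nonpositive. For real \<open>z < 0\<close> it
    is -1; otherwise it is \<open>\<i>\<close> or \<open>-\<i>\<close>, according to the sign of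
    \<open>Im z\<close>.\<close>
  obtain w where w: "cmod w = 1" "Re w \<le> 0" "0 < Re (z * cnj w)"
  proof (cases "Im z = 0")
    case True
    then have "Re z < 0" using z by (simp add: complex_nonneg_Reals_iff)
    then show ?thesis using that[of "-1"] by simp
  next
    case False
    then show ?thesis using that[of "\<i> * of_real (sgn (Im z))"]
      by (simp add: norm_mult sgn_if)
  qed
  define c where "c = Re (z * cnj w)"
  have c: "0 < c" using w by (simp add: c_def)
  have "c * ell2_norm X f \<le> ell2_norm X (matrix_operator X T f)" if f: "f \<in> ell2 X" for f
  proof -
    let ?g = "matrix_operator X A f"
    let ?u = "matrix_operator X T f"
    let ?v = "\<lambda>k. w *\<^sub>C f k"
    have g: "?g \<in> ell2 X" by (rule operator_bounded(1)[OF A f])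
    have u: "?u \<in> ell2 X" by (rule operator_bounded(1)[OF T f])
    have v: "?v \<in> ell2 X" by (rule ell2_scaleC[OF f])
    have Pf: "matrix_operator X P f \<in> ell2 X" by (rule operator_bounded(1)[OF P f])
    have re: "ell2_inner X h (\<lambda>k. a *\<^sub>C h k) = Re a * (ell2_norm X h)\<^sup>2" for h :: "'a \<Rightarrow> 'h" and a
    proof -
      have "inner x (a *\<^sub>C x) = Re a * (norm x)\<^sup>2" for x :: 'h
        by (simp add: Re_cinner[symmetric] cinner_scaleC_right cinner_self)
      then show ?thesis
        by (simp add: ell2_inner_def ell2_norm_square infsum_cmult_right' power2_norm_eq_inner)
    qed
    have "T \<oplus>\<^bsub>alg\<^esub> P = z \<odot>\<^bsub>alg\<^esub> \<one>\<^bsub>alg\<^esub>"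
      unfolding T_def minus_alg[OF Z P] by simp
    then have "(\<lambda>k. ?u k + matrix_operator X P f k) = matrix_operator X (z \<odot>\<^bsub>alg\<^esub> \<one>\<^bsub>alg\<^esub>) f"
      using operator_add[OF T P f] by simp
    also have "\<dots> = (\<lambda>k. z *\<^sub>C f k)"
      unfolding operator_scaleC[OF one_closed f] operator_one[OF f] ..
    finally have "ell2_inner X ?u ?v + ell2_inner X (matrix_operator X P f) ?v = ell2_inner X (\<lambda>k. z *\<^sub>C f k) ?v"
      using ell2_inner_add_left[OF u Pf v] by simp
    also have "ell2_inner X (\<lambda>k. z *\<^sub>C f k) ?v = c * (ell2_norm X f)\<^sup>2"
      unfolding ell2_inner_scaleC_left scaleC_scaleC re by (simp add: c_def)
    also have "ell2_inner X (matrix_operator X P f) ?v = ell2_inner X ?v (matrix_operator X (star alg A) ?g)"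
      unfolding P_def operator_mult[OF S A f] by (rule ell2_inner_commute)
    also have "\<dots> = ell2_inner X (matrix_operator X A ?v) ?g"
      by (rule operator_adjoint[OF A v g, symmetric])
    also have "\<dots> = Re w * (ell2_norm X ?g)\<^sup>2"
      unfolding operator_linear_scaleC[OF A f] by (subst ell2_inner_commute) (rule re)
    finally have "ell2_inner X ?u ?v = c * (ell2_norm X f)\<^sup>2 - Re w * (ell2_norm X ?g)\<^sup>2" by simp
    moreover have "Re w * (ell2_norm X ?g)\<^sup>2 \<le> 0" using w(2) by (simp add: mult_nonpos_nonneg)
    ultimately have "c * (ell2_norm X f)\<^sup>2 \<le> ell2_inner X ?u ?v" by simp
    \<comment> \<open>Cauchy-Schwarz in disguise: the squared norm of \<open>?u - c ?v\<close> is
      nonnegative, and inserting the lower bound for \<open>ell2_inner X ?u ?v\<close> into its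
      expansion leaves the desired estimate.\<close>
    then have "c * (c * (ell2_norm X f)\<^sup>2) \<le> c * ell2_inner X ?u ?v"
      using c by (intro mult_left_mono) auto
    moreover have "0 \<le> (ell2_norm X (\<lambda>k. ?u k - c *\<^sub>R ?v k))\<^sup>2" by simp
    then have "0 \<le> (ell2_norm X ?u)\<^sup>2 - 2 * (c * ell2_inner X ?u ?v) + (ell2_norm X (\<lambda>k. c *\<^sub>R ?v k))\<^sup>2"
      unfolding ell2_norm_diff_square[OF u ell2_scaleR[OF v]] ell2_inner_scaleR_right .
    moreover have "ell2_norm X (\<lambda>k. c *\<^sub>R ?v k) = c * ell2_norm X f"
      using ell2_norm_scaleC[of X "of_real c * w" f] c w(1)
      by (simp add: scaleC_of_real[symmetric] scaleC_scaleC norm_mult)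
    then have "(ell2_norm X (\<lambda>k. c *\<^sub>R ?v k))\<^sup>2 = c * (c * (ell2_norm X f)\<^sup>2)"
      by (simp add: power_mult_distrib power2_eq_square mult.assoc)
    ultimately have "c * (c * (ell2_norm X f)\<^sup>2) \<le> (ell2_norm X ?u)\<^sup>2" by linarith
    moreover have "(c * ell2_norm X f)\<^sup>2 = c * (c * (ell2_norm X f)\<^sup>2)"
      by (simp add: power2_eq_square)
    ultimately have "(c * ell2_norm X f)\<^sup>2 \<le> (ell2_norm X ?u)\<^sup>2" by simp
    then show ?thesis by (rule power2_le_imp_le) simp
  qed
  from left_inverse[OF T c this] show ?thesis unfolding T_def .
qed

theorem symmetric_alg: "symmetric_algebra (alg :: ('a, 'h::chilbert_space) op_matrix star_algebra)"
  unfolding symmetric_algebra_def algebra_spectrum_def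
proof (intro ballI subsetI)
  let ?A = "alg :: ('a, 'h) op_matrix star_algebra"
  interpret B: unital_banach_star_algebra ?A by (rule unital_banach_star_algebra_alg)
  fix A z assume "A \<in> carrier ?A"
  then have A: "A \<in> mats" by simp
  define P where "P = star ?A A \<otimes>\<^bsub>?A\<^esub> A"
  assume "z \<in> {c. (c \<odot>\<^bsub>?A\<^esub> \<one>\<^bsub>?A\<^esub>) \<ominus>\<^bsub>?A\<^esub> (star ?A A \<otimes>\<^bsub>?A\<^esub> A) \<notin> Units ?A}"
  then have nu: "(z \<odot>\<^bsub>?A\<^esub> \<one>\<^bsub>?A\<^esub>) \<ominus>\<^bsub>?A\<^esub> P \<notin> Units ?A" by (simp add: P_def del: matrix_algebra_simps)
  show "z \<in> \<real>\<^sub>\<ge>\<^sub>0"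
  proof (rule ccontr)
    assume z: "z \<notin> \<real>\<^sub>\<ge>\<^sub>0"
    then have cz: "cnj z \<notin> \<real>\<^sub>\<ge>\<^sub>0" by (simp add: complex_nonneg_Reals_iff)
    have S: "star ?A A \<in> mats" using star_closed[OF A] by simp
    have P: "P \<in> mats" unfolding P_def by (rule mult_closed[OF S A])
    have Z: "c \<odot>\<^bsub>?A\<^esub> \<one>\<^bsub>?A\<^esub> \<in> mats" for c
      using scaleC_closed[OF one_closed] by simp
    let ?T = "\<lambda>c. (c \<odot>\<^bsub>?A\<^esub> \<one>\<^bsub>?A\<^esub>) \<ominus>\<^bsub>?A\<^esub> P"
    have T: "?T c \<in> mats" for c unfolding minus_alg[OF Z P] by (rule diff_closed[OF Z P])
    have starP: "star ?A P = P"
      unfolding P_def star_mult_alg[OF S A] using B.star_star[of A] A by (simp del: matrix_algebra_simps(2,7))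
    have star_one: "star ?A \<one>\<^bsub>?A\<^esub> = \<one>\<^bsub>?A\<^esub>"
    proof (intro ext)
      show "star ?A \<one>\<^bsub>?A\<^esub> k l = \<one>\<^bsub>?A\<^esub> k l" for k l by (cases "k = l") auto
    qed
    have starT: "star ?A (?T (cnj z)) = ?T z"
    proof (intro ext)
      fix k l
      have "star ?A (?T (cnj z)) k l = adjoint_op ((cnj z \<odot>\<^bsub>?A\<^esub> \<one>\<^bsub>?A\<^esub>) l k) - adjoint_op (P l k)"
        unfolding minus_alg[OF Z P]
        using op_matrices_bounded_ops[OF schur_matrices_op[OF P]]
          op_matrices_bounded_ops[OF schur_matrices_op[OF Z[of "cnj z"]]]
        by (simp add: adjoint_op_diff)
      moreover have "adjoint_op (P l k) = P k l" using fun_cong[OF fun_cong[OF starP, of k], of l] by simp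
      moreover have "adjoint_op ((cnj z \<odot>\<^bsub>?A\<^esub> \<one>\<^bsub>?A\<^esub>) l k) = (z \<odot>\<^bsub>?A\<^esub> \<one>\<^bsub>?A\<^esub>) k l"
        by (auto simp: adjoint_op_scaleC)
      ultimately show "star ?A (?T (cnj z)) k l = ?T z k l"
        unfolding minus_alg[OF Z P] by simp
    qed
    obtain L where L: "L \<in> mats" "L \<otimes>\<^bsub>?A\<^esub> ?T z = \<one>\<^bsub>?A\<^esub>"
      using shifted_left_inverse[OF A z] unfolding P_def by blast
    obtain L' where L': "L' \<in> mats" "L' \<otimes>\<^bsub>?A\<^esub> ?T (cnj z) = \<one>\<^bsub>?A\<^esub>"
      using shifted_left_inverse[OF A cz] unfolding P_def by blast
    have SL': "star ?A L' \<in> mats" using star_closed[OF L'(1)] by simp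
    \<comment> \<open>Taking adjoints turns the left inverse for \<open>cnj z\<close> into a right
      inverse for \<open>z\<close>, which must then agree with the left inverse
      \<open>L\<close>.\<close>
    have R: "?T z \<otimes>\<^bsub>?A\<^esub> star ?A L' = \<one>\<^bsub>?A\<^esub>"
      using star_mult_alg[OF L'(1) T[of "cnj z"]] unfolding L'(2) star_one starT by (rule sym)
    have "L = L \<otimes>\<^bsub>?A\<^esub> (?T z \<otimes>\<^bsub>?A\<^esub> star ?A L')"
      unfolding R using monoid.r_one[OF monoid_alg, of L] L(1) by simp
    also have "\<dots> = (L \<otimes>\<^bsub>?A\<^esub> ?T z) \<otimes>\<^bsub>?A\<^esub> star ?A L'"
      using monoid.m_assoc[OF monoid_alg, of L "?T z" "star ?A L'"] L(1) T[of z] SL' by simp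
    also have "\<dots> = star ?A L'"
      unfolding L(2) using monoid.l_one[OF monoid_alg, of "star ?A L'"] SL' by simp
    finally have "?T z \<otimes>\<^bsub>?A\<^esub> L = \<one>\<^bsub>?A\<^esub>" using R by (simp only:)
    then have "?T z \<in> Units ?A"
      using L T[of z] unfolding Units_def by auto
    with nu show False by simp
  qed
qed

end

lemma (in schur_weight) solid_alg: "solid X (alg :: ('i, 'h::chilbert_space) op_matrix star_algebra)"
  unfolding solid_def
proof (intro ballI impI)
  fix A B :: "('i, 'h) op_matrix"
  assume "A \<in> carrier alg" then have A: "A \<in> mats" by simp
  assume B: "B \<in> op_matrices X" and le: "\<forall>k\<in>X. \<forall>l\<in>X. norm (B k l) \<le> norm (A k l)"
  have "schur_bound X W B (nrm A)"
    by (rule schur_bound_mono[OF schur_bound_norm[OF A]]) (use le schur_norm_nonneg[OF A] in auto)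
  then show "B \<in> carrier alg \<and> anorm alg B \<le> anorm alg A"
    using schur_matricesI[OF B] schur_norm_le by simp
qed

section \<open>Admissible weights\<close>

text \<open>Isolated as a locale because \<rho> is also used after a shift of its argument;
  \<open>shift\<close> shows that the properties persist.\<close>

locale concave_growth =
  fixes \<rho> :: "real \<Rightarrow> real"
  assumes concave: "concave_on {0..} \<rho>" and nonneg: "0 \<le> t \<Longrightarrow> 0 \<le> \<rho> t" and zero: "\<rho> 0 = 0"
begin

text \<open>Both \<open>b\<close> and \<open>a + h\<close> are convex combinations of
  \<open>a\<close> and \<open>b + h\<close>, with complementary coefficients; adding the two
  concavity inequalities gives the claim.\<close>

lemma increment_antimono:
  assumes "0 \<le> a" "a \<le> b" "0 \<le> h"
  shows "\<rho> (b + h) - \<rho> b \<le> \<rho> (a + h) - \<rho> a"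
proof (cases "b + h = a")
  case True
  then have "b = a" "h = 0" using assms by auto
  then show ?thesis by simp
next
  case False
  define D where "D = b + h - a"
  have D: "0 < D" using assms False by (simp add: D_def)
  define u where "u = (b - a) / D"
  define v where "v = h / D"
  have uv: "0 \<le> u" "0 \<le> v" "u + v = 1"
    using assms D by (simp_all add: u_def v_def D_def add_divide_distrib[symmetric])
  have ab: "a \<in> {0..}" "b + h \<in> {0..}" using assms by auto
  have cb: "\<rho> ((1 - s) *\<^sub>R a + s *\<^sub>R (b + h)) \<ge> (1 - s) * \<rho> a + s * \<rho> (b + h)" if "0 \<le> s" "s \<le> 1" for s
    using concave_onD[OF concave that ab] .
  have "(1 - u) *\<^sub>R a + u *\<^sub>R (b + h) = a + u * D" by (simp add: D_def algebra_simps)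
  also have "\<dots> = b" using D by (simp add: u_def)
  finally have 1: "(1 - u) * \<rho> a + u * \<rho> (b + h) \<le> \<rho> b" using cb[of u] uv by simp
  have "(1 - v) *\<^sub>R a + v *\<^sub>R (b + h) = a + v * D" by (simp add: D_def algebra_simps)
  also have "\<dots> = a + h" using D by (simp add: v_def)
  finally have 2: "(1 - v) * \<rho> a + v * \<rho> (b + h) \<le> \<rho> (a + h)" using cb[of v] uv by simp
  have v: "v = 1 - u" using uv by simp
  show ?thesis using 1 2 unfolding v by (simp add: algebra_simps)
qed

lemma subadditive:
  assumes "0 \<le> a" "0 \<le> b" shows "\<rho> (a + b) \<le> \<rho> a + \<rho> b"
  using increment_antimono[of 0 a b] assms by (simp add: zero)

text \<open>A drop would recur, at least as large, on every further interval of the same length,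
  since increments do not grow, and would drive \<rho> below 0.\<close>

lemma mono:
  assumes "0 \<le> a" "a \<le> b" shows "\<rho> a \<le> \<rho> b"
proof (rule ccontr)
  define e where "e = \<rho> a - \<rho> b"
  assume "\<not> ?thesis"
  then have e: "0 < e" by (simp add: e_def)
  define h where "h = b - a"
  have h: "0 \<le> h" using assms by (simp add: h_def)
  have "\<rho> (a + real n * h) \<le> \<rho> a - real n * e" for n
  proof (induction n)
    case (Suc n)
    have "\<rho> (a + real n * h + h) - \<rho> (a + real n * h) \<le> \<rho> (a + h) - \<rho> a"
      using assms h by (intro increment_antimono) auto
    also have "\<dots> = - e" by (simp add: h_def e_def)
    finally show ?case using Suc.IH by (simp add: algebra_simps)
  qed simp
  moreover obtain n where "\<rho> a < real n * e" using e reals_Archimedean3 by blast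
  moreover have "0 \<le> \<rho> (a + real n * h)" using assms h by (intro nonneg) auto
  ultimately show False by (smt (verit))
qed

lemma shift: "0 \<le> T \<Longrightarrow> concave_growth (\<lambda>t. \<rho> (t + T) - \<rho> T)"
proof
  assume T: "0 \<le> T"
  show "0 \<le> \<rho> (t + T) - \<rho> T" if "0 \<le> t" for t using mono[of T "t + T"] T that by simp
  show "concave_on {0..} (\<lambda>t. \<rho> (t + T) - \<rho> T)"
    unfolding concave_on_iff
  proof (intro conjI ballI allI impI)
    fix x y u v :: real
    assume *: "x \<in> {0..}" "y \<in> {0..}" "0 \<le> u" "0 \<le> v" "u + v = 1"
    have "u *\<^sub>R x + v *\<^sub>R y + T = u *\<^sub>R (x + T) + v *\<^sub>R (y + T)"
      using * by (simp add: algebra_simps flip: distrib_left)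
    moreover have "\<rho> (u *\<^sub>R (x + T) + v *\<^sub>R (y + T)) \<ge> u * \<rho> (x + T) + v * \<rho> (y + T)"
      using concave T * unfolding concave_on_iff by auto
    moreover have "u * \<rho> T + v * \<rho> T = \<rho> T" using * by (simp flip: distrib_right)
    ultimately show "u * (\<rho> (x + T) - \<rho> T) + v * (\<rho> (y + T) - \<rho> T) \<le> \<rho> (u *\<^sub>R x + v *\<^sub>R y + T) - \<rho> T"
      by (simp add: right_diff_distrib)
  qed simp
qed simp

end

section \<open>Submultiplicative weights and their flattening on cubes\<close>

definition submultiplicative_weight :: "('a::real_vector \<Rightarrow> real) \<Rightarrow> bool" where
  "submultiplicative_weight \<omega> \<longleftrightarrow> \<omega> 0 = 1 \<and> (\<forall>x. \<omega> (- x) = \<omega> x) \<and> (\<forall>x. 1 \<le> \<omega> x) \<and>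
     (\<forall>x y. \<omega> (x + y) \<le> \<omega> x * \<omega> y)"

lemma schur_weight_translation:
  assumes "submultiplicative_weight \<omega>"
  shows "schur_weight (\<lambda>k l. \<omega> (k - l))"
proof
  show "\<omega> (k - l) = \<omega> (l - k)" for k l
    using assms unfolding submultiplicative_weight_def by (metis minus_diff_eq)
  show "\<omega> (k - l) \<le> \<omega> (k - n) * \<omega> (n - l)" for k l n
  proof -
    have "\<omega> ((k - n) + (n - l)) \<le> \<omega> (k - n) * \<omega> (n - l)"
      using assms unfolding submultiplicative_weight_def by blast
    then show ?thesis by simp
  qed
qed (use assms in \<open>simp_all add: submultiplicative_weight_def\<close>)

lemma submultiplicative_weight_mult:
  assumes "submultiplicative_weight \<omega>" "submultiplicative_weight \<omega>'"
  shows "submultiplicative_weight (\<lambda>x. \<omega> x * \<omega>' x)"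
  unfolding submultiplicative_weight_def
proof (intro conjI allI)
  note a = assms[unfolded submultiplicative_weight_def]
  have ge: "1 \<le> \<omega> x" "1 \<le> \<omega>' x" for x using a by auto
  have pos: "0 \<le> \<omega> x" "0 \<le> \<omega>' x" for x using order_trans[OF zero_le_one] ge by auto
  show "1 \<le> \<omega> x * \<omega>' x" for x using mult_mono[OF ge(1) ge(2), of x x] pos by simp
  fix x y
  have "\<omega> (x + y) * \<omega>' (x + y) \<le> (\<omega> x * \<omega> y) * (\<omega>' x * \<omega>' y)"
    using a pos by (intro mult_mono) auto
  then show "\<omega> (x + y) * \<omega>' (x + y) \<le> (\<omega> x * \<omega>' x) * (\<omega> y * \<omega>' y)" by (simp add: mult_ac)
qed (use assms in \<open>auto simp: submultiplicative_weight_def\<close>)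

lemma is_norm_zero: "is_norm p \<Longrightarrow> p 0 = 0"
  by (simp add: is_norm_def)

lemma is_norm_neg: "is_norm p \<Longrightarrow> p (- x) = p x"
  unfolding is_norm_def by (metis abs_minus_cancel abs_one mult_1 scaleR_minus1_left)

lemma (in concave_growth) submultiplicative_weight_exp:
  assumes p: "is_norm p"
  shows "submultiplicative_weight (\<lambda>x. exp (\<rho> (p x)))"
  unfolding submultiplicative_weight_def
proof (intro conjI allI)
  have p0: "0 \<le> p x" for x using p by (simp add: is_norm_def)
  show "exp (\<rho> (p 0)) = 1" using p by (simp add: is_norm_zero zero)
  show "exp (\<rho> (p (- x))) = exp (\<rho> (p x))" for x by (simp add: is_norm_neg[OF p])
  show "1 \<le> exp (\<rho> (p x))" for x using nonneg[OF p0] by simp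
  fix x y
  have "\<rho> (p (x + y)) \<le> \<rho> (p x + p y)" using p p0 by (intro mono) (auto simp: is_norm_def)
  also have "\<dots> \<le> \<rho> (p x) + \<rho> (p y)" by (rule subadditive[OF p0 p0])
  finally show "exp (\<rho> (p (x + y))) \<le> exp (\<rho> (p x)) * exp (\<rho> (p y))" by (simp flip: exp_add)
qed

text \<open>The case \<open>\<eta> = 1\<close> is the polynomial factor of the Schur class. A small
  \<open>\<eta>\<close> dilates it so that it is nearly 1 on a given cube, while it stays equivalent
  to the original.\<close>

definition poly_weight :: "real \<Rightarrow> ('d \<Rightarrow> nat) \<Rightarrow> real^'d \<Rightarrow> real" where
  "poly_weight \<eta> \<alpha> x = (\<Prod>j\<in>UNIV. (1 + \<eta> * \<bar>x $ j\<bar>) ^ \<alpha> j)"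

lemma submultiplicative_weight_poly:
  assumes "0 \<le> \<eta>" shows "submultiplicative_weight (poly_weight \<eta> \<alpha>)"
  unfolding submultiplicative_weight_def
proof (intro conjI allI)
  show "poly_weight \<eta> \<alpha> 0 = 1" "poly_weight \<eta> \<alpha> (- x) = poly_weight \<eta> \<alpha> x" for x
    by (simp_all add: poly_weight_def)
  show "1 \<le> poly_weight \<eta> \<alpha> x" for x
    unfolding poly_weight_def using assms by (intro prod_ge_1 one_le_power) simp
  fix x y :: "real^'a"
  have "poly_weight \<eta> \<alpha> (x + y) \<le> (\<Prod>j\<in>UNIV. ((1 + \<eta> * \<bar>x $ j\<bar>) * (1 + \<eta> * \<bar>y $ j\<bar>)) ^ \<alpha> j)"
    unfolding poly_weight_def
  proof (intro prod_mono conjI power_mono zero_le_power)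
    fix j
    have "\<eta> * \<bar>x $ j + y $ j\<bar> \<le> \<eta> * (\<bar>x $ j\<bar> + \<bar>y $ j\<bar>)"
      using assms by (intro mult_left_mono abs_triangle_ineq)
    moreover have "0 \<le> (\<eta> * \<bar>x $ j\<bar>) * (\<eta> * \<bar>y $ j\<bar>)" using assms by simp
    ultimately show "1 + \<eta> * \<bar>(x + y) $ j\<bar> \<le> (1 + \<eta> * \<bar>x $ j\<bar>) * (1 + \<eta> * \<bar>y $ j\<bar>)"
      by (simp add: distrib_left distrib_right)
  qed (use assms in auto)
  then show "poly_weight \<eta> \<alpha> (x + y) \<le> poly_weight \<eta> \<alpha> x * poly_weight \<eta> \<alpha> y"
    by (simp add: poly_weight_def power_mult_distrib prod.distrib)
qed

lemma poly_weight_le: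
  assumes "0 \<le> \<eta>" "\<eta> \<le> 1" shows "poly_weight \<eta> \<alpha> x \<le> poly_weight 1 \<alpha> x"
  unfolding poly_weight_def using assms
  by (intro prod_mono conjI power_mono add_left_mono mult_right_mono zero_le_power) auto

lemma poly_weight_equiv:
  assumes "0 < \<eta>" "\<eta> \<le> 1"
  shows "poly_weight 1 \<alpha> x \<le> (\<Prod>j\<in>UNIV. (1 / \<eta>) ^ \<alpha> j) * poly_weight \<eta> \<alpha> x"
proof -
  have "poly_weight 1 \<alpha> x \<le> (\<Prod>j\<in>UNIV. ((1 / \<eta>) * (1 + \<eta> * \<bar>x $ j\<bar>)) ^ \<alpha> j)"
    unfolding poly_weight_def
  proof (intro prod_mono conjI power_mono zero_le_power)
    show "1 + 1 * \<bar>x $ j\<bar> \<le> (1 / \<eta>) * (1 + \<eta> * \<bar>x $ j\<bar>)" for j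
      using assms by (simp add: distrib_left)
  qed auto
  then show ?thesis by (simp only: poly_weight_def power_mult_distrib prod.distrib)
qed

text \<open>As \<open>\<eta>\<close> tends to 0 from above, the bound for the values on the cube
  tends to 1, so it falls below any number exceeding 1, here 2.\<close>

lemma poly_weight_small:
  "\<exists>\<eta>. 0 < \<eta> \<and> \<eta> \<le> 1 \<and> (\<forall>x. (\<forall>j. \<bar>x $ j\<bar> \<le> S) \<longrightarrow> poly_weight \<eta> \<alpha> x \<le> 2)"
proof -
  have "((\<lambda>\<eta>. \<Prod>j\<in>UNIV. (1 + \<eta> * S) ^ \<alpha> j) \<longlongrightarrow> (\<Prod>j\<in>UNIV. (1 + 0 * S) ^ \<alpha> j)) (at_right 0)"
    by (intro tendsto_intros)
  then have "eventually (\<lambda>\<eta>. (\<Prod>j\<in>UNIV. (1 + \<eta> * S) ^ \<alpha> j) < 2) (at_right 0)"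
    by (rule order_tendstoD) simp
  moreover have "eventually (\<lambda>\<eta>::real. 0 < \<eta> \<and> \<eta> < 1) (at_right 0)"
    by (simp add: eventually_at_right_less eventually_at_right_real eventually_conj_iff eventually_at_right_field)
      (meson zero_less_one)
  ultimately have "eventually (\<lambda>\<eta>. (\<Prod>j\<in>UNIV. (1 + \<eta> * S) ^ \<alpha> j) < 2 \<and> 0 < \<eta> \<and> \<eta> < 1) (at_right 0)"
    by (rule eventually_conj)
  then obtain \<eta> where \<eta>: "(\<Prod>j\<in>UNIV. (1 + \<eta> * S) ^ \<alpha> j) < 2" "0 < \<eta>" "\<eta> < 1"
    using eventually_happens[of _ "at_right (0::real)"] by auto
  have "poly_weight \<eta> \<alpha> x \<le> 2" if x: "\<forall>j. \<bar>x $ j\<bar> \<le> S" for x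
  proof -
    have "poly_weight \<eta> \<alpha> x \<le> (\<Prod>j\<in>UNIV. (1 + \<eta> * S) ^ \<alpha> j)"
      unfolding poly_weight_def using \<eta> x
      by (intro prod_mono conjI power_mono add_left_mono mult_left_mono zero_le_power) auto
    then show ?thesis using \<eta>(1) by simp
  qed
  then show ?thesis using \<eta> by (intro exI[of _ \<eta>]) auto
qed

text \<open>Expand \<open>x\<close> in the standard basis. The estimate places a cube of size
  \<open>s\<close> inside a ball of the norm \<open>p\<close> whose radius is a fixed multiple of
  \<open>s\<close>.\<close>

lemma is_norm_le_sup:
  fixes p :: "real^'d \<Rightarrow> real"
  assumes p: "is_norm p" and x: "\<And>j. \<bar>x $ j\<bar> \<le> s"
  shows "p x \<le> (\<Sum>j\<in>UNIV. p (axis j 1)) * s"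
proof -
  have sum: "p (\<Sum>j\<in>F. f j) \<le> (\<Sum>j\<in>F. p (f j))" if "finite F" for F :: "'d set" and f
    using that
  proof (induction F rule: finite_induct)
    case empty
    then show ?case using p by (simp add: is_norm_zero)
  next
    case (insert j F)
    have "p (f j + sum f F) \<le> p (f j) + p (sum f F)" using p unfolding is_norm_def by blast
    then show ?case using insert by simp
  qed
  have "x = (\<Sum>j\<in>UNIV. (x $ j) *\<^sub>R axis j 1)"
    using basis_expansion[of x] by (simp add: scalar_mult_eq_scaleR)
  then have "p x \<le> (\<Sum>j\<in>UNIV. p ((x $ j) *\<^sub>R axis j 1))"
    using sum[of UNIV "\<lambda>j. (x $ j) *\<^sub>R axis j 1"] by simp
  also have "\<dots> = (\<Sum>j\<in>UNIV. p (axis j 1) * \<bar>x $ j\<bar>)" using p by (simp add: is_norm_def mult.commute)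
  also have "\<dots> \<le> (\<Sum>j\<in>UNIV. p (axis j 1) * s)"
    using p x by (intro sum_mono mult_left_mono) (auto simp: is_norm_def)
  finally show ?thesis by (simp add: sum_distrib_right)
qed

text \<open>The cube around \<open>k\<close> is covered by unit cubes whose lower corners lie on the
  integer grid based at its own lower corner, and each of these holds a bounded number of
  points.\<close>

lemma relatively_separated_card_cube:
  fixes X :: "(real^'d) set"
  assumes "relatively_separated X"
  obtains c where "0 \<le> c"
    "\<And>S k F. 1 \<le> S \<Longrightarrow> F \<subseteq> X \<Longrightarrow> finite F \<Longrightarrow>
      real (card {l \<in> F. \<forall>j. \<bar>k $ j - l $ j\<bar> \<le> real S}) \<le> c * real S ^ CARD('d)"
proof -
  obtain n where n: "\<And>x. finite (X \<inter> (+) x ` cbox 0 1)" "\<And>x. card (X \<inter> (+) x ` cbox 0 1) \<le> n"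
    using assms unfolding relatively_separated_def by blast
  have "real (card {l \<in> F. \<forall>j. \<bar>k $ j - l $ j\<bar> \<le> real S}) \<le> (real n * 3 ^ CARD('d)) * real S ^ CARD('d)"
    if S: "1 \<le> S" and F: "F \<subseteq> X" "finite F" for S k F
  proof -
    let ?G = "{l \<in> F. \<forall>j. \<bar>k $ j - l $ j\<bar> \<le> real S}"
    \<comment> \<open>A coordinate difference of exactly \<open>S\<close> has integer part
      \<open>2 * S\<close> after the shift by \<open>S\<close>, so this index is included. The
      resulting \<open>2 * S + 1\<close> cubes per axis are at most \<open>3 * S\<close>, as
      \<open>1 \<le> S\<close>.\<close>
    define I where "I = (UNIV :: 'd set) \<rightarrow>\<^sub>E {0..2 * int S}"
    define base where "base m = (\<chi> j. k $ j - real S + real_of_int (m j))" for m :: "'d \<Rightarrow> int"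
    have I: "finite I" "card I = (2 * S + 1) ^ CARD('d)"
      by (simp_all add: I_def finite_PiE card_PiE nat_add_distrib nat_mult_distrib)
    have "?G \<subseteq> (\<Union>m\<in>I. X \<inter> (+) (base m) ` cbox 0 1)"
    proof
      fix l assume l: "l \<in> ?G"
      define m where "m j = \<lfloor>l $ j - k $ j + real S\<rfloor>" for j
      have b: "- real S \<le> l $ j - k $ j" "l $ j - k $ j \<le> real S" for j
        using l by (auto simp: abs_le_iff) (smt (verit))+
      have "0 \<le> m j" "m j \<le> 2 * int S" for j
        unfolding m_def using b[of j] by linarith+
      then have "m \<in> I" by (simp add: I_def PiE_iff)
      moreover have "l - base m \<in> cbox 0 1"
        unfolding mem_box_cart
      proof
        fix j
        have "(l - base m) $ j = (l $ j - k $ j + real S) - real_of_int (m j)"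
          by (simp add: base_def)
        then show "(0 :: real^'d) $ j \<le> (l - base m) $ j \<and> (l - base m) $ j \<le> (1 :: real^'d) $ j"
          unfolding m_def by simp linarith
      qed
      then have "l \<in> (+) (base m) ` cbox 0 1" by (intro image_eqI[of _ _ "l - base m"]) auto
      ultimately show "l \<in> (\<Union>m\<in>I. X \<inter> (+) (base m) ` cbox 0 1)" using l F by auto
    qed
    then have "card ?G \<le> card (\<Union>m\<in>I. X \<inter> (+) (base m) ` cbox 0 1)"
      by (intro card_mono finite_UN_I n(1) I(1))
    also have "\<dots> \<le> (\<Sum>m\<in>I. card (X \<inter> (+) (base m) ` cbox 0 1))" by (rule card_UN_le[OF I(1)])
    also have "\<dots> \<le> (\<Sum>m\<in>I. n)" by (intro sum_mono n(2))
    also have "\<dots> = (2 * S + 1) ^ CARD('d) * n" by (simp add: I(2))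
    also have "\<dots> \<le> (3 * S) ^ CARD('d) * n" using S by (intro mult_right_mono power_mono) auto
    finally have "real (card ?G) \<le> real ((3 * S) ^ CARD('d) * n)" by (rule of_nat_mono)
    then show ?thesis by (simp add: power_mult_distrib mult_ac)
  qed
  then show ?thesis using that[of "real n * 3 ^ CARD('d)"] by simp
qed

text \<open>Connects the sums in \<open>[0, \<infinity>]\<close> that define
  \<open>schur_class\<close> with the partial sums in \<open>schur_bound\<close>: for nonnegative
  terms the infinite sum is the supremum of the finite ones.\<close>

lemma SUP_infsum_finite_iff:
  fixes g :: "'i \<Rightarrow> 'i \<Rightarrow> real"
  assumes g: "\<And>k l. 0 \<le> g k l"
  shows "(SUP k\<in>X. \<Sum>\<^sub>\<infinity>l\<in>X. ennreal (g k l)) < \<infinity> \<longleftrightarrow>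
    (\<exists>c\<ge>0. \<forall>k\<in>X. \<forall>F. finite F \<longrightarrow> F \<subseteq> X \<longrightarrow> (\<Sum>l\<in>F. g k l) \<le> c)"
    (is "?S < \<infinity> \<longleftrightarrow> ?R")
proof
  assume fin: "?S < \<infinity>"
  show ?R
  proof (intro exI[of _ "enn2real ?S"] conjI ballI allI impI)
    fix k F assume k: "k \<in> X" and F: "finite F" "F \<subseteq> X"
    have "ennreal (\<Sum>l\<in>F. g k l) = (\<Sum>l\<in>F. ennreal (g k l))" using g by (simp add: sum_ennreal)
    also have "\<dots> \<le> (\<Sum>\<^sub>\<infinity>l\<in>X. ennreal (g k l))"
      using F by (subst nonneg_infsum_complete) (auto intro: SUP_upper)
    also have "\<dots> \<le> ?S" by (rule SUP_upper[OF k])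
    finally have "enn2real (ennreal (\<Sum>l\<in>F. g k l)) \<le> enn2real ?S" using fin by (intro enn2real_mono) auto
    then show "(\<Sum>l\<in>F. g k l) \<le> enn2real ?S" using g by (simp add: sum_nonneg)
  qed simp
next
  assume ?R
  then obtain c where c: "0 \<le> c" "\<And>k F. k \<in> X \<Longrightarrow> finite F \<Longrightarrow> F \<subseteq> X \<Longrightarrow> (\<Sum>l\<in>F. g k l) \<le> c"
    by blast
  have "?S \<le> ennreal c"
  proof (rule SUP_least)
    fix k assume k: "k \<in> X"
    show "(\<Sum>\<^sub>\<infinity>l\<in>X. ennreal (g k l)) \<le> ennreal c"
    proof (rule infsum_le_finite_sums)
      fix F assume "finite F" "F \<subseteq> X"
      then show "(\<Sum>l\<in>F. ennreal (g k l)) \<le> ennreal c"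
        using c(2)[OF k] g by (simp add: sum_ennreal ennreal_leI)
    qed (rule nonneg_summable_on_complete, simp)
  qed
  then show "?S < \<infinity>" using le_less_trans ennreal_less_top by (metis infinity_ennreal_def)
qed

lemma schur_class_eq:
  fixes X :: "(real^'d) set"
  assumes \<nu>: "\<And>x. 0 < \<nu> x"
  shows "schur_class X \<nu> \<alpha> = (schur_matrices X (\<lambda>k l. \<nu> (k - l) * poly_weight 1 \<alpha> (k - l)) ::
    (real^'d, 'h::chilbert_space) op_matrix set)" (is "_ = schur_matrices X ?W")
proof -
  have eq: "(\<Prod>j\<in>UNIV. (1 + \<bar>k $ j - l $ j\<bar>) ^ \<alpha> j) * norm (A k l) * \<nu> (k - l) = ?W k l * norm (A k l)"
    for k l and A :: "(real^'d, 'h) op_matrix"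
    by (simp add: poly_weight_def mult_ac)
  have W: "0 \<le> ?W k l * norm (A k l)" for k l and A :: "(real^'d, 'h) op_matrix"
    unfolding poly_weight_def
    by (intro mult_nonneg_nonneg prod_nonneg less_imp_le[OF \<nu>] norm_ge_zero) simp
  have "A \<in> schur_class X \<nu> \<alpha> \<longleftrightarrow> A \<in> schur_matrices X ?W" for A :: "(real^'d, 'h) op_matrix"
  proof -
    have row: "(SUP k\<in>X. \<Sum>\<^sub>\<infinity>l\<in>X. ennreal (?W k l * norm (A k l))) < \<infinity> \<longleftrightarrow>
      (\<exists>c\<ge>0. \<forall>i\<in>X. \<forall>F. finite F \<longrightarrow> F \<subseteq> X \<longrightarrow> (\<Sum>l\<in>F. ?W i l * norm (A i l)) \<le> c)"
      by (rule SUP_infsum_finite_iff[OF W[of _ _ A]])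
    have col: "(SUP l\<in>X. \<Sum>\<^sub>\<infinity>k\<in>X. ennreal (?W k l * norm (A k l))) < \<infinity> \<longleftrightarrow>
      (\<exists>c\<ge>0. \<forall>i\<in>X. \<forall>F. finite F \<longrightarrow> F \<subseteq> X \<longrightarrow> (\<Sum>k\<in>F. ?W k i * norm (A k i)) \<le> c)"
      by (rule SUP_infsum_finite_iff[where g = "\<lambda>i k. ?W k i * norm (A k i)", OF W[of _ _ A]])
    have "(\<exists>c. schur_bound X ?W A c) \<longleftrightarrow>
      (\<exists>c\<ge>0. \<forall>i\<in>X. \<forall>F. finite F \<longrightarrow> F \<subseteq> X \<longrightarrow> (\<Sum>l\<in>F. ?W i l * norm (A i l)) \<le> c) \<and>
      (\<exists>c\<ge>0. \<forall>i\<in>X. \<forall>F. finite F \<longrightarrow> F \<subseteq> X \<longrightarrow> (\<Sum>k\<in>F. ?W k i * norm (A k i)) \<le> c)"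
      (is "?L \<longleftrightarrow> ?R1 \<and> ?R2")
    proof
      assume ?L
      then obtain c where c: "schur_bound X ?W A c" by blast
      show "?R1 \<and> ?R2"
        by (intro conjI exI[of _ c] ballI allI impI; rule schur_boundD[OF c])
    next
      assume R: "?R1 \<and> ?R2"
      from conjunct1[OF R] obtain a where a: "0 \<le> a"
        "\<forall>i\<in>X. \<forall>F. finite F \<longrightarrow> F \<subseteq> X \<longrightarrow> (\<Sum>l\<in>F. ?W i l * norm (A i l)) \<le> a"
        by (elim exE conjE) (rule that)
      from conjunct2[OF R] obtain b where b: "0 \<le> b"
        "\<forall>i\<in>X. \<forall>F. finite F \<longrightarrow> F \<subseteq> X \<longrightarrow> (\<Sum>k\<in>F. ?W k i * norm (A k i)) \<le> b"
        by (elim exE conjE) (rule that)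
      have "schur_bound X ?W A (max a b)"
      proof (rule schur_boundI)
        fix i F assume F: "i \<in> X" "finite F" "F \<subseteq> X"
        show "(\<Sum>l\<in>F. ?W i l * norm (A i l)) \<le> max a b"
          by (rule order_trans[OF a(2)[rule_format, OF F] max.cobounded1])
        show "(\<Sum>k\<in>F. ?W k i * norm (A k i)) \<le> max a b"
          by (rule order_trans[OF b(2)[rule_format, OF F] max.cobounded2])
      qed (simp add: a(1) max.coboundedI1)
      then show ?L by blast
    qed
    then show ?thesis
      unfolding schur_class_def schur_matrices_def mem_Collect_eq eq row col by (simp only:)
  qed
  then show ?thesis by blast
qed

text \<open>The weight \<open>exp (\<rho> (p x + T) - \<rho> T)\<close> is equivalent to \<open>\<nu>\<close>. For large \<open>T\<close> it is almost 1 on the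
  cube of size \<open>S\<close>, because the increments of \<open>\<rho>\<close> tend to 0; by concavity its quotient by \<open>\<nu>\<close>
  decreases in \<open>p x\<close>, so outside of the cube it is controlled by the values at the boundary.\<close>

lemma admissible_weight_approx:
  fixes \<nu> :: "real^'d \<Rightarrow> real" and S :: nat
  assumes \<nu>: "admissible_weight \<nu>" and pos: "0 < \<delta>" "0 < C"
    and growth: "\<And>x. \<nu> x \<ge> C * (1 + norm x) powr \<delta>" and S: "1 \<le> S"
  shows "\<exists>V K. submultiplicative_weight V \<and> 0 \<le> K \<and> (\<forall>x. \<nu> x \<le> K * V x) \<and>
    (\<forall>x. V x \<le> (if \<forall>j. \<bar>x $ j\<bar> \<le> real S then 2 else 2 / C * real S powr - \<delta> * \<nu> x))"
proof -
  obtain p \<rho> where p: "is_norm p" and "concave_on {0..} \<rho>" "\<forall>t\<ge>0. 0 \<le> \<rho> t" "\<rho> 0 = 0"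
    and \<nu>_eq: "\<And>x. \<nu> x = exp (\<rho> (p x))"
    using \<nu> unfolding admissible_weight_def by blast
  then interpret concave_growth \<rho> by unfold_locales auto
  have p0: "0 \<le> p x" for x using p by (simp add: is_norm_def)
  have p_scale: "p (r *\<^sub>R x) = \<bar>r\<bar> * p x" for r x using p by (simp add: is_norm_def)
  define M where "M = (\<Sum>j\<in>UNIV. p (axis j (1::real)))"
  have M_pos: "0 < M"
    unfolding M_def
  proof (rule sum_pos)
    have "axis j (1::real) \<noteq> 0" for j :: 'd by (simp add: axis_eq_0_iff)
    then show "0 < p (axis j 1)" for j :: 'd using p p0[of "axis j 1"] unfolding is_norm_def by (metis less_eq_real_def)
  qed auto
  \<comment> \<open>The \<open>p\<close>-ball of radius \<open>s\<close> contains the cube of size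
    \<open>S\<close>. As \<nu> depends on \<open>p\<close> only, any single point \<open>z\<close>
    with \<open>p z = s\<close> represents the whole sphere.\<close>
  define s where "s = M * real S"
  have s_pos: "0 < s" using M_pos S by (simp add: s_def)
  obtain z where z: "p z = s"
  proof -
    obtain j :: 'd where True by simp
    have j: "p (axis j 1) \<noteq> 0" using p unfolding is_norm_def by (simp add: axis_eq_0_iff)
    show ?thesis
      by (rule that[of "(s / p (axis j 1)) *\<^sub>R axis j 1"])
        (use s_pos p0[of "axis j 1"] j in \<open>simp add: p_scale\<close>)
  qed
  \<comment> \<open>The constant \<open>M\<close> also bounds \<open>p\<close> by the Euclidean
    norm, so \<open>z\<close> is far enough out for the growth condition to bound
    \<open>\<nu> z\<close> below by \<open>C * real S powr \<delta>\<close>.\<close>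
  have norm_z: "real S \<le> norm z"
  proof -
    have "p z \<le> M * norm z" unfolding M_def by (rule is_norm_le_sup[OF p component_le_norm_cart])
    then show ?thesis using M_pos by (simp add: z s_def)
  qed
  have growth_S: "C * real S powr \<delta> \<le> \<nu> x" if "real S \<le> norm x" for x
  proof -
    have "real S powr \<delta> \<le> (1 + norm x) powr \<delta>" using that pos by (intro powr_mono2) auto
    then have "C * real S powr \<delta> \<le> C * (1 + norm x) powr \<delta>" using pos by (intro mult_left_mono) auto
    then show ?thesis using growth[of x] by linarith
  qed
  \<comment> \<open>If every increment over a length \<open>s\<close> exceeded \<open>ln 2\<close>,
    then \<nu> at the \<open>n\<close>-th multiple of \<open>z\<close> would be at least
    \<open>2 ^ n\<close>, against the root condition at \<open>z\<close>.\<close>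
  have "\<exists>T\<ge>0. \<rho> (s + T) - \<rho> T \<le> ln 2"
  proof (rule ccontr)
    assume "\<not> ?thesis"
    then have inc: "\<rho> T + ln 2 < \<rho> (s + T)" if "0 \<le> T" for T using that by force
    have low: "real n * ln 2 \<le> \<rho> (real n * s)" for n
    proof (induction n)
      case (Suc n)
      have "\<rho> (real n * s) + ln 2 < \<rho> (s + real n * s)" using s_pos by (intro inc) simp
      then show ?case using Suc.IH by (simp add: algebra_simps)
    qed (simp add: zero)
    have "2 \<le> root n (\<nu> (real n *\<^sub>R z))" if "1 \<le> n" for n
    proof -
      have "2 ^ n = exp (real n * ln 2)" by (simp add: exp_of_nat_mult)
      also have "\<dots> \<le> \<nu> (real n *\<^sub>R z)" using low[of n] by (simp add: \<nu>_eq p_scale z)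
      finally have "root n (2 ^ n) \<le> root n (\<nu> (real n *\<^sub>R z))" using that by simp
      then show ?thesis using that by (simp add: real_root_power_cancel)
    qed
    moreover have "(\<lambda>n. root n (\<nu> (real n *\<^sub>R z))) \<longlonglongrightarrow> 1"
      using \<nu> unfolding admissible_weight_def by blast
    ultimately have "2 \<le> (1::real)" by (intro LIMSEQ_le_const) auto
    then show False by simp
  qed
  then obtain T where T: "0 \<le> T" "\<rho> (s + T) - \<rho> T \<le> ln 2" by blast
  interpret shifted: concave_growth "\<lambda>t. \<rho> (t + T) - \<rho> T" by (rule shift[OF T(1)])
  define V where "V x = exp (\<rho> (p x + T) - \<rho> T)" for x
  have small: "V x \<le> 2" if "p x \<le> s" for x
  proof -
    have "\<rho> (p x + T) - \<rho> T \<le> ln 2" using shifted.mono[OF p0 that] T(2) by simp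
    then have "V x \<le> exp (ln 2)" unfolding V_def by (simp only: exp_le_cancel_iff)
    then show ?thesis by simp
  qed
  \<comment> \<open>Outside the cube but inside the \<open>p\<close>-ball, \<open>V\<close> is at
    most 2 and growth at \<open>x\<close> makes \<nu> large. Beyond the ball, concavity bounds
    \<open>V / \<nu>\<close> by \<open>2 / \<nu> z\<close>, and growth is applied at
    \<open>z\<close> instead.\<close>
  have far: "V x \<le> 2 / C * real S powr - \<delta> * \<nu> x" if outside: "\<not> (\<forall>j. \<bar>x $ j\<bar> \<le> real S)" for x
  proof -
    obtain j where "real S < \<bar>x $ j\<bar>" using outside by (auto simp: not_le)
    then have x: "real S \<le> norm x" using component_le_norm_cart[of x j] by linarith
    have cancel: "2 / C * real S powr - \<delta> * (C * real S powr \<delta>) = 2"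
      using pos S by (simp add: powr_minus)
    have c: "0 \<le> 2 / C * real S powr - \<delta>" using pos by simp
    show ?thesis
    proof (cases "p x \<le> s")
      case True
      have "V x \<le> 2 / C * real S powr - \<delta> * (C * real S powr \<delta>)" using small[OF True] by (simp only: cancel)
      also have "\<dots> \<le> 2 / C * real S powr - \<delta> * \<nu> x" by (rule mult_left_mono[OF growth_S[OF x] c])
      finally show ?thesis .
    next
      case False
      have "\<rho> (p x + T) - \<rho> (p x) \<le> \<rho> (s + T) - \<rho> s"
        using False s_pos T by (intro increment_antimono) auto
      then have "\<rho> (p x + T) - \<rho> T \<le> ln 2 + (\<rho> (p x) - \<rho> s)" using T(2) by linarith
      then have "V x \<le> exp (ln 2 + (\<rho> (p x) - \<rho> s))" unfolding V_def by (simp only: exp_le_cancel_iff)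
      also have "\<dots> = 2 * \<nu> x / \<nu> z" by (simp add: exp_add exp_diff \<nu>_eq z)
      also have "\<dots> \<le> 2 * \<nu> x / (C * real S powr \<delta>)"
        using growth_S[OF norm_z] pos S by (intro divide_left_mono mult_pos_pos) (auto simp: \<nu>_eq)
      also have "\<dots> = 2 / C * real S powr - \<delta> * \<nu> x" using pos S by (simp add: powr_minus field_simps)
      finally show ?thesis .
    qed
  qed
  have "submultiplicative_weight V"
    unfolding V_def by (rule shifted.submultiplicative_weight_exp[OF p])
  moreover have "\<nu> x \<le> exp (\<rho> T) * V x" for x
  proof -
    have "\<rho> (p x) \<le> \<rho> (p x + T)" using p0 T by (intro mono) auto
    then show ?thesis by (simp add: \<nu>_eq V_def flip: exp_add)
  qed
  moreover have "V x \<le> 2" if "\<forall>j. \<bar>x $ j\<bar> \<le> real S" for x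
    by (rule small) (use is_norm_le_sup[OF p, of x "real S"] that in \<open>simp add: s_def M_def\<close>)
  ultimately show ?thesis using far by (intro exI[of _ V] exI[of _ "exp (\<rho> T)"]) auto
qed

lemma admissible_weight_submultiplicative:
  assumes "admissible_weight \<nu>" shows "submultiplicative_weight \<nu>"
proof -
  obtain p \<rho> where p: "is_norm p" and "concave_on {0..} \<rho>" "\<forall>t\<ge>0. 0 \<le> \<rho> t" "\<rho> 0 = 0"
    and \<nu>_eq: "\<And>x. \<nu> x = exp (\<rho> (p x))"
    using assms unfolding admissible_weight_def by blast
  then interpret concave_growth \<rho> by unfold_locales auto
  have "\<nu> = (\<lambda>x. exp (\<rho> (p x)))" using \<nu>_eq by blast
  then show ?thesis using submultiplicative_weight_exp[OF p] by simp
qed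

theorem corollary6p5:
  fixes X :: "(real^'d) set" and \<nu> :: "real^'d \<Rightarrow> real" and C \<delta> :: real and \<alpha> :: "'d \<Rightarrow> nat"
  assumes "separable_space (euclidean :: 'h::chilbert_space topology)"
    and "relatively_separated X"
    and "admissible_weight \<nu>"
    and "0 < \<delta>" "\<delta> \<le> 1" "0 < C"
    and "\<And>x. \<nu> x \<ge> C * (1 + norm x) powr \<delta>"
  shows "\<exists>N :: (real^'d, 'h) op_matrix \<Rightarrow> real.
    let \<A> = matrix_algebra X (schur_class X \<nu> \<alpha>) N in
      unital_banach_star_algebra \<A> \<and> solid X \<A> \<and>
      inverse_closed_via (matrix_operator X) \<A> (ell2_operators X) \<and>
      symmetric_algebra \<A>"
proof -
  define W where "W k l = \<nu> (k - l) * poly_weight 1 \<alpha> (k - l)" for k l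
  have \<nu>_pos: "0 < \<nu> x" for x using assms(3) by (simp add: admissible_weight_def weight_def)
  have class_eq: "schur_class X \<nu> \<alpha> = (schur_matrices X W :: (real^'d, 'h) op_matrix set)"
    unfolding W_def by (rule schur_class_eq[OF \<nu>_pos])
  obtain c where c: "0 \<le> c" and card: "\<And>S k F. 1 \<le> S \<Longrightarrow> F \<subseteq> X \<Longrightarrow> finite F \<Longrightarrow>
      real (card {l \<in> F. \<forall>j. \<bar>k $ j - l $ j\<bar> \<le> real S}) \<le> c * real S ^ CARD('d)"
    using relatively_separated_card_cube[OF assms(2)] by blast
  interpret schur_weight X W
    unfolding W_def
    by (rule schur_weight_translation[OF submultiplicative_weight_mult[OF
          admissible_weight_submultiplicative[OF assms(3)] submultiplicative_weight_poly]]) simp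
  interpret schur_weight_approx X W "\<lambda>S k l. \<forall>j. \<bar>k $ j - l $ j\<bar> \<le> real S" "CARD('d)" c "2 / C" \<delta>
  proof
    fix S :: nat assume S: "1 \<le> S"
    obtain U K where U: "submultiplicative_weight U" and K: "0 \<le> K" "\<And>x. \<nu> x \<le> K * U x"
      and U_le: "\<And>x. U x \<le> (if \<forall>j. \<bar>x $ j\<bar> \<le> real S then 2 else 2 / C * real S powr - \<delta> * \<nu> x)"
      using admissible_weight_approx[OF assms(3,4,6,7) S] by blast
    obtain \<eta> where \<eta>: "0 < \<eta>" "\<eta> \<le> 1"
      and \<eta>_le: "\<And>x :: real^'d. \<forall>j. \<bar>x $ j\<bar> \<le> real S \<Longrightarrow> poly_weight \<eta> \<alpha> x \<le> 2"
      using poly_weight_small[of "real S" \<alpha>] by blast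
    have poly: "submultiplicative_weight (poly_weight \<eta> \<alpha>)"
      using \<eta> by (intro submultiplicative_weight_poly) simp
    have U0: "0 \<le> U x" for x using U order_trans[OF zero_le_one] unfolding submultiplicative_weight_def by blast
    have P0: "0 \<le> poly_weight \<eta> \<alpha> x" for x
      using poly order_trans[OF zero_le_one] unfolding submultiplicative_weight_def by blast
    have P1: "0 \<le> poly_weight 1 \<alpha> x" for x
      using P0 poly_weight_le[of \<eta> \<alpha> x] \<eta> by (meson less_imp_le order_trans)
    define V where "V k l = U (k - l) * poly_weight \<eta> \<alpha> (k - l)" for k l
    define L where "L = K * (\<Prod>j\<in>UNIV. (1 / \<eta>) ^ \<alpha> j)"
    have "schur_weight V"
      unfolding V_def by (rule schur_weight_translation[OF submultiplicative_weight_mult[OF U poly]])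
    moreover have "W k l \<le> L * V k l" for k l
    proof -
      have "W k l \<le> (K * U (k - l)) * ((\<Prod>j\<in>UNIV. (1 / \<eta>) ^ \<alpha> j) * poly_weight \<eta> \<alpha> (k - l))"
        unfolding W_def by (intro mult_mono K poly_weight_equiv \<eta> P1 mult_nonneg_nonneg U0)
      then show ?thesis by (simp only: L_def V_def mult_ac)
    qed
    moreover have "V k l \<le> (if \<forall>j. \<bar>k $ j - l $ j\<bar> \<le> real S then 4 else 2 / C * real S powr - \<delta> * W k l)" for k l
    proof (cases "\<forall>j. \<bar>(k - l) $ j\<bar> \<le> real S")
      case True
      \<comment> \<open>One factor 2 comes from the shifted version of \<nu>, the other from the
        dilated polynomial: this is the 4 of the locale.\<close>
      have "V k l \<le> 2 * 2"
        unfolding V_def using U_le[of "k - l"] \<eta>_le[OF True] True P0 by (intro mult_mono) auto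
      then show ?thesis using True by simp
    next
      case False
      \<comment> \<open>All decay off the cube is taken from \<open>U\<close>; the dilated
        polynomial is bounded by the original one, as \<open>\<eta> \<le> 1\<close>.\<close>
      have U': "U (k - l) \<le> 2 / C * real S powr - \<delta> * \<nu> (k - l)" using U_le[of "k - l"] unfolding if_not_P[OF False] .
      have "V k l \<le> (2 / C * real S powr - \<delta> * \<nu> (k - l)) * poly_weight 1 \<alpha> (k - l)"
        unfolding V_def
        by (rule mult_mono[OF U' poly_weight_le]) (use \<eta> P0 order_trans[OF U0 U'] in auto)
      moreover have "\<not> (\<forall>j. \<bar>k $ j - l $ j\<bar> \<le> real S)" using False by simp
      ultimately show ?thesis by (simp only: W_def mult.assoc if_False)
    qed
    ultimately show "\<exists>V K. schur_weight V \<and> (\<forall>k l. W k l \<le> K * V k l) \<and>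
        (\<forall>k l. V k l \<le> (if \<forall>j. \<bar>k $ j - l $ j\<bar> \<le> real S then 4 else 2 / C * real S powr - \<delta> * W k l))"
      by blast
  qed (use assms(4,6) c card in \<open>auto simp: abs_minus_commute\<close>)
  show ?thesis
    unfolding class_eq Let_def
    using unital_banach_star_algebra_alg solid_alg inverse_closed_alg symmetric_alg by blast
qed

end
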